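(* Let $1<p,q<\infty$ and $\alpha>-1$. Let $\Phi\in\mathscr{L}\cup\mathscr{U}$, let $\vec{\varepsilon}\in\{0,1\}^2$, put $\omega=\mathcal{T}_\Phi^{\vec{\varepsilon}}$, and let $k\in\mathbb{R}$. Let $p',q'$ be the conjugate exponents of $p,q$. Then the dual space $\left(A^{p,q}_{\omega^k,\alpha}(\mathbb{C}_+)\right)^*$ identifies with $A^{p',q'}_{\omega^{k(1-q')},\alpha}(\mathbb{C}_+)$ under the duality pairing $$\langle f,g\rangle_\alpha:=\int_{\mathbb{C}_+}f(z)\overline{g(z)}\,dV_\alpha(z),\qquad f\in A^{p,q}_{\omega^k,\alpha}(\mathbb{C}_+),\ g\in A^{p',q'}_{\omega^{k(1-q')},\alpha}(\mathbb{C}_+);$$ that is, each such $g$ defines a bounded linear functional $f\mapsto\langle f,g\rangle_\alpha$ on $A^{p,q}_{\omega^k,\alpha}(\mathbb{C}_+)$, every bounded linear functional on $A^{p,q}_{\omega^k,\alpha}(\mathbb{C}_+)$ is of this form for a unique $g\in A^{p',q'}_{\omega^{k(1-q')},\alpha}(\mathbb{C}_+)$, and the norm of the functional is equivalent to the norm of $g$.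
   Context: $\mathbb{C}_+=\{z\in\mathbb{C}:\operatorname{Im} z>0\}$, $dV_\alpha(x+iy)=y^\alpha\,dx\,dy$. Growth functions and weights: a growth function is a continuous, nondecreasing, onto function $\Phi:[0,\infty)\to[0,\infty)$, not identically null. For $r>0$, $\Phi$ is of upper-type $r$ (resp. lower-type $r$) if there is $C_r>0$ such that for all $t\ge 1$ (resp. all $0<t\le 1$) and all $s>0$, $\Phi(st)\le C_r t^r\Phi(s)$. $\mathscr{U}^r$ ($r\ge1$) is the set of growth functions of upper-type $r$ such that $t\mapsto\Phi(t)/t$ is nondecreasing on $(0,\infty)$; $\mathscr{L}_r$ ($0<r\le1$) is the set of growth functions of lower-type $r$ such that $t\mapsto\Phi(t)/t$ is nonincreasing on $(0,\infty)$. $\mathscr{U}=\bigcup_{r\ge1}\mathscr{U}^r$, $\mathscr{L}=\bigcup_{0<r\le1}\mathscr{L}_r$. For $\vec{\varepsilon}=(\varepsilon_1,\varepsilon_2)\in\{0,1\}^2$ and $t>0$, $\mathcal{T}_\Phi^{\vec{\varepsilon}}(t)=1+\varepsilon_1\ln_+(\Phi(1/t))+\varepsilon_2\ln_+(\Phi(t))$, where $\ln_+=\max(\ln,0)$. Spaces: for a weight $\Omega$ on $(0,\infty)$ and $1\le p,q<\infty$, $A^{p,q}_{\Omega,\alpha}(\mathbb{C}_+)$ is the space of holomorphic functions $f$ on $\mathbb{C}_+$ such that $\|f\|^q_{A^{p,q}_{\Omega,\alpha}}:=\int_0^\infty\left(\int_{\mathbb{R}}|f(x+iy)|^p\,dx\right)^{q/p}\Omega(y)y^\alpha\,dy<\infty$.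 *)

theory Defs
  imports "HOL-Complex_Analysis.Complex_Analysis"
begin

definition upper_half_plane :: "complex set" (\<open>\<complex>\<^sub>+\<close>)
  where "\<complex>\<^sub>+ = {z. Im z > 0}"

definition dV :: "real \<Rightarrow> complex measure"
  where "dV \<alpha> = density lborel (\<lambda>z. ennreal (indicator \<complex>\<^sub>+ z * Im z powr \<alpha>))"

text \<open>Functions on \<open>[0,\<infinity>)\<close> are represented by total functions on the reals; only the
  values on \<open>{0..}\<close> matter.\<close>

definition growth_function :: "(real \<Rightarrow> real) \<Rightarrow> bool"
  where "growth_function \<Phi> \<longleftrightarrow>
    continuous_on {0..} \<Phi> \<and> mono_on {0..} \<Phi> \<and> \<Phi> ` {0..} = {0..} \<and> (\<exists>t\<ge>0. \<Phi> t \<noteq> 0)"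

definition upper_type :: "real \<Rightarrow> (real \<Rightarrow> real) \<Rightarrow> bool"
  where "upper_type r \<Phi> \<longleftrightarrow>
    (\<exists>C>0. \<forall>t\<ge>1. \<forall>s>0. \<Phi> (s * t) \<le> C * t powr r * \<Phi> s)"

definition lower_type :: "real \<Rightarrow> (real \<Rightarrow> real) \<Rightarrow> bool"
  where "lower_type r \<Phi> \<longleftrightarrow>
    (\<exists>C>0. \<forall>t. 0 < t \<and> t \<le> 1 \<longrightarrow> (\<forall>s>0. \<Phi> (s * t) \<le> C * t powr r * \<Phi> s))"

definition U_class :: "real \<Rightarrow> (real \<Rightarrow> real) set"
  where "U_class r =
    {\<Phi>. growth_function \<Phi> \<and> upper_type r \<Phi> \<and> mono_on {0<..} (\<lambda>t. \<Phi> t / t)}"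

definition L_class :: "real \<Rightarrow> (real \<Rightarrow> real) set"
  where "L_class r =
    {\<Phi>. growth_function \<Phi> \<and> lower_type r \<Phi> \<and> antimono_on {0<..} (\<lambda>t. \<Phi> t / t)}"

definition U_functions :: "(real \<Rightarrow> real) set" (\<open>\<U>\<close>)
  where "\<U> = (\<Union>r\<in>{1..}. U_class r)"

definition L_functions :: "(real \<Rightarrow> real) set" (\<open>\<L>\<close>)
  where "\<L> = (\<Union>r\<in>{0<..1}. L_class r)"

definition ln_plus :: "real \<Rightarrow> real"
  where "ln_plus x = max (ln x) 0"

definition T_weight :: "(real \<Rightarrow> real) \<Rightarrow> nat \<times> nat \<Rightarrow> real \<Rightarrow> real"
  where "T_weight \<Phi> \<epsilon> t =
    1 + real (fst \<epsilon>) * ln_plus (\<Phi> (1 / t)) + real (snd \<epsilon>) * ln_plus (\<Phi> t)"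

text \<open>The value at infinity is the right one for positive exponents only.\<close>

definition ennreal_powr :: "ennreal \<Rightarrow> real \<Rightarrow> ennreal"
  where "ennreal_powr x a = (if x = \<infinity> then \<infinity> else ennreal (enn2real x powr a))"

definition mixed_integral ::
    "real \<Rightarrow> real \<Rightarrow> (real \<Rightarrow> real) \<Rightarrow> real \<Rightarrow> (complex \<Rightarrow> complex) \<Rightarrow> ennreal"
  where "mixed_integral p q \<Omega> \<alpha> f =
    (\<integral>\<^sup>+ y\<in>{0<..}. ennreal_powr (\<integral>\<^sup>+ x. ennreal (cmod (f (Complex x y)) powr p) \<partial>lborel) (q / p)
        * ennreal (\<Omega> y * y powr \<alpha>) \<partial>lborel)"

text \<open>A function on the half-plane is represented by its extension by zero, so that equality
  in \<open>bergman\<close> is equality of functions on the half-plane.\<close>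

definition bergman :: "real \<Rightarrow> real \<Rightarrow> (real \<Rightarrow> real) \<Rightarrow> real \<Rightarrow> (complex \<Rightarrow> complex) set"
  where "bergman p q \<Omega> \<alpha> =
    {f. f holomorphic_on \<complex>\<^sub>+ \<and> (\<forall>z. z \<notin> \<complex>\<^sub>+ \<longrightarrow> f z = 0) \<and> mixed_integral p q \<Omega> \<alpha> f < \<infinity>}"

definition bergman_norm ::
    "real \<Rightarrow> real \<Rightarrow> (real \<Rightarrow> real) \<Rightarrow> real \<Rightarrow> (complex \<Rightarrow> complex) \<Rightarrow> real"
  where "bergman_norm p q \<Omega> \<alpha> f = enn2real (mixed_integral p q \<Omega> \<alpha> f) powr (1 / q)"

definition pairing :: "real \<Rightarrow> (complex \<Rightarrow> complex) \<Rightarrow> (complex \<Rightarrow> complex) \<Rightarrow> complex"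
  where "pairing \<alpha> f g = (\<integral>z. f z * cnj (g z) \<partial>dV \<alpha>)"

text \<open>A functional on \<open>A\<close> is a total function whose values outside \<open>A\<close> are irrelevant.\<close>

definition bounded_functional ::
    "(complex \<Rightarrow> complex) set \<Rightarrow> ((complex \<Rightarrow> complex) \<Rightarrow> real)
      \<Rightarrow> ((complex \<Rightarrow> complex) \<Rightarrow> complex) \<Rightarrow> bool"
  where "bounded_functional A N L \<longleftrightarrow>
    (\<forall>f\<in>A. \<forall>g\<in>A. L (\<lambda>z. f z + g z) = L f + L g) \<and>
    (\<forall>c. \<forall>f\<in>A. L (\<lambda>z. c * f z) = c * L f) \<and>
    (\<exists>C. \<forall>f\<in>A. cmod (L f) \<le> C * N f)"

definition functional_norm ::
    "(complex \<Rightarrow> complex) set \<Rightarrow> ((complex \<Rightarrow> complex) \<Rightarrow> real)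
      \<Rightarrow> ((complex \<Rightarrow> complex) \<Rightarrow> complex) \<Rightarrow> real"
  where "functional_norm A N L = (SUP f\<in>{f \<in> A. N f \<le> 1}. cmod (L f))"

end

theory Submission
  imports Defs
begin

text \<open>
  A bounded functional \<open>L\<close> is represented by \<open>g w = cnj (L (K w))\<close>, where \<open>K\<close> is the Bergman
  kernel of the unweighted space. The weight \<open>\<omega>\<close> varies so slowly that its powers change by at most
  an arbitrarily small power under dilation. Hence Minkowski's inequality for dilations and
  translations bounds the Bergman projection on the mixed norm spaces, for all exponents and
  all \<open>k\<close>. As \<open>L\<close> commutes with the integral that defines the projection of a compactly
  supported function, the converse Hoelder inequality bounds the dual norm of \<open>g\<close>, and exhausting
  the half-plane by compact boxes gives \<open>L f = \<langle>f, g\<rangle>\<close>. Neither the Hahn-Banach theorem nor the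
  duality of the Lebesgue spaces is needed. Uniqueness is the reproducing formula.
\<close>

section \<open>Powers in the extended nonnegative reals\<close>

text \<open>Three points shape the argument. The weight \<open>\<omega>\<close> is built from
  logarithms of functions of polynomial growth, so dilation by \<open>s\<close> costs at most a
  factor of order \<open>1 + \<bar>ln s\<bar>\<close>. Minkowski's inequality leaves an integral
  over dilations that converges with margin \<open>(1 + \<alpha>) / q\<close> at infinity and
  \<open>(1 + \<alpha>) * (1 - 1 / q)\<close> at 0; both are positive for \<open>1 < q\<close> and
  absorb the loss from every power of \<open>\<omega>\<close>. The spaces need not lie in the
  unweighted Hilbert space, so the reproducing formula cannot be read off an orthogonal projection.
  It is proved for each function by Cauchy's formula on a horizontal line, which calls for an a
  priori polynomial growth bound. A functional is moved under the integral by Riemann sums whose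
  nodes serve the projection and the scalar integral at once. The function
  \<open>cnj (L (K w))\<close> is at first only known to be continuous in \<open>w\<close>; it turns
  out to be holomorphic at the end, when the representation applied to kernels shows that the
  projection reproduces it. The constants of the norm equivalence are 1 and the inverse of the bound
  of the projection.\<close>

lemma ennreal_powr_ennreal: "0 \<le> r \<Longrightarrow> ennreal_powr (ennreal r) a = ennreal (r powr a)"
  by (simp add: ennreal_powr_def)

lemma ennreal_powr_top [simp]: "ennreal_powr top a = top"
  by (simp add: ennreal_powr_def)

lemma ennreal_powr_0 [simp]: "ennreal_powr 0 a = 0"
  by (simp add: ennreal_powr_def)

lemma ennreal_powr_one [simp]: "ennreal_powr x 1 = x"
  by (cases x) (auto simp: ennreal_powr_ennreal)

lemma ennreal_powr_eq_0_iff [simp]: "ennreal_powr x a = 0 \<longleftrightarrow> x = 0"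
  by (cases x) (auto simp: ennreal_powr_ennreal)

lemma ennreal_powr_eq_top_iff [simp]: "ennreal_powr x a = top \<longleftrightarrow> x = top"
  by (cases x) (auto simp: ennreal_powr_ennreal)

lemma ennreal_powr_less_top_iff [simp]: "ennreal_powr x a < top \<longleftrightarrow> x < top"
  by (metis ennreal_powr_eq_top_iff top.not_eq_extremum)

lemma ennreal_powr_powr: "ennreal_powr (ennreal_powr x a) b = ennreal_powr x (a * b)"
  by (cases x) (auto simp: ennreal_powr_ennreal powr_powr)

text \<open>Valid for every real exponent, negative ones included: \<open>ennreal_powr\<close> fixes
  0 and \<open>top\<close> whatever the exponent, so the convention \<open>0 * top = 0\<close> acts
  alike on both sides. The same behaviour at 0 and \<open>top\<close> frees
  \<open>ennreal_powr_add\<close> from side conditions.\<close>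

lemma ennreal_powr_mult: "ennreal_powr (x * y) a = ennreal_powr x a * ennreal_powr y a"
proof (cases x; cases y)
  fix r s assume "x = ennreal r" "y = ennreal s" "0 \<le> r" "0 \<le> s"
  then show ?thesis
    by (simp add: ennreal_powr_ennreal powr_mult flip: ennreal_mult)
qed (cases "x = 0"; cases "y = 0"; auto simp: ennreal_mult_top ennreal_top_mult)+

lemma ennreal_powr_add: "ennreal_powr x (a + b) = ennreal_powr x a * ennreal_powr x b"
proof (cases x)
  case (real r)
  then show ?thesis
    by (simp add: ennreal_powr_ennreal powr_add flip: ennreal_mult)
qed (auto simp: ennreal_top_mult)

lemma ennreal_powr_mono:
  assumes "x \<le> y" "0 \<le> a" shows "ennreal_powr x a \<le> ennreal_powr y a"
proof (cases y)
  case (real r)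
  with assms show ?thesis
    by (cases x) (auto simp: ennreal_powr_ennreal intro!: ennreal_leI powr_mono2 simp: top_unique)
qed auto

lemma ennreal_powr_le_cancel:
  assumes "ennreal_powr x a \<le> y" "0 < a" shows "x \<le> ennreal_powr y (1 / a)"
  using ennreal_powr_mono[OF assms(1), of "1 / a"] assms(2) by (simp add: ennreal_powr_powr)

lemma ennreal_powr_le_iff:
  assumes "0 < a" shows "ennreal_powr x a \<le> ennreal_powr y a \<longleftrightarrow> x \<le> y"
  using ennreal_powr_mono[of x y a] ennreal_powr_le_cancel[of x a "ennreal_powr y a"] assms
  by (auto simp: ennreal_powr_powr)

lemma ennreal_powr_less_iff:
  assumes "0 < a" shows "ennreal_powr x a < ennreal_powr y a \<longleftrightarrow> x < y"
  using ennreal_powr_le_iff[OF assms] by (meson not_le)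

lemma measurable_ennreal_powr [measurable]: "(\<lambda>x. ennreal_powr x a) \<in> borel_measurable borel"
  unfolding ennreal_powr_def[abs_def] by measurable

text \<open>For positive \<open>a\<close> the power is an order automorphism with inverse the power
  \<open>1 / a\<close>, and the topology of \<open>ennreal\<close> is the order topology.\<close>

lemma tendsto_ennreal_powr:
  assumes f: "(f \<longlongrightarrow> x) F" and a: "0 < a"
  shows "((\<lambda>i. ennreal_powr (f i) a) \<longlongrightarrow> ennreal_powr x a) F"
proof (rule order_tendstoI)
  have inv: "ennreal_powr (ennreal_powr l (1 / a)) a = l" for l
    using a by (simp add: ennreal_powr_powr)
  fix l
  show "l < ennreal_powr x a \<Longrightarrow> \<forall>\<^sub>F i in F. l < ennreal_powr (f i) a"
    using order_tendstoD(1)[OF f, of "ennreal_powr l (1 / a)"] ennreal_powr_less_iff[OF a]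
    by (metis (mono_tags, lifting) eventually_mono inv)
  show "ennreal_powr x a < l \<Longrightarrow> \<forall>\<^sub>F i in F. ennreal_powr (f i) a < l"
    using order_tendstoD(2)[OF f, of "ennreal_powr l (1 / a)"] ennreal_powr_less_iff[OF a]
    by (metis (mono_tags, lifting) eventually_mono inv)
qed

text \<open>From \<open>x + y \<le> 2 * max x y\<close>. The crude constant is harmless: the bound
  serves only to show that sums of functions of finite norm have finite norm.\<close>

lemma ennreal_powr_add_le:
  assumes "0 \<le> a"
  shows "ennreal_powr (x + y) a \<le> ennreal (2 powr a) * (ennreal_powr x a + ennreal_powr y a)"
proof -
  have "ennreal_powr (x + y) a \<le> ennreal_powr (ennreal 2 * max x y) a"
  proof (rule ennreal_powr_mono[OF _ assms])
    have "x + y \<le> max x y + max x y" by (intro add_mono) auto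
    then show "x + y \<le> ennreal 2 * max x y" by (simp add: mult_2)
  qed
  also have "\<dots> = ennreal (2 powr a) * ennreal_powr (max x y) a"
    by (simp add: ennreal_powr_mult ennreal_powr_ennreal del: ennreal_numeral)
  also have "\<dots> \<le> ennreal (2 powr a) * (ennreal_powr x a + ennreal_powr y a)"
    by (intro mult_left_mono) (auto simp: max_def)
  finally show ?thesis .
qed

lemma conjugate_exponent_gt_1:
  assumes "1 < p" "1 / p + 1 / q = (1::real)"
  shows "1 < q"
proof -
  have "1 / q = 1 - 1 / p" using assms by simp
  then have "0 < 1 / q" "1 / q < 1" using assms(1) by auto
  then show ?thesis by (auto simp: field_simps split: if_splits)
qed

lemma ennreal_Young:
  assumes "1 < p" "1 / p + 1 / q = (1::real)"
  shows "x * y \<le> ennreal (1 / p) * ennreal_powr x p + ennreal (1 / q) * ennreal_powr y q"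
proof -
  have q: "1 < q" using assms by (rule conjugate_exponent_gt_1)
  show ?thesis
  proof (cases "x = top \<or> y = top")
    case True
    then show ?thesis using assms q by (auto simp: ennreal_mult_top)
  next
    case False
    then obtain r s where "x = ennreal r" "y = ennreal s" "0 \<le> r" "0 \<le> s"
      by (metis ennreal_cases)
    then show ?thesis
      using Youngs_inequality[of p q r s] assms q
      by (simp add: ennreal_powr_ennreal flip: ennreal_mult ennreal_plus)
  qed
qed

section \<open>\<open>L\<^sup>p\<close>-norms of nonnegative functions\<close>

text \<open>Values in \<open>ennreal\<close> let Hoelder, Minkowski and the operator bounds be
  stated without integrability hypotheses.\<close>

definition enorm :: "real \<Rightarrow> 'a measure \<Rightarrow> ('a \<Rightarrow> ennreal) \<Rightarrow> ennreal"
  where "enorm p M f = ennreal_powr (\<integral>\<^sup>+ x. ennreal_powr (f x) p \<partial>M) (1 / p)"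

lemma enorm_powr: "0 < p \<Longrightarrow> ennreal_powr (enorm p M f) p = (\<integral>\<^sup>+ x. ennreal_powr (f x) p \<partial>M)"
  by (simp add: enorm_def ennreal_powr_powr)

lemma enorm_mono_AE:
  "0 < p \<Longrightarrow> (AE x in M. f x \<le> g x) \<Longrightarrow> enorm p M f \<le> enorm p M g"
  unfolding enorm_def
  by (intro ennreal_powr_mono nn_integral_mono_AE) (auto elim!: eventually_mono intro: ennreal_powr_mono)

lemma enorm_mono: "0 < p \<Longrightarrow> (\<And>x. x \<in> space M \<Longrightarrow> f x \<le> g x) \<Longrightarrow> enorm p M f \<le> enorm p M g"
  by (intro enorm_mono_AE AE_I2)

lemma enorm_cong_AE:
  "(AE x in M. f x = g x) \<Longrightarrow> enorm p M f = enorm p M g"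
  unfolding enorm_def
  by (intro arg_cong[of _ _ "\<lambda>t. ennreal_powr t (1 / p)"] nn_integral_cong_AE) (auto elim!: eventually_mono)

lemma enorm_cmult:
  assumes [measurable]: "f \<in> borel_measurable M" and "0 < p"
  shows "enorm p M (\<lambda>x. c * f x) = c * enorm p M f"
  using assms(2) by (simp add: enorm_def ennreal_powr_mult nn_integral_cmult ennreal_powr_powr)

lemma enorm_eq_0D:
  assumes [measurable]: "f \<in> borel_measurable M" and "enorm p M f = 0"
  shows "AE x in M. f x = 0"
  using assms(2) by (simp add: enorm_def nn_integral_0_iff_AE)

lemma enorm_add_lt_top:
  assumes [measurable]: "f \<in> borel_measurable M" "g \<in> borel_measurable M"
    and p: "0 < p" and "enorm p M f < top" "enorm p M g < top"
  shows "enorm p M (\<lambda>x. f x + g x) < top"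
proof -
  have "(\<integral>\<^sup>+ x. ennreal_powr (f x + g x) p \<partial>M)
    \<le> (\<integral>\<^sup>+ x. ennreal (2 powr p) * (ennreal_powr (f x) p + ennreal_powr (g x) p) \<partial>M)"
    using p by (intro nn_integral_mono ennreal_powr_add_le) simp
  also have "\<dots> = ennreal (2 powr p) *
      ((\<integral>\<^sup>+ x. ennreal_powr (f x) p \<partial>M) + (\<integral>\<^sup>+ x. ennreal_powr (g x) p \<partial>M))"
    by (simp add: nn_integral_cmult nn_integral_add)
  also have "\<dots> < top"
    using assms(4,5) by (simp add: enorm_def ennreal_mult_less_top)
  finally show ?thesis by (simp add: enorm_def)
qed

text \<open>Young's inequality for the two functions divided by their norms. Norms equal to 0 or
  \<open>top\<close> cannot be divided out and are treated first.\<close>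

theorem Hoelder_nn_integral:
  assumes [measurable]: "f \<in> borel_measurable M" "g \<in> borel_measurable M"
    and p: "1 < p" and pq: "1 / p + 1 / q = 1"
  shows "(\<integral>\<^sup>+ x. f x * g x \<partial>M) \<le> enorm p M f * enorm q M g"
proof -
  define A B where "A = enorm p M f" and "B = enorm q M g"
  have q: "0 < q" using conjugate_exponent_gt_1[OF p pq] by simp
  consider "A = 0" | "B = 0" | "A \<noteq> 0" "B \<noteq> 0" "A = top \<or> B = top"
    | "A \<noteq> 0" "B \<noteq> 0" "A \<noteq> top" "B \<noteq> top" by blast
  then show ?thesis
  proof cases
    case 1
    then have "AE x in M. f x = 0" unfolding A_def by (rule enorm_eq_0D[rotated]) measurable
    then have "(\<integral>\<^sup>+ x. f x * g x \<partial>M) = (\<integral>\<^sup>+ x. 0 \<partial>M)"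
      by (intro nn_integral_cong_AE) (auto elim!: eventually_mono)
    then show ?thesis by simp
  next
    case 2
    then have "AE x in M. g x = 0" unfolding B_def by (rule enorm_eq_0D[rotated]) measurable
    then have "(\<integral>\<^sup>+ x. f x * g x \<partial>M) = (\<integral>\<^sup>+ x. 0 \<partial>M)"
      by (intro nn_integral_cong_AE) (auto elim!: eventually_mono)
    then show ?thesis by simp
  next
    case 3
    then show ?thesis unfolding A_def[symmetric] B_def[symmetric]
      by (auto simp: ennreal_mult_top ennreal_top_mult)
  next
    case 4
    then obtain a b where ab: "A = ennreal a" "B = ennreal b" "0 < a" "0 < b"
      by (metis ennreal_cases ennreal_0 less_eq_real_def)
    have "ennreal (a powr p) = (\<integral>\<^sup>+ x. ennreal_powr (f x) p \<partial>M)"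
      "ennreal (b powr q) = (\<integral>\<^sup>+ x. ennreal_powr (g x) q \<partial>M)"
      using enorm_powr[of p M f] enorm_powr[of q M g] ab p q
      by (simp_all add: A_def[symmetric] B_def[symmetric] ennreal_powr_ennreal)
    note e = this
    have *: "(\<integral>\<^sup>+ x. ennreal_powr (ennreal (1 / a) * f x) p \<partial>M) = 1"
      "(\<integral>\<^sup>+ x. ennreal_powr (ennreal (1 / b) * g x) q \<partial>M) = 1"
      using ab p q unfolding ennreal_powr_mult
      by (simp_all add: nn_integral_cmult, unfold e[symmetric])
         (simp_all add: ennreal_powr_ennreal powr_divide flip: ennreal_mult)
    have "(\<integral>\<^sup>+ x. (ennreal (1 / a) * f x) * (ennreal (1 / b) * g x) \<partial>M) \<le>
        (\<integral>\<^sup>+ x. ennreal (1 / p) * ennreal_powr (ennreal (1 / a) * f x) p +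
               ennreal (1 / q) * ennreal_powr (ennreal (1 / b) * g x) q \<partial>M)"
      using p pq by (intro nn_integral_mono ennreal_Young) auto
    also have "\<dots> = ennreal (1 / p) + ennreal (1 / q)"
      by (simp add: nn_integral_add nn_integral_cmult *)
    also have "\<dots> = 1"
      using p q pq by (simp flip: ennreal_plus)
    finally have "(\<integral>\<^sup>+ x. (ennreal (1 / a) * f x) * (ennreal (1 / b) * g x) \<partial>M) \<le> 1" .
    moreover have "(\<integral>\<^sup>+ x. (ennreal (1 / a) * f x) * (ennreal (1 / b) * g x) \<partial>M)
       = ennreal (1 / (a * b)) * (\<integral>\<^sup>+ x. f x * g x \<partial>M)"
    proof -
      have "(ennreal (1 / a) * f x) * (ennreal (1 / b) * g x) = ennreal (1 / (a * b)) * (f x * g x)" for x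
        using ab ennreal_mult[of "1 / a" "1 / b"] by (simp add: mult_ac)
      then show ?thesis by (simp add: nn_integral_cmult)
    qed
    ultimately have "ennreal (a * b) * (ennreal (1 / (a * b)) * (\<integral>\<^sup>+ x. f x * g x \<partial>M)) \<le> ennreal (a * b) * 1"
      by (intro mult_left_mono) auto
    moreover have "ennreal (a * b) * (ennreal (1 / (a * b)) * (\<integral>\<^sup>+ x. f x * g x \<partial>M)) = (\<integral>\<^sup>+ x. f x * g x \<partial>M)"
      using ab by (simp add: mult.assoc[symmetric] flip: ennreal_mult)
    ultimately show ?thesis
      using ab by (simp add: A_def[symmetric] B_def[symmetric] ennreal_mult)
  qed
qed

text \<open>Apply Hoelder to \<open>T x v = T x v A(v)\<^sup>-\<^sup>1\<^sup>/\<^sup>q \<cdot> A(v)\<^sup>1\<^sup>/\<^sup>q\<close>, where \<open>A(v) > 0\<close> dominates the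
  norm of \<open>T \<cdot> v\<close>: the powers of \<open>A\<close> recombine after exchanging the integrals.\<close>

lemma Minkowski_majorant:
  assumes M: "sigma_finite_measure M" and N: "sigma_finite_measure N"
    and [measurable]: "case_prod T \<in> borel_measurable (M \<Otimes>\<^sub>M N)"
    and [measurable]: "A \<in> borel_measurable N"
    and p: "1 < p"
    and A0: "\<And>v. 0 < A v" and AT: "AE v in N. A v \<noteq> top"
    and le: "AE v in N. enorm p M (\<lambda>x. T x v) \<le> A v"
  shows "enorm p M (\<lambda>x. \<integral>\<^sup>+ v. T x v \<partial>N) \<le> (\<integral>\<^sup>+ v. A v \<partial>N)"
proof -
  interpret M: sigma_finite_measure M by fact
  interpret N: sigma_finite_measure N by fact
  interpret pair_sigma_finite M N ..
  define q where "q = p / (p - 1)"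
  have q: "0 < q" "1 / p + 1 / q = 1" using p by (auto simp: q_def field_simps)
  define S where "S = (\<integral>\<^sup>+ v. A v \<partial>N)"
  have "(\<integral>\<^sup>+ v. T x v \<partial>N) \<le>
      enorm p N (\<lambda>v. T x v * ennreal_powr (A v) (- (1 / q))) * ennreal_powr S (1 / q)"
    if x: "x \<in> space M" for x
  proof -
    have [measurable]: "T x \<in> borel_measurable N"
      using measurable_Pair2[OF assms(3) x] by simp
    have "(\<integral>\<^sup>+ v. T x v \<partial>N) =
        (\<integral>\<^sup>+ v. (T x v * ennreal_powr (A v) (- (1 / q))) * ennreal_powr (A v) (1 / q) \<partial>N)"
    proof (rule nn_integral_cong_AE, use AT in eventually_elim)
      fix v assume "A v \<noteq> top"
      with A0[of v] obtain a where a: "A v = ennreal a" "0 < a"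
        by (metis ennreal_cases ennreal_less_zero_iff)
      have "ennreal_powr (A v) (- (1 / q)) * ennreal_powr (A v) (1 / q) = 1"
        using a by (simp add: ennreal_powr_add[symmetric]) (simp add: ennreal_powr_ennreal)
      then show "T x v = T x v * ennreal_powr (A v) (- (1 / q)) * ennreal_powr (A v) (1 / q)"
        by (simp add: mult.assoc)
    qed
    also have "\<dots> \<le> enorm p N (\<lambda>v. T x v * ennreal_powr (A v) (- (1 / q))) *
        enorm q N (\<lambda>v. ennreal_powr (A v) (1 / q))"
      by (rule Hoelder_nn_integral) (use p q in measurable)
    also have "enorm q N (\<lambda>v. ennreal_powr (A v) (1 / q)) = ennreal_powr S (1 / q)"
      using q by (simp add: enorm_def ennreal_powr_powr S_def)
    finally show ?thesis .
  qed
  then have "(\<integral>\<^sup>+ x. ennreal_powr (\<integral>\<^sup>+ v. T x v \<partial>N) p \<partial>M) \<le>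
      (\<integral>\<^sup>+ x. ennreal_powr (enorm p N (\<lambda>v. T x v * ennreal_powr (A v) (- (1 / q))) * ennreal_powr S (1 / q)) p \<partial>M)"
    using p by (intro nn_integral_mono ennreal_powr_mono) auto
  also have "\<dots> = (\<integral>\<^sup>+ x. ennreal_powr S (p - 1) *
       (\<integral>\<^sup>+ v. ennreal_powr (T x v) p * ennreal_powr (A v) (1 - p) \<partial>N) \<partial>M)"
  proof (rule nn_integral_cong)
    fix x assume "x \<in> space M"
    have "p / q = p - 1" using p by (simp add: q_def)
    then show "ennreal_powr (enorm p N (\<lambda>v. T x v * ennreal_powr (A v) (- (1 / q))) * ennreal_powr S (1 / q)) p
      = ennreal_powr S (p - 1) * (\<integral>\<^sup>+ v. ennreal_powr (T x v) p * ennreal_powr (A v) (1 - p) \<partial>N)"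
      using p by (simp add: ennreal_powr_mult enorm_powr ennreal_powr_powr mult.commute)
  qed
  also have "\<dots> = ennreal_powr S (p - 1) *
       (\<integral>\<^sup>+ v. \<integral>\<^sup>+ x. ennreal_powr (T x v) p * ennreal_powr (A v) (1 - p) \<partial>M \<partial>N)"
    by (subst Fubini') (auto simp: nn_integral_cmult)
  also have "\<dots> = ennreal_powr S (p - 1) *
       (\<integral>\<^sup>+ v. ennreal_powr (enorm p M (\<lambda>x. T x v)) p * ennreal_powr (A v) (1 - p) \<partial>N)"
    using p by (intro arg_cong2[where f = "(*)"] refl nn_integral_cong)
       (simp add: enorm_powr nn_integral_multc)
  also have "\<dots> \<le> ennreal_powr S (p - 1) * (\<integral>\<^sup>+ v. A v \<partial>N)"
  proof (intro mult_left_mono nn_integral_mono_AE)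
    show "AE v in N. ennreal_powr (enorm p M (\<lambda>x. T x v)) p * ennreal_powr (A v) (1 - p) \<le> A v"
      using AT le
    proof eventually_elim
      fix v assume v: "A v \<noteq> top" "enorm p M (\<lambda>x. T x v) \<le> A v"
      have "ennreal_powr (enorm p M (\<lambda>x. T x v)) p * ennreal_powr (A v) (1 - p)
          \<le> ennreal_powr (A v) p * ennreal_powr (A v) (1 - p)"
        using v p by (intro mult_right_mono ennreal_powr_mono) auto
      also have "\<dots> = A v" by (simp flip: ennreal_powr_add)
      finally show "ennreal_powr (enorm p M (\<lambda>x. T x v)) p * ennreal_powr (A v) (1 - p) \<le> A v" .
    qed
  qed simp
  also have "\<dots> = ennreal_powr S p"
    using ennreal_powr_add[of S "p - 1" 1] by (simp add: S_def)
  finally show ?thesis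
    unfolding enorm_def S_def using p ennreal_powr_mono[of _ _ "1 / p"]
    by (fastforce simp: ennreal_powr_powr)
qed

text \<open>The majorant in \<open>Minkowski_majorant\<close> must be strictly positive, but the
  norm of a slice may vanish. So it is enlarged by \<open>\<delta>\<close> times a positive
  integrable function, which exists by sigma-finiteness, and \<open>\<delta>\<close> is sent to
  0.\<close>

theorem Minkowski_nn_integral:
  assumes M: "sigma_finite_measure M" and N: "sigma_finite_measure N"
    and T[measurable]: "case_prod T \<in> borel_measurable (M \<Otimes>\<^sub>M N)"
    and p: "1 < p"
  shows "enorm p M (\<lambda>x. \<integral>\<^sup>+ v. T x v \<partial>N) \<le> (\<integral>\<^sup>+ v. enorm p M (\<lambda>x. T x v) \<partial>N)"
proof (cases "(\<integral>\<^sup>+ v. enorm p M (\<lambda>x. T x v) \<partial>N) = top")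
  case False
  interpret M: sigma_finite_measure M by fact
  interpret N: sigma_finite_measure N by fact
  have [measurable]: "(\<lambda>v. enorm p M (\<lambda>x. T x v)) \<in> borel_measurable N"
    unfolding enorm_def by measurable
  obtain e where e[measurable]: "e \<in> borel_measurable N" and "(\<integral>\<^sup>+ v. e v \<partial>N) \<noteq> top"
    and e0: "\<And>v. v \<in> space N \<Longrightarrow> 0 < e v \<and> e v < top"
    using N.Ex_finite_integrable_function by (metis infinity_ennreal_def)
  \<comment> \<open>Extended by 1 off the space, since the majorant has to be positive at every
    \<open>v\<close>.\<close>
  define e' where "e' v = (if v \<in> space N then e v else 1)" for v
  have [measurable]: "e' \<in> borel_measurable N" unfolding e'_def by measurable
  define c where "c = (\<integral>\<^sup>+ v. e' v \<partial>N)"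
  have "c = (\<integral>\<^sup>+ v. e v \<partial>N)" unfolding c_def e'_def by (rule nn_integral_cong) simp
  with \<open>(\<integral>\<^sup>+ v. e v \<partial>N) \<noteq> top\<close> have c: "c \<noteq> top" by simp
  have e': "0 < e' v" "e' v < top" for v using e0 by (auto simp: e'_def)
  have *: "enorm p M (\<lambda>x. \<integral>\<^sup>+ v. T x v \<partial>N) \<le> (\<integral>\<^sup>+ v. enorm p M (\<lambda>x. T x v) \<partial>N) + ennreal \<delta> * c"
    if "0 < \<delta>" for \<delta>
  proof -
    have "enorm p M (\<lambda>x. \<integral>\<^sup>+ v. T x v \<partial>N) \<le> (\<integral>\<^sup>+ v. enorm p M (\<lambda>x. T x v) + ennreal \<delta> * e' v \<partial>N)"
    proof (rule Minkowski_majorant[OF M N])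
      have "AE v in N. enorm p M (\<lambda>x. T x v) \<noteq> \<infinity>"
        using False by (intro nn_integral_PInf_AE) auto
      then show "AE v in N. enorm p M (\<lambda>x. T x v) + ennreal \<delta> * e' v \<noteq> top"
        by eventually_elim (use e' in \<open>auto simp: ennreal_mult_eq_top_iff less_top\<close>)
      show "0 < enorm p M (\<lambda>x. T x v) + ennreal \<delta> * e' v" for v
        using that e'[of v] by (simp add: ennreal_zero_less_mult_iff add_nonneg_pos)
    qed (use p in auto)
    also have "\<dots> = (\<integral>\<^sup>+ v. enorm p M (\<lambda>x. T x v) \<partial>N) + ennreal \<delta> * c"
      by (simp add: nn_integral_add nn_integral_cmult c_def)
    finally show ?thesis .
  qed
  show ?thesis
  proof (rule ennreal_le_epsilon)
    fix r :: real assume "0 < r"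
    obtain c' where c': "c = ennreal c'" "0 \<le> c'" using c by (metis ennreal_cases)
    \<comment> \<open>The choice \<open>\<delta> = r / (c' + 1)\<close>; adding 1 covers
      \<open>c' = 0\<close>.\<close>
    have "ennreal (r / (c' + 1)) * c \<le> ennreal r"
      using c' \<open>0 < r\<close> by (simp add: field_simps flip: ennreal_mult)
    with *[of "r / (c' + 1)"] c' \<open>0 < r\<close>
    show "enorm p M (\<lambda>x. \<integral>\<^sup>+ v. T x v \<partial>N) \<le> (\<integral>\<^sup>+ v. enorm p M (\<lambda>x. T x v) \<partial>N) + ennreal r"
      by (meson add_left_mono order_trans divide_pos_pos add_nonneg_pos zero_less_one)
  qed
qed simp

section \<open>Slowly varying weights\<close>

text \<open>Subpolynomial variation under dilation in both directions, with continuity for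
  measurability and for boundedness on compact sets. Apart from the relation between the two
  weights, the analysis below knows the powers of \<open>\<omega>\<close> only through this
  property.\<close>

definition slow_weight :: "(real \<Rightarrow> real) \<Rightarrow> bool"
  where "slow_weight \<Omega> \<longleftrightarrow> continuous_on {0<..} \<Omega> \<and> (\<forall>y>0. 0 < \<Omega> y) \<and>
    (\<forall>\<delta>>0. \<exists>C>0. \<forall>y>0. \<forall>s>0. \<Omega> (s * y) \<le> C * (s powr \<delta> + s powr - \<delta>) * \<Omega> y)"

lemma slow_weight_pos: "slow_weight \<Omega> \<Longrightarrow> 0 < y \<Longrightarrow> 0 < \<Omega> y"
  by (simp add: slow_weight_def)

lemma slow_weightE:
  assumes "slow_weight \<Omega>" "0 < \<delta>"
  obtains C where "0 < C" "\<And>y s. 0 < y \<Longrightarrow> 0 < s \<Longrightarrow> \<Omega> (s * y) \<le> C * (s powr \<delta> + s powr - \<delta>) * \<Omega> y"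
  using assms by (auto simp: slow_weight_def)

text \<open>On \<open>\<L>\<close> the monotonicity of \<open>\<Phi> t / t\<close> gives type 1 with
  constant 1; on \<open>\<U>\<close> the type is given. The constant is taken at least 1 so that
  \<open>ln C\<close> is nonnegative.\<close>

lemma growth_class_upper_type:
  assumes "\<Phi> \<in> \<L> \<union> \<U>"
  obtains r C where "0 \<le> r" "1 \<le> C" "\<And>t s. 1 \<le> t \<Longrightarrow> 0 < s \<Longrightarrow> \<Phi> (s * t) \<le> C * t powr r * \<Phi> s"
proof -
  have "\<exists>r C. 0 \<le> r \<and> 1 \<le> C \<and> (\<forall>t\<ge>1. \<forall>s>0. \<Phi> (s * t) \<le> C * t powr r * \<Phi> s)"
    using assms
  proof
    assume "\<Phi> \<in> \<L>"
    then have mono: "antimono_on {0<..} (\<lambda>t. \<Phi> t / t)"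
      by (auto simp: L_functions_def L_class_def)
    have "\<Phi> (s * t) \<le> 1 * t powr 1 * \<Phi> s" if "1 \<le> t" "0 < s" for t s
    proof -
      have "\<Phi> (s * t) / (s * t) \<le> \<Phi> s / s"
        using that mult_left_mono[of 1 t s] by (intro monotone_onD[OF mono]) auto
      then show ?thesis using that by (simp add: field_simps)
    qed
    then show ?thesis by (intro exI[of _ 1]) auto
  next
    assume "\<Phi> \<in> \<U>"
    then obtain r where r: "1 \<le> r" and g: "growth_function \<Phi>" and "upper_type r \<Phi>"
      by (auto simp: U_functions_def U_class_def)
    then obtain C where C: "0 < C" "\<And>t s. 1 \<le> t \<Longrightarrow> 0 < s \<Longrightarrow> \<Phi> (s * t) \<le> C * t powr r * \<Phi> s"
      by (auto simp: upper_type_def)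
    have pos: "0 \<le> \<Phi> s" if "0 < s" for s
      using g that imageI[of s "{0..}" \<Phi>] by (auto simp: growth_function_def)
    have "\<Phi> (s * t) \<le> max 1 C * t powr r * \<Phi> s" if "1 \<le> t" "0 < s" for t s
      by (rule order_trans[OF C(2)[OF that]]) (intro mult_right_mono pos that, auto)
    then show ?thesis using r by (intro exI[of _ r] exI[of _ "max 1 C"]) auto
  qed
  then show thesis using that by blast
qed

text \<open>Since \<open>\<Phi>\<close> is onto, it takes the value 1 at some \<open>x\<close>. A
  zero at \<open>s\<close> contradicts monotonicity if \<open>x \<le> s\<close> and the upper type
  if \<open>s < x\<close>. Positivity is what makes the logarithms continuous and monotone.\<close>

lemma growth_class_pos:
  assumes "\<Phi> \<in> \<L> \<union> \<U>" "0 < s"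
  shows "0 < \<Phi> s"
proof (rule ccontr)
  assume "\<not> 0 < \<Phi> s"
  have g: "growth_function \<Phi>"
    using assms(1) by (auto simp: L_functions_def L_class_def U_functions_def U_class_def)
  obtain r C where C: "0 \<le> r" "1 \<le> C" "\<And>t s. 1 \<le> t \<Longrightarrow> 0 < s \<Longrightarrow> \<Phi> (s * t) \<le> C * t powr r * \<Phi> s"
    using growth_class_upper_type[OF assms(1)] by blast
  have "(1::real) \<in> \<Phi> ` {0..}" using g by (auto simp: growth_function_def)
  then obtain x where x: "0 \<le> x" "\<Phi> x = 1" by auto
  have *: "\<Phi> a \<le> \<Phi> b" if "0 \<le> a" "a \<le> b" for a b
    using g that by (auto simp: growth_function_def mono_on_def)
  show False
  proof (cases "x \<le> s")
    case True
    then show ?thesis using *[of x s] x \<open>\<not> 0 < \<Phi> s\<close> by auto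
  next
    case False
    then have "\<Phi> (s * (x / s)) \<le> C * (x / s) powr r * \<Phi> s"
      using assms(2) by (intro C) auto
    also have "\<dots> \<le> 0" using C \<open>\<not> 0 < \<Phi> s\<close> by (intro mult_nonneg_nonpos) auto
    finally show False using assms(2) x by simp
  qed
qed

text \<open>For \<open>s \<le> 1\<close> monotonicity bounds \<open>\<Phi> (s * y)\<close> by
  \<open>\<Phi> y\<close>, for \<open>s > 1\<close> the upper type bounds it by a power of
  \<open>s\<close>; the logarithm turns this into an additive error
  \<open>ln C + r * \<bar>ln s\<bar>\<close>. As the weight is at least 1, an additive error is also
  a multiplicative one.\<close>

lemma T_weight_dilation:
  assumes "\<Phi> \<in> \<L> \<union> \<U>"
  obtains B where "1 \<le> B"
    "\<And>y s. 0 < y \<Longrightarrow> 0 < s \<Longrightarrow> T_weight \<Phi> \<epsilon> (s * y) \<le> B * (1 + \<bar>ln s\<bar>) * T_weight \<Phi> \<epsilon> y"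
proof -
  obtain r C where C: "0 \<le> r" "1 \<le> C" "\<And>t s. 1 \<le> t \<Longrightarrow> 0 < s \<Longrightarrow> \<Phi> (s * t) \<le> C * t powr r * \<Phi> s"
    using growth_class_upper_type[OF assms] by blast
  have g: "growth_function \<Phi>"
    using assms by (auto simp: L_functions_def L_class_def U_functions_def U_class_def)
  note pos = growth_class_pos[OF assms]
  have *: "ln_plus (\<Phi> (s * y)) \<le> ln C + r * \<bar>ln s\<bar> + ln_plus (\<Phi> y)" if sy: "0 < s" "0 < y" for s y
  proof (cases "s \<le> 1")
    case True
    have "\<Phi> (s * y) \<le> \<Phi> y"
      using g sy True mult_right_mono[of s 1 y] by (auto simp: growth_function_def mono_on_def)
    then have "ln_plus (\<Phi> (s * y)) \<le> ln_plus (\<Phi> y)"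
      using pos sy by (auto simp: ln_plus_def max_def)
    then show ?thesis using C by (smt (verit) ln_ge_zero mult_nonneg_nonneg)
  next
    case False
    then have "\<Phi> (s * y) \<le> C * s powr r * \<Phi> y" using C(3)[of s y] sy by (simp add: mult.commute)
    then have "ln (\<Phi> (s * y)) \<le> ln (C * s powr r * \<Phi> y)"
      using pos[of "s * y"] sy by (intro ln_mono) auto
    also have "\<dots> = ln C + r * ln s + ln (\<Phi> y)"
      using C sy pos[of y] by (simp add: ln_mult ln_powr)
    finally show ?thesis using False C by (auto simp: ln_plus_def max_def)
  qed
  have **: "T_weight \<Phi> \<epsilon> (s * y) \<le> ((1 + (real (fst \<epsilon>) + real (snd \<epsilon>)) * (ln C + r)) * (1 + \<bar>ln s\<bar>)) * T_weight \<Phi> \<epsilon> y"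
    if sy: "0 < y" "0 < s" for s y
  proof -
    let ?a = "ln C + r * \<bar>ln s\<bar>"
    have T1: "1 \<le> T_weight \<Phi> \<epsilon> y" by (auto simp: T_weight_def ln_plus_def)
    have a0: "0 \<le> ?a" using C by (intro add_nonneg_nonneg mult_nonneg_nonneg) auto
    have 1: "ln_plus (\<Phi> (1 / (s * y))) \<le> ?a + ln_plus (\<Phi> (1 / y))"
      using *[of "1 / s" "1 / y"] sy by (simp add: ln_div)
    have 2: "ln_plus (\<Phi> (s * y)) \<le> ?a + ln_plus (\<Phi> y)"
      using *[of s y] sy by simp
    have "T_weight \<Phi> \<epsilon> (s * y) \<le> 1 + real (fst \<epsilon>) * (?a + ln_plus (\<Phi> (1 / y))) + real (snd \<epsilon>) * (?a + ln_plus (\<Phi> y))"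
      unfolding T_weight_def using 1 2 by (intro add_mono mult_left_mono) auto
    also have "\<dots> = T_weight \<Phi> \<epsilon> y + (real (fst \<epsilon>) + real (snd \<epsilon>)) * ?a"
      by (simp add: T_weight_def algebra_simps)
    also have "\<dots> \<le> T_weight \<Phi> \<epsilon> y + ((real (fst \<epsilon>) + real (snd \<epsilon>)) * ?a) * T_weight \<Phi> \<epsilon> y"
      using mult_left_mono[OF T1, of "(real (fst \<epsilon>) + real (snd \<epsilon>)) * ?a"] a0 by simp
    also have "\<dots> = (1 + (real (fst \<epsilon>) + real (snd \<epsilon>)) * ?a) * T_weight \<Phi> \<epsilon> y"
      by (simp add: algebra_simps)
    also have "\<dots> \<le> ((1 + (real (fst \<epsilon>) + real (snd \<epsilon>)) * (ln C + r)) * (1 + \<bar>ln s\<bar>)) * T_weight \<Phi> \<epsilon> y"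
    proof (rule mult_right_mono)
      have "?a \<le> (ln C + r) * (1 + \<bar>ln s\<bar>)" using C by (simp add: algebra_simps)
      then have "(real (fst \<epsilon>) + real (snd \<epsilon>)) * ?a \<le> (real (fst \<epsilon>) + real (snd \<epsilon>)) * ((ln C + r) * (1 + \<bar>ln s\<bar>))"
        by (intro mult_left_mono) auto
      then show "1 + (real (fst \<epsilon>) + real (snd \<epsilon>)) * ?a \<le> (1 + (real (fst \<epsilon>) + real (snd \<epsilon>)) * (ln C + r)) * (1 + \<bar>ln s\<bar>)"
        by (simp add: algebra_simps)
    qed (use T1 in simp)
    finally show ?thesis .
  qed
  show thesis
    using C by (intro that[of "1 + (real (fst \<epsilon>) + real (snd \<epsilon>)) * (ln C + r)"] **) auto
qed

lemma one_plus_ln_powr_le: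
  assumes "0 < \<delta>" "0 \<le> k"
  obtains C where "0 < C" "\<And>s::real. 0 < s \<Longrightarrow> (1 + \<bar>ln s\<bar>) powr k \<le> C * (s powr \<delta> + s powr - \<delta>)"
proof -
  \<comment> \<open>Chosen so that \<open>\<eta> * k \<le> \<delta>\<close>; the denominator
    \<open>k + 1\<close> also admits \<open>k = 0\<close>.\<close>
  define \<eta> where "\<eta> = \<delta> / (k + 1)"
  have \<eta>: "0 < \<eta>" "\<eta> * k \<le> \<delta>" using assms by (auto simp: \<eta>_def field_simps)
  have "(1 + \<bar>ln s\<bar>) powr k \<le> (1 + 1 / \<eta>) powr k * (s powr \<delta> + s powr - \<delta>)" if s: "0 < s" for s :: real
  proof -
    define u where "u = \<bar>ln s\<bar>"
    have u: "0 \<le> u" by (simp add: u_def)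
    have "1 + u \<le> (1 + 1 / \<eta>) * (1 + \<eta> * u)" using \<eta> u by (simp add: field_simps)
    also have "\<dots> \<le> (1 + 1 / \<eta>) * exp (\<eta> * u)" using \<eta> by (intro mult_left_mono exp_ge_add_one_self) auto
    finally have "(1 + u) powr k \<le> ((1 + 1 / \<eta>) * exp (\<eta> * u)) powr k"
      using u assms by (intro powr_mono2) auto
    also have "\<dots> = (1 + 1 / \<eta>) powr k * exp (\<eta> * k * u)"
      using \<eta> by (simp add: powr_mult exp_powr_real mult_ac)
    also have "\<dots> \<le> (1 + 1 / \<eta>) powr k * exp (\<delta> * u)"
      using \<eta> u by (intro mult_left_mono) (auto intro: mult_right_mono)
    also have "exp (\<delta> * u) \<le> s powr \<delta> + s powr - \<delta>"
      using s by (auto simp: u_def powr_def abs_if add_nonneg_pos)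
    finally show ?thesis unfolding u_def by (simp add: mult_left_mono)
  qed
  moreover have "0 < 1 + 1 / \<eta>" using \<eta> by (simp add: add_pos_pos)
  ultimately show thesis by (intro that[of "(1 + 1 / \<eta>) powr k"]) auto
qed

lemma slow_weight_T_weight:
  assumes "\<Phi> \<in> \<L> \<union> \<U>"
  shows "slow_weight (\<lambda>y. T_weight \<Phi> \<epsilon> y powr k)"
  unfolding slow_weight_def
proof (intro conjI allI impI)
  let ?w = "T_weight \<Phi> \<epsilon>"
  have T1: "1 \<le> ?w y" for y by (auto simp: T_weight_def ln_plus_def)
  then have T0: "0 < ?w y" for y using less_le_trans[OF zero_less_one] by blast
  note pos = growth_class_pos[OF assms]
  have "continuous_on {0..} \<Phi>"
    using assms by (auto simp: L_functions_def L_class_def U_functions_def U_class_def growth_function_def)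
  then have c1: "continuous_on {0<..} \<Phi>" by (rule continuous_on_subset) auto
  have c2: "continuous_on {0<..} (\<lambda>y. \<Phi> (1 / y))"
    by (rule continuous_on_compose2[OF c1]) (auto intro!: continuous_intros)
  have "continuous_on {0<..} ?w"
    unfolding T_weight_def[abs_def] ln_plus_def
    using pos by (intro continuous_intros c1 c2) (auto simp: less_imp_neq[symmetric])
  then show "continuous_on {0<..} (\<lambda>y. ?w y powr k)"
    using T0 by (intro continuous_intros) (auto simp: less_imp_neq[symmetric])
  show "0 < ?w y powr k" for y using T0[of y] by simp
  fix \<delta> :: real assume "0 < \<delta>"
  obtain B where B: "1 \<le> B" "\<And>y s. 0 < y \<Longrightarrow> 0 < s \<Longrightarrow> ?w (s * y) \<le> B * (1 + \<bar>ln s\<bar>) * ?w y"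
    using T_weight_dilation[OF assms] by blast
  obtain C where C: "0 < C" "\<And>s::real. 0 < s \<Longrightarrow> (1 + \<bar>ln s\<bar>) powr \<bar>k\<bar> \<le> C * (s powr \<delta> + s powr - \<delta>)"
    using one_plus_ln_powr_le[OF \<open>0 < \<delta>\<close>, of "\<bar>k\<bar>"] by auto
  have "?w (s * y) powr k \<le> (B powr \<bar>k\<bar> * C) * (s powr \<delta> + s powr - \<delta>) * ?w y powr k" if "0 < y" "0 < s" for y s
  proof -
    have l0: "0 \<le> B * (1 + \<bar>ln s\<bar>)" using B by simp
    have "?w (s * y) powr k \<le> (B * (1 + \<bar>ln s\<bar>)) powr \<bar>k\<bar> * ?w y powr k"
    proof (cases "0 \<le> k")
      case True
      have "?w (s * y) powr k \<le> (B * (1 + \<bar>ln s\<bar>) * ?w y) powr k"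
        using B(2) that T0 True less_imp_le[OF T0] by (intro powr_mono2) auto
      then show ?thesis using True l0 less_imp_le[OF T0] by (simp add: powr_mult)
    next
      case False
      \<comment> \<open>For negative \<open>k\<close> the dilation bound is used backwards, from
        \<open>s * y\<close> to \<open>y\<close> with the factor \<open>1 / s\<close>; its constant
        is the same because \<open>\<bar>ln (1 / s)\<bar> = \<bar>ln s\<bar>\<close>.\<close>
      have "?w y \<le> B * (1 + \<bar>ln s\<bar>) * ?w (s * y)"
        using B(2)[of "s * y" "1 / s"] that by (simp add: ln_div)
      then have "?w y powr (- k) \<le> (B * (1 + \<bar>ln s\<bar>) * ?w (s * y)) powr (- k)"
        using less_imp_le[OF T0] False by (intro powr_mono2) auto
      also have "\<dots> = (B * (1 + \<bar>ln s\<bar>)) powr (- k) * ?w (s * y) powr (- k)"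
        using l0 less_imp_le[OF T0] by (simp add: powr_mult)
      finally have "1 / ?w y powr k \<le> (B * (1 + \<bar>ln s\<bar>)) powr \<bar>k\<bar> / ?w (s * y) powr k"
        using False by (simp add: powr_minus divide_inverse)
      then show ?thesis
        using T0[of y] T0[of "s * y"] by (simp add: divide_simps split: if_splits)
    qed
    also have "(B * (1 + \<bar>ln s\<bar>)) powr \<bar>k\<bar> = B powr \<bar>k\<bar> * (1 + \<bar>ln s\<bar>) powr \<bar>k\<bar>"
      using B by (simp add: powr_mult)
    also have "\<dots> \<le> B powr \<bar>k\<bar> * (C * (s powr \<delta> + s powr - \<delta>))"
      using C(2)[OF \<open>0 < s\<close>] by (intro mult_left_mono) auto
    finally show ?thesis using T0[of y] by (simp add: mult_right_mono mult.assoc)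
  qed
  moreover have "0 < B powr \<bar>k\<bar> * C" using B C by simp
  ultimately show "\<exists>C>0. \<forall>y>0. \<forall>s>0. ?w (s * y) powr k \<le> C * (s powr \<delta> + s powr - \<delta>) * ?w y powr k"
    by blast
qed

section \<open>Power integrals\<close>

text \<open>Split at 1: near 0 the integrand is at most \<open>y powr a\<close> with
  \<open>-1 < a\<close>, near infinity at most \<open>y powr (a - b)\<close> with
  \<open>a - b < -1\<close>.\<close>

lemma nn_integral_powr_finite:
  fixes a b :: real
  assumes a: "-1 < a" and ba: "1 < b - a"
  shows "(\<integral>\<^sup>+ y\<in>{0<..}. ennreal (y powr a * (1 + y) powr - b) \<partial>lborel) < \<infinity>"
proof -
  have "(\<integral>\<^sup>+ y\<in>{0<..}. ennreal (y powr a * (1 + y) powr - b) \<partial>lborel) \<le>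
      (\<integral>\<^sup>+ y. ennreal (y powr a * indicator {0..1} y) + ennreal (y powr (a - b) * indicator {1..} y) \<partial>lborel)"
  proof (rule nn_integral_mono)
    fix y :: real
    have "y powr a * (1 + y) powr - b \<le> y powr a" if "0 < y"
      using that a ba powr_mono2'[of "-b" 1 "1 + y"] by (intro mult_left_le) auto
    moreover have "y powr a * (1 + y) powr - b \<le> y powr (a - b)" if "1 \<le> y"
      using that a ba powr_mono2'[of "-b" y "1 + y"]
      by (auto simp: powr_diff powr_minus divide_inverse intro!: mult_left_mono)
    ultimately have "y powr a * (1 + y) powr - b * indicator {0<..} y \<le>
       y powr a * indicator {0..1} y + y powr (a - b) * indicator {1..} y"
      by (cases "0 < y"; cases "y \<le> 1"; cases "1 \<le> y") (auto intro: add_increasing2)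
    then show "ennreal (y powr a * (1 + y) powr - b) * indicator {0<..} y \<le>
       ennreal (y powr a * indicator {0..1} y) + ennreal (y powr (a - b) * indicator {1..} y)"
      by (auto simp: indicator_def simp flip: ennreal_plus intro!: ennreal_leI split: if_splits)
  qed
  also have "\<dots> = (\<integral>\<^sup>+ y. ennreal (y powr a * indicator {0..1} y) \<partial>lborel) +
      (\<integral>\<^sup>+ y. ennreal (y powr (a - b) * indicator {1..} y) \<partial>lborel)"
    by (rule nn_integral_add) auto
  also have "(\<integral>\<^sup>+ y. ennreal (y powr a * indicator {0..1} y) \<partial>lborel) = ennreal (1 powr (a + 1) / (a + 1))"
  proof (rule nn_integral_has_integral_lborel)
    show "((\<lambda>y. y powr a * indicator {0..1} y) has_integral 1 powr (a + 1) / (a + 1)) UNIV"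
    proof -
      have "(\<lambda>y. y powr a * indicator {0..1} y) = (\<lambda>y. if y \<in> {0..1} then y powr a else 0)"
        by (auto simp: indicator_def)
      then show ?thesis using has_integral_powr_from_0[OF a, of 1] by (simp only: has_integral_restrict_UNIV)
    qed
  qed auto
  also have "(\<integral>\<^sup>+ y. ennreal (y powr (a - b) * indicator {1..} y) \<partial>lborel) =
      ennreal (-(1 powr ((a - b) + 1)) / ((a - b) + 1))"
  proof (rule nn_integral_has_integral_lborel)
    show "((\<lambda>y. y powr (a - b) * indicator {1..} y) has_integral -(1 powr ((a - b) + 1)) / ((a - b) + 1)) UNIV"
    proof -
      have "(\<lambda>y. y powr (a - b) * indicator {1..} y) = (\<lambda>y. if y \<in> {1..} then y powr (a - b) else 0)"
        by (auto simp: indicator_def)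
      then show ?thesis using has_integral_powr_to_inf[of "a - b" 1] ba by (simp only: has_integral_restrict_UNIV)
    qed
  qed auto
  finally show ?thesis by (rule le_less_trans) simp
qed

lemma nn_integral_abs_powr:
  fixes b s :: real
  assumes "0 < b" "1 < s"
  shows "(\<integral>\<^sup>+ t. ennreal ((\<bar>t\<bar> + b) powr - s) \<partial>lborel) = ennreal (2 / (s - 1) * b powr (1 - s))"
proof -
  have half: "(\<integral>\<^sup>+ t. ennreal ((t + b) powr - s) * indicator {0..} t \<partial>lborel) = ennreal (b powr (1 - s) / (s - 1))"
  proof -
    have "(\<integral>\<^sup>+ t. ennreal ((t + b) powr - s) * indicator {0..} t \<partial>lborel)
        = ennreal (0 - - ((0 + b) powr (1 - s) / (s - 1)))"
    proof (rule nn_integral_FTC_atLeast)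
      show "((\<lambda>t. - ((t + b) powr (1 - s) / (s - 1))) has_real_derivative (t + b) powr - s) (at t)"
        if "0 \<le> t" for t
      proof -
        have "((\<lambda>t. (t + b) powr (1 - s)) has_real_derivative (1 - s) * (t + b) powr (1 - s - 1) * 1) (at t)"
          using that assms
          by (intro DERIV_chain2[OF has_real_derivative_powr]) (auto intro!: derivative_eq_intros)
        from DERIV_minus[OF DERIV_cdivide[OF this, of "s - 1"]] show ?thesis
          by (rule DERIV_cong) (use assms in \<open>simp add: divide_simps, simp add: algebra_simps\<close>)
      qed
      have "((\<lambda>t. (t + b) powr (1 - s)) \<longlongrightarrow> 0) at_top"
        using assms by (intro tendsto_neg_powr) (auto intro!: filterlim_tendsto_add_at_top[OF tendsto_const, simplified add.commute] filterlim_ident simp: add.commute[of _ b])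
      then have "((\<lambda>t. - ((t + b) powr (1 - s) / (s - 1))) \<longlongrightarrow> - (0 / (s - 1))) at_top"
        using assms by (intro tendsto_intros) auto
      then show "((\<lambda>t. - ((t + b) powr (1 - s) / (s - 1))) \<longlongrightarrow> 0) at_top" by simp
    qed (use assms in auto)
    then show ?thesis by simp
  qed
  \<comment> \<open>At 0 both indicators equal 1, so the integrands agree only off a null
    set.\<close>
  have "(\<integral>\<^sup>+ t. ennreal ((\<bar>t\<bar> + b) powr - s) \<partial>lborel) =
     (\<integral>\<^sup>+ t. ennreal ((t + b) powr - s) * indicator {0..} t + ennreal ((- t + b) powr - s) * indicator {0..} (- t) \<partial>lborel)"
    by (intro nn_integral_cong_AE AE_I[where N = "{0}"]) (auto simp: indicator_def)
  also have "\<dots> = (\<integral>\<^sup>+ t. ennreal ((t + b) powr - s) * indicator {0..} t \<partial>lborel) +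
     (\<integral>\<^sup>+ t. ennreal ((- t + b) powr - s) * indicator {0..} (- t) \<partial>lborel)"
    by (rule nn_integral_add) auto
  also have "(\<integral>\<^sup>+ t. ennreal ((- t + b) powr - s) * indicator {0..} (- t) \<partial>lborel) =
     (\<integral>\<^sup>+ t. ennreal ((t + b) powr - s) * indicator {0..} t \<partial>lborel)"
    by (subst (2) nn_integral_real_affine[where c = "-1" and t = 0]) auto
  finally show ?thesis using assms by (simp add: half flip: ennreal_plus)
qed

section \<open>Mixed norms\<close>

lemma borel_measurable_Complex [measurable (raw)]:
  assumes "f \<in> borel_measurable M" "g \<in> borel_measurable M"
  shows "(\<lambda>x. Complex (f x) (g x)) \<in> borel_measurable M"
  using assms by (simp add: Complex_eq)

text \<open>The height is the first coordinate, so that Tonelli puts the integral over horizontal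
  lines inside, as in the mixed norm.\<close>

lemma lborel_complex_eq: "lborel = distr (lborel \<Otimes>\<^sub>M lborel) borel (\<lambda>(y, x). Complex x y)"
proof (rule lborel_eqI)
  fix l u :: complex assume le: "\<And>b. b \<in> Basis \<Longrightarrow> l \<bullet> b \<le> u \<bullet> b"
  then have le': "Re l \<le> Re u" "Im l \<le> Im u" using le[of 1] le[of \<i>] by (auto simp: Basis_complex_def)
  have "(\<lambda>(y, x). Complex x y) -` box l u \<inter> space (lborel \<Otimes>\<^sub>M lborel) =
     {Im l<..<Im u} \<times> {Re l<..<Re u}"
    by (auto simp: space_pair_measure in_box_complex_iff)
  then have "emeasure (distr (lborel \<Otimes>\<^sub>M lborel) borel (\<lambda>(y, x). Complex x y)) (box l u) =
      emeasure (lborel \<Otimes>\<^sub>M lborel) ({Im l<..<Im u} \<times> {Re l<..<Re u})"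
    by (subst emeasure_distr) (auto simp: split_beta')
  also have "\<dots> = ennreal (Im u - Im l) * ennreal (Re u - Re l)"
    using le' by (subst lborel.emeasure_pair_measure_Times) auto
  also have "\<dots> = ennreal (\<Prod>b\<in>Basis. (u - l) \<bullet> b)"
    using le' by (simp add: Basis_complex_def ennreal_mult' mult.commute complex_eq_iff)
  finally show "emeasure (distr (lborel \<Otimes>\<^sub>M lborel) borel (\<lambda>(y, x). Complex x y)) (box l u) =
     ennreal (\<Prod>b\<in>Basis. (u - l) \<bullet> b)" .
qed simp

lemma borel_upper_half_plane [measurable]: "\<complex>\<^sub>+ \<in> sets borel"
  unfolding upper_half_plane_def by measurable

lemma open_upper_half_plane: "open \<complex>\<^sub>+"
  unfolding upper_half_plane_def by (rule open_halfspace_Im_gt)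

lemma nn_integral_dV:
  assumes [measurable]: "f \<in> borel_measurable borel"
  shows "(\<integral>\<^sup>+ z. f z \<partial>dV \<alpha>) =
    (\<integral>\<^sup>+ y\<in>{0<..}. (\<integral>\<^sup>+ x. f (Complex x y) \<partial>lborel) * ennreal (y powr \<alpha>) \<partial>lborel)"
proof -
  have "(\<integral>\<^sup>+ z. f z \<partial>dV \<alpha>) = (\<integral>\<^sup>+ z. ennreal (indicator \<complex>\<^sub>+ z * Im z powr \<alpha>) * f z \<partial>lborel)"
    unfolding dV_def by (rule nn_integral_density) auto
  also have "\<dots> = (\<integral>\<^sup>+ y. \<integral>\<^sup>+ x. ennreal (indicator {0<..} y * y powr \<alpha>) * f (Complex x y) \<partial>lborel \<partial>lborel)"
    by (subst lborel_complex_eq)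
       (auto simp: nn_integral_distr split_beta' lborel.nn_integral_fst[symmetric] upper_half_plane_def indicator_def
             intro!: nn_integral_cong)
  also have "\<dots> = (\<integral>\<^sup>+ y\<in>{0<..}. (\<integral>\<^sup>+ x. f (Complex x y) \<partial>lborel) * ennreal (y powr \<alpha>) \<partial>lborel)"
    by (intro nn_integral_cong) (auto simp: nn_integral_cmult indicator_def mult.commute)
  finally show ?thesis .
qed

text \<open>Moving the weight into the measure makes the mixed norm an iterated
  \<open>enorm\<close>, to which the one-variable inequalities apply twice.\<close>

definition wmeasure :: "(real \<Rightarrow> real) \<Rightarrow> real \<Rightarrow> real measure"
  where "wmeasure \<Omega> \<alpha> = density lborel (\<lambda>y. ennreal (indicator {0<..} y * (\<Omega> y * y powr \<alpha>)))"

lemma slow_weight_measurable: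
  assumes "slow_weight \<Omega>"
  shows "(\<lambda>y. indicator {0<..} y * (\<Omega> y * y powr \<alpha>)) \<in> borel_measurable borel"
proof -
  have "continuous_on {0<..} (\<lambda>y. \<Omega> y * y powr \<alpha>)"
    using assms by (intro continuous_intros) (auto simp: slow_weight_def)
  from borel_measurable_continuous_on_indicator[OF _ this] show ?thesis by simp
qed

lemma sets_wmeasure [measurable_cong, simp]: "sets (wmeasure \<Omega> \<alpha>) = sets borel"
  by (simp add: wmeasure_def)

lemma nn_integral_wmeasure:
  assumes "slow_weight \<Omega>" and [measurable]: "f \<in> borel_measurable borel"
  shows "(\<integral>\<^sup>+ y. f y \<partial>wmeasure \<Omega> \<alpha>) = (\<integral>\<^sup>+ y\<in>{0<..}. f y * ennreal (\<Omega> y * y powr \<alpha>) \<partial>lborel)"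
  using slow_weight_measurable[OF assms(1)] unfolding wmeasure_def
  by (subst nn_integral_density) (auto intro!: nn_integral_cong simp: indicator_def mult.commute)

lemma AE_wmeasure_iff:
  assumes "slow_weight \<Omega>"
  shows "(AE y in wmeasure \<Omega> \<alpha>. P y) \<longleftrightarrow> (AE y in lborel. 0 < y \<longrightarrow> P y)"
proof -
  have "0 < indicator {0<..} y * (\<Omega> y * y powr \<alpha>) \<longleftrightarrow> 0 < y" for y
    using slow_weight_pos[OF assms] by (auto simp: indicator_def)
  then show ?thesis
    using slow_weight_measurable[OF assms] unfolding wmeasure_def
    by (subst AE_density) auto
qed

lemma sigma_finite_wmeasure: "slow_weight \<Omega> \<Longrightarrow> sigma_finite_measure (wmeasure \<Omega> \<alpha>)"
  unfolding wmeasure_def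
  by (subst sigma_finite_measure.sigma_finite_iff_density_finite[OF lborel.sigma_finite_measure_axioms]) (use slow_weight_measurable in auto)

definition mixed_norm :: "real \<Rightarrow> real \<Rightarrow> (real \<Rightarrow> real) \<Rightarrow> real \<Rightarrow> (complex \<Rightarrow> ennreal) \<Rightarrow> ennreal"
  where "mixed_norm p q \<Omega> \<alpha> f = enorm q (wmeasure \<Omega> \<alpha>) (\<lambda>y. enorm p lborel (\<lambda>x. f (Complex x y)))"

lemma measurable_slice [measurable (raw)]:
  assumes [measurable]: "f \<in> borel_measurable borel"
  shows "(\<lambda>y. enorm p lborel (\<lambda>x. f (Complex x y))) \<in> borel_measurable borel"
  unfolding enorm_def by measurable

lemma mixed_integral_eq:
  assumes "slow_weight \<Omega>" "0 < p" "0 < q" and [measurable]: "f \<in> borel_measurable borel"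
  shows "mixed_integral p q \<Omega> \<alpha> f = ennreal_powr (mixed_norm p q \<Omega> \<alpha> (\<lambda>z. ennreal (cmod (f z)))) q"
proof -
  have "mixed_integral p q \<Omega> \<alpha> f =
     (\<integral>\<^sup>+ y\<in>{0<..}. ennreal_powr (enorm p lborel (\<lambda>x. ennreal (cmod (f (Complex x y))))) q * ennreal (\<Omega> y * y powr \<alpha>) \<partial>lborel)"
    unfolding mixed_integral_def enorm_def
    by (simp add: ennreal_powr_ennreal ennreal_powr_powr)
  then show ?thesis
    using assms by (simp add: mixed_norm_def enorm_powr nn_integral_wmeasure)
qed

lemma mixed_norm_mono:
  assumes "slow_weight \<Omega>" "0 < p" "0 < q" "\<And>z. z \<in> \<complex>\<^sub>+ \<Longrightarrow> f z \<le> g z"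
  shows "mixed_norm p q \<Omega> \<alpha> f \<le> mixed_norm p q \<Omega> \<alpha> g"
  unfolding mixed_norm_def
  using assms by (intro enorm_mono_AE) (auto simp: AE_wmeasure_iff upper_half_plane_def intro!: AE_I2 enorm_mono)

lemma mixed_norm_cong:
  assumes "slow_weight \<Omega>" "\<And>z. z \<in> \<complex>\<^sub>+ \<Longrightarrow> f z = g z"
  shows "mixed_norm p q \<Omega> \<alpha> f = mixed_norm p q \<Omega> \<alpha> g"
  unfolding mixed_norm_def
  using assms by (intro enorm_cong_AE) (auto simp: AE_wmeasure_iff upper_half_plane_def intro!: AE_I2 enorm_cong_AE)

lemma mixed_norm_cmult:
  assumes "0 < p" "0 < q" and [measurable]: "f \<in> borel_measurable borel"
  shows "mixed_norm p q \<Omega> \<alpha> (\<lambda>z. c * f z) = c * mixed_norm p q \<Omega> \<alpha> f"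
  unfolding mixed_norm_def using assms by (simp add: enorm_cmult)

text \<open>Minkowski's inequality on each horizontal line, and then once more in the
  height.\<close>

lemma mixed_norm_Minkowski:
  assumes \<Omega>: "slow_weight \<Omega>" and pq: "1 < p" "1 < q" and N: "sigma_finite_measure N"
    and [measurable]: "case_prod f \<in> borel_measurable (borel \<Otimes>\<^sub>M N)"
  shows "mixed_norm p q \<Omega> \<alpha> (\<lambda>z. \<integral>\<^sup>+ v. f z v \<partial>N) \<le> (\<integral>\<^sup>+ v. mixed_norm p q \<Omega> \<alpha> (\<lambda>z. f z v) \<partial>N)"
proof -
  interpret N: sigma_finite_measure N by fact
  have [measurable]: "(\<lambda>w. f (g w) (h w)) \<in> borel_measurable M"
    if "g \<in> borel_measurable M" "h \<in> measurable M N" for g h and M :: "'c measure"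
    using measurable_compose[OF measurable_Pair[OF that] assms(5)] by simp
  have "mixed_norm p q \<Omega> \<alpha> (\<lambda>z. \<integral>\<^sup>+ v. f z v \<partial>N) \<le>
      enorm q (wmeasure \<Omega> \<alpha>) (\<lambda>y. \<integral>\<^sup>+ v. enorm p lborel (\<lambda>x. f (Complex x y) v) \<partial>N)"
    unfolding mixed_norm_def
    by (rule enorm_mono) (use pq N in \<open>auto intro!: Minkowski_nn_integral lborel.sigma_finite_measure_axioms\<close>)
  also have "\<dots> \<le> (\<integral>\<^sup>+ v. mixed_norm p q \<Omega> \<alpha> (\<lambda>z. f z v) \<partial>N)"
    unfolding mixed_norm_def
    by (rule Minkowski_nn_integral[OF sigma_finite_wmeasure[OF \<Omega>] N])
       (use pq in \<open>auto simp: enorm_def\<close>)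
  finally show ?thesis .
qed

lemma mixed_norm_add_lt_top:
  assumes \<Omega>: "slow_weight \<Omega>" and pq: "0 < p" "0 < q"
    and [measurable]: "f \<in> borel_measurable borel" "g \<in> borel_measurable borel"
    and lt: "mixed_norm p q \<Omega> \<alpha> f < top" "mixed_norm p q \<Omega> \<alpha> g < top"
  shows "mixed_norm p q \<Omega> \<alpha> (\<lambda>z. f z + g z) < top"
proof -
  have "enorm p lborel (\<lambda>x. f (Complex x y) + g (Complex x y)) \<le>
      ennreal (2 * 2 powr (1 / p)) * (enorm p lborel (\<lambda>x. f (Complex x y)) + enorm p lborel (\<lambda>x. g (Complex x y)))" for y
  proof -
    let ?F = "\<integral>\<^sup>+ x. ennreal_powr (f (Complex x y)) p \<partial>lborel" and ?G = "\<integral>\<^sup>+ x. ennreal_powr (g (Complex x y)) p \<partial>lborel"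
    have "(\<integral>\<^sup>+ x. ennreal_powr (f (Complex x y) + g (Complex x y)) p \<partial>lborel)
      \<le> (\<integral>\<^sup>+ x. ennreal (2 powr p) * (ennreal_powr (f (Complex x y)) p + ennreal_powr (g (Complex x y)) p) \<partial>lborel)"
      using pq by (intro nn_integral_mono ennreal_powr_add_le) simp
    also have "\<dots> = ennreal (2 powr p) * (?F + ?G)"
      by (simp add: nn_integral_cmult nn_integral_add)
    finally have "enorm p lborel (\<lambda>x. f (Complex x y) + g (Complex x y)) \<le> ennreal_powr (ennreal (2 powr p) * (?F + ?G)) (1 / p)"
      unfolding enorm_def using pq by (intro ennreal_powr_mono) auto
    also have "\<dots> = ennreal 2 * ennreal_powr (?F + ?G) (1 / p)"
      using pq by (simp add: ennreal_powr_mult ennreal_powr_ennreal powr_powr del: ennreal_numeral)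
    also have "\<dots> \<le> ennreal 2 * (ennreal (2 powr (1 / p)) * (ennreal_powr ?F (1 / p) + ennreal_powr ?G (1 / p)))"
      using pq by (intro mult_left_mono ennreal_powr_add_le) auto
    finally show ?thesis
      unfolding enorm_def by (subst ennreal_mult) (simp_all add: mult.assoc)
  qed
  then have "mixed_norm p q \<Omega> \<alpha> (\<lambda>z. f z + g z) \<le> enorm q (wmeasure \<Omega> \<alpha>)
      (\<lambda>y. ennreal (2 * 2 powr (1 / p)) * (enorm p lborel (\<lambda>x. f (Complex x y)) + enorm p lborel (\<lambda>x. g (Complex x y))))"
    unfolding mixed_norm_def using pq by (intro enorm_mono) auto
  also have "\<dots> = ennreal (2 * 2 powr (1 / p)) * enorm q (wmeasure \<Omega> \<alpha>)
      (\<lambda>y. enorm p lborel (\<lambda>x. f (Complex x y)) + enorm p lborel (\<lambda>x. g (Complex x y)))"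
    using pq by (intro enorm_cmult) auto
  also have "\<dots> < top"
    using lt pq unfolding mixed_norm_def
    by (intro ennreal_mult_less_top[THEN iffD2] disjI2 conjI enorm_add_lt_top) auto
  finally show ?thesis .
qed

text \<open>Hoelder on each line, then in the height with respect to \<open>y powr \<alpha>\<close>.
  The weights are shifted from the measures into the functions as
  \<open>\<Omega> powr (1 / q)\<close> and \<open>\<Omega>' powr (1 / q')\<close>; their product is
  1 because \<open>1 / q + (1 - q') / q' = 0\<close>. This is the origin of the exponent
  \<open>1 - q'\<close> of the dual weight.\<close>

theorem mixed_norm_Hoelder:
  assumes \<Omega>: "slow_weight \<Omega>" "slow_weight \<Omega>'" "\<And>y. 0 < y \<Longrightarrow> \<Omega>' y = \<Omega> y powr (1 - q')"
    and pq: "1 < p" "1 < q" "1 / p + 1 / p' = 1" "1 / q + 1 / q' = 1"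
    and [measurable]: "f \<in> borel_measurable borel" "g \<in> borel_measurable borel"
  shows "(\<integral>\<^sup>+ z. f z * g z \<partial>dV \<alpha>) \<le> mixed_norm p q \<Omega> \<alpha> f * mixed_norm p' q' \<Omega>' \<alpha> g"
proof -
  define F G where "F y = enorm p lborel (\<lambda>x. f (Complex x y))"
    and "G y = enorm p' lborel (\<lambda>x. g (Complex x y))" for y
  have [measurable]: "F \<in> borel_measurable borel" "G \<in> borel_measurable borel"
    unfolding F_def G_def by measurable
  have q': "0 < q'" using conjugate_exponent_gt_1[OF pq(2,4)] by simp
  \<comment> \<open>The factor \<open>y powr 0\<close> equals 1 for \<open>y > 0\<close>; it is kept
    so that \<open>slow_weight_measurable\<close> applies with exponent 0.\<close>
  have w: "(\<lambda>y. ennreal (indicator {0<..} y * (\<Omega> y * y powr 0))) \<in> borel_measurable borel"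
    "(\<lambda>y. ennreal (indicator {0<..} y * (\<Omega>' y * y powr 0))) \<in> borel_measurable borel"
    using slow_weight_measurable[OF \<Omega>(1)] slow_weight_measurable[OF \<Omega>(2)] by measurable
  define \<phi> \<psi> where "\<phi> y = F y * ennreal_powr (ennreal (indicator {0<..} y * (\<Omega> y * y powr 0))) (1 / q)"
    and "\<psi> y = G y * ennreal_powr (ennreal (indicator {0<..} y * (\<Omega>' y * y powr 0))) (1 / q')" for y
  have [measurable]: "\<phi> \<in> borel_measurable borel" "\<psi> \<in> borel_measurable borel"
    unfolding \<phi>_def \<psi>_def using w by measurable
  define \<nu> where "\<nu> = density lborel (\<lambda>y. ennreal (indicator {0<..} y * y powr \<alpha>))"
  have [measurable_cong]: "sets \<nu> = sets borel" by (simp add: \<nu>_def)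
  have change: "enorm r \<nu> (\<lambda>y. H y * ennreal_powr (ennreal (indicator {0<..} y * (W y * y powr 0))) (1 / r))
      = enorm r (wmeasure W \<alpha>) H"
    if W: "slow_weight W" and r: "0 < r" and [measurable]: "H \<in> borel_measurable borel" for W r H
  proof -
    have [measurable]: "(\<lambda>y. ennreal (indicator {0<..} y * (W y * y powr 0))) \<in> borel_measurable borel"
      using slow_weight_measurable[OF W] by measurable
    have "(\<integral>\<^sup>+ y. ennreal_powr (H y * ennreal_powr (ennreal (indicator {0<..} y * (W y * y powr 0))) (1 / r)) r \<partial>\<nu>)
      = (\<integral>\<^sup>+ y. ennreal (indicator {0<..} y * y powr \<alpha>) *
          ennreal_powr (H y * ennreal_powr (ennreal (indicator {0<..} y * (W y * y powr 0))) (1 / r)) r \<partial>lborel)"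
      unfolding \<nu>_def by (rule nn_integral_density) measurable
    also have "\<dots> = (\<integral>\<^sup>+ y\<in>{0<..}. ennreal_powr (H y) r * ennreal (W y * y powr \<alpha>) \<partial>lborel)"
    proof (rule nn_integral_cong)
      fix y :: real
      show "ennreal (indicator {0<..} y * y powr \<alpha>) *
          ennreal_powr (H y * ennreal_powr (ennreal (indicator {0<..} y * (W y * y powr 0))) (1 / r)) r
        = ennreal_powr (H y) r * ennreal (W y * y powr \<alpha>) * indicator {0<..} y"
      proof (cases "0 < y")
        case True
        then have "0 \<le> W y" using slow_weight_pos[OF W] by (simp add: less_imp_le)
        then show ?thesis
          using True r by (simp add: ennreal_powr_mult ennreal_powr_powr ennreal_mult mult_ac)
      qed simp
    qed
    also have "\<dots> = (\<integral>\<^sup>+ y. ennreal_powr (H y) r \<partial>wmeasure W \<alpha>)"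
      using W by (intro nn_integral_wmeasure[symmetric]) measurable
    finally show ?thesis by (simp add: enorm_def)
  qed
  have "(\<integral>\<^sup>+ z. f z * g z \<partial>dV \<alpha>) =
     (\<integral>\<^sup>+ y\<in>{0<..}. (\<integral>\<^sup>+ x. f (Complex x y) * g (Complex x y) \<partial>lborel) * ennreal (y powr \<alpha>) \<partial>lborel)"
    by (rule nn_integral_dV) auto
  also have "\<dots> \<le> (\<integral>\<^sup>+ y\<in>{0<..}. (F y * G y) * ennreal (y powr \<alpha>) \<partial>lborel)"
    unfolding F_def G_def using pq
    by (intro nn_integral_mono mult_right_mono Hoelder_nn_integral) auto
  also have "\<dots> = (\<integral>\<^sup>+ y. \<phi> y * \<psi> y \<partial>\<nu>)"
    unfolding \<nu>_def
  proof (subst nn_integral_density, simp_all, rule nn_integral_cong)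
    fix y :: real
    have "\<phi> y * \<psi> y = F y * G y" if "0 < y"
    proof -
      have "\<Omega> y powr (1 / q) * (\<Omega> y powr (1 - q')) powr (1 / q') = 1"
      proof -
        have "1 / q + (1 - q') * (1 / q') = 0" using pq q' by (simp add: field_simps)
        then show ?thesis using slow_weight_pos[OF \<Omega>(1) that] by (simp add: powr_powr flip: powr_add)
      qed
      then have "ennreal (\<Omega> y powr (1 / q)) * ennreal (\<Omega>' y powr (1 / q')) = 1"
        using \<Omega>(3)[OF that] by (simp flip: ennreal_mult)
      then show ?thesis
        unfolding \<phi>_def \<psi>_def using that slow_weight_pos[OF \<Omega>(1) that] slow_weight_pos[OF \<Omega>(2) that]
        by (simp add: ennreal_powr_ennreal less_imp_le)
           (metis (no_types, lifting) ab_semigroup_mult_class.mult_ac(1) mult.commute mult.right_neutral)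
    qed
    then show "F y * G y * ennreal (y powr \<alpha>) * indicator {0<..} y = ennreal (indicator {0<..} y * y powr \<alpha>) * (\<phi> y * \<psi> y)"
      by (cases "0 < y") (auto simp: mult.commute)
  qed
  also have "\<dots> \<le> enorm q \<nu> \<phi> * enorm q' \<nu> \<psi>"
    using pq by (intro Hoelder_nn_integral) measurable
  also have "enorm q \<nu> \<phi> = mixed_norm p q \<Omega> \<alpha> f"
    unfolding mixed_norm_def F_def[symmetric] \<phi>_def[abs_def] using \<Omega>(1) pq(2) by (intro change) auto
  also have "enorm q' \<nu> \<psi> = mixed_norm p' q' \<Omega>' \<alpha> g"
    unfolding mixed_norm_def G_def[symmetric] \<psi>_def[abs_def] using \<Omega>(2) q' by (intro change) auto
  finally show ?thesis .
qed

text \<open>Dominated convergence on lines and then in the height. The dominating slice has finite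
  norm for almost every height because the mixed norm of \<open>g\<close> is finite.\<close>

lemma mixed_norm_dominated:
  assumes \<Omega>: "slow_weight \<Omega>" and pq: "0 < p" "0 < q"
    and [measurable]: "\<And>n. f n \<in> borel_measurable borel" "g \<in> borel_measurable borel"
    and le: "\<And>n z. f n z \<le> g z" and g: "mixed_norm p q \<Omega> \<alpha> g < top"
    and lim: "\<And>z. (\<lambda>n. f n z) \<longlonglongrightarrow> 0"
  shows "(\<lambda>n. mixed_norm p q \<Omega> \<alpha> (f n)) \<longlonglongrightarrow> 0"
proof -
  have enorm_dom: "(\<lambda>n. enorm r M (u n)) \<longlonglongrightarrow> 0"
    if [measurable]: "\<And>n. u n \<in> borel_measurable M" "w \<in> borel_measurable M"
      and "\<And>n x. u n x \<le> w x" "enorm r M w < top" "AE x in M. (\<lambda>n. u n x) \<longlonglongrightarrow> 0" "0 < r"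
    for M :: "real measure" and u w r
  proof -
    have "(\<lambda>n. \<integral>\<^sup>+ x. ennreal_powr (u n x) r \<partial>M) \<longlonglongrightarrow> (\<integral>\<^sup>+ x. 0 \<partial>M)"
    proof (rule nn_integral_dominated_convergence)
      show "(\<integral>\<^sup>+ x. ennreal_powr (w x) r \<partial>M) < \<infinity>" using that by (simp add: enorm_def)
      show "AE x in M. (\<lambda>n. ennreal_powr (u n x) r) \<longlonglongrightarrow> 0"
        using that(5) by eventually_elim (use tendsto_ennreal_powr[of _ 0 _ r] that(6) in simp)
    qed (use that in \<open>auto intro!: ennreal_powr_mono\<close>)
    from tendsto_ennreal_powr[OF this, of "1 / r"] that(6) show ?thesis by (simp add: enorm_def)
  qed
  show ?thesis
    unfolding mixed_norm_def
  proof (rule enorm_dom)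
    have "AE y in wmeasure \<Omega> \<alpha>. ennreal_powr (enorm p lborel (\<lambda>x. g (Complex x y))) q \<noteq> \<infinity>"
      using g pq unfolding mixed_norm_def enorm_def[of q] by (intro nn_integral_PInf_AE) auto
    then show "AE y in wmeasure \<Omega> \<alpha>. (\<lambda>n. enorm p lborel (\<lambda>x. f n (Complex x y))) \<longlonglongrightarrow> 0"
    proof eventually_elim
      fix y assume "ennreal_powr (enorm p lborel (\<lambda>x. g (Complex x y))) q \<noteq> \<infinity>"
      then show "(\<lambda>n. enorm p lborel (\<lambda>x. f n (Complex x y))) \<longlonglongrightarrow> 0"
        using pq le lim by (intro enorm_dom[where w = "\<lambda>x. g (Complex x y)"]) (auto simp: less_top)
    qed
    show "enorm q (wmeasure \<Omega> \<alpha>) (\<lambda>y. enorm p lborel (\<lambda>x. g (Complex x y))) < top"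
      using g by (simp add: mixed_norm_def)
  qed (use pq le in \<open>auto intro!: enorm_mono\<close>)
qed

section \<open>Bergman spaces in terms of mixed norms\<close>

lemma bergman_measurable:
  assumes "f \<in> bergman p q \<Omega> \<alpha>" shows "f \<in> borel_measurable borel"
proof -
  have "continuous_on \<complex>\<^sub>+ f" using assms by (auto simp: bergman_def intro: holomorphic_on_imp_continuous_on)
  from borel_measurable_continuous_on_indicator[OF _ this]
  have "(\<lambda>z. indicator \<complex>\<^sub>+ z *\<^sub>R f z) \<in> borel_measurable borel" by simp
  also have "(\<lambda>z. indicator \<complex>\<^sub>+ z *\<^sub>R f z) = f"
    using assms by (auto simp: bergman_def indicator_def)
  finally show ?thesis .
qed

abbreviation mixed_cnorm :: "real \<Rightarrow> real \<Rightarrow> (real \<Rightarrow> real) \<Rightarrow> real \<Rightarrow> (complex \<Rightarrow> complex) \<Rightarrow> ennreal"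
  where "mixed_cnorm p q \<Omega> \<alpha> f \<equiv> mixed_norm p q \<Omega> \<alpha> (\<lambda>z. ennreal (cmod (f z)))"

lemma holomorphic_zero_ext_measurable:
  assumes "f holomorphic_on \<complex>\<^sub>+" "\<And>z. z \<notin> \<complex>\<^sub>+ \<Longrightarrow> f z = 0"
  shows "f \<in> borel_measurable borel"
proof -
  have "(\<lambda>z. indicator \<complex>\<^sub>+ z *\<^sub>R f z) \<in> borel_measurable borel"
    by (intro borel_measurable_continuous_on_indicator holomorphic_on_imp_continuous_on assms) simp
  also have "(\<lambda>z. indicator \<complex>\<^sub>+ z *\<^sub>R f z) = f"
    using assms by (auto simp: indicator_def)
  finally show ?thesis .
qed

lemma bergman_iff:
  assumes "slow_weight \<Omega>" "0 < p" "0 < q"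
  shows "f \<in> bergman p q \<Omega> \<alpha> \<longleftrightarrow>
    f holomorphic_on \<complex>\<^sub>+ \<and> (\<forall>z. z \<notin> \<complex>\<^sub>+ \<longrightarrow> f z = 0) \<and> mixed_cnorm p q \<Omega> \<alpha> f < top"
  using mixed_integral_eq[OF assms, of f] holomorphic_zero_ext_measurable[of f]
  by (auto simp: bergman_def)

lemma bergman_norm_eq:
  assumes "slow_weight \<Omega>" "0 < p" "0 < q" "f \<in> bergman p q \<Omega> \<alpha>"
  shows "ennreal (bergman_norm p q \<Omega> \<alpha> f) = mixed_cnorm p q \<Omega> \<alpha> f"
proof -
  have "mixed_cnorm p q \<Omega> \<alpha> f < top" using assms by (simp add: bergman_iff)
  then obtain r where r: "mixed_cnorm p q \<Omega> \<alpha> f = ennreal r" "0 \<le> r"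
    by (metis ennreal_cases less_irrefl)
  then show ?thesis
    using assms bergman_measurable[OF assms(4)]
    by (simp add: bergman_norm_def mixed_integral_eq ennreal_powr_ennreal powr_powr)
qed

section \<open>The maximal Bergman operator\<close>

text \<open>On the half-plane this is the modulus of the Bergman kernel up to constants, with
  \<open>cmod (z - cnj w)\<close> replaced by the sum of the moduli of its real and imaginary parts.
  The expression stays homogeneous, and its integral over a horizontal line is explicit.\<close>

definition kmaj :: "real \<Rightarrow> complex \<Rightarrow> complex \<Rightarrow> real"
  where "kmaj \<alpha> w z = (\<bar>Re z - Re w\<bar> + (Im z + Im w)) powr - (\<alpha> + 2)"

definition Pplus :: "real \<Rightarrow> (complex \<Rightarrow> ennreal) \<Rightarrow> complex \<Rightarrow> ennreal"
  where "Pplus \<alpha> h w = (\<integral>\<^sup>+ z. h z * ennreal (kmaj \<alpha> w z) \<partial>dV \<alpha>)"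

lemma measurable_kmaj [measurable (raw)]:
  assumes [measurable]: "f \<in> borel_measurable M" "g \<in> borel_measurable M"
  shows "(\<lambda>x. kmaj \<alpha> (f x) (g x)) \<in> borel_measurable M"
  unfolding kmaj_def by measurable

lemma kmaj_nonneg [simp]: "0 \<le> kmaj \<alpha> w z"
  by (simp add: kmaj_def)

lemma kmaj_commute: "kmaj \<alpha> w z = kmaj \<alpha> z w"
  by (simp add: kmaj_def abs_minus_commute add.commute)

lemma sets_dV [measurable_cong, simp]: "sets (dV \<alpha>) = sets borel"
  by (simp add: dV_def)

text \<open>In the variables \<open>z = Re w + \<tau> Im w + i t Im w\<close> the powers of \<open>Im w\<close> cancel, so that
  the operator is an average of the maps \<open>h \<mapsto> h (Re w + \<tau> Im w + i t Im w)\<close> with weights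
  independent of \<open>w\<close>. Hence Minkowski's inequality applies.\<close>

lemma Pplus_scale:
  assumes w: "w \<in> \<complex>\<^sub>+" and [measurable]: "h \<in> borel_measurable borel"
  shows "Pplus \<alpha> h w = (\<integral>\<^sup>+ t. \<integral>\<^sup>+ \<tau>. h (Complex (Re w + Im w * \<tau>) (Im w * t)) *
      ennreal (indicator {0<..} t * (t powr \<alpha> * (\<bar>\<tau>\<bar> + (1 + t)) powr - (\<alpha> + 2))) \<partial>lborel \<partial>lborel)"
proof -
  define y where "y = Im w"
  have y: "0 < y" using w by (simp add: y_def upper_half_plane_def)
  have "Pplus \<alpha> h w = (\<integral>\<^sup>+ v\<in>{0<..}. (\<integral>\<^sup>+ x. h (Complex x v) * ennreal (kmaj \<alpha> w (Complex x v)) \<partial>lborel) * ennreal (v powr \<alpha>) \<partial>lborel)"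
    unfolding Pplus_def by (rule nn_integral_dV) measurable
  also have "\<dots> = ennreal \<bar>y\<bar> * (\<integral>\<^sup>+ t. (\<integral>\<^sup>+ x. h (Complex x (0 + y * t)) * ennreal (kmaj \<alpha> w (Complex x (0 + y * t))) \<partial>lborel) * ennreal ((0 + y * t) powr \<alpha>) * indicator {0<..} (0 + y * t) \<partial>lborel)"
    using y by (intro nn_integral_real_affine) auto
  also have "\<dots> = (\<integral>\<^sup>+ t. ennreal \<bar>y\<bar> * ((\<integral>\<^sup>+ x. h (Complex x (0 + y * t)) * ennreal (kmaj \<alpha> w (Complex x (0 + y * t))) \<partial>lborel) * ennreal ((0 + y * t) powr \<alpha>) * indicator {0<..} (0 + y * t)) \<partial>lborel)"
    by (rule nn_integral_cmult[symmetric]) measurable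
  also have "\<dots> = (\<integral>\<^sup>+ t. \<integral>\<^sup>+ \<tau>. h (Complex (Re w + y * \<tau>) (y * t)) *
      ennreal (indicator {0<..} t * (t powr \<alpha> * (\<bar>\<tau>\<bar> + (1 + t)) powr - (\<alpha> + 2))) \<partial>lborel \<partial>lborel)"
  proof (rule nn_integral_cong)
    fix t :: real
    show "ennreal \<bar>y\<bar> * ((\<integral>\<^sup>+ x. h (Complex x (0 + y * t)) * ennreal (kmaj \<alpha> w (Complex x (0 + y * t))) \<partial>lborel) * ennreal ((0 + y * t) powr \<alpha>) * indicator {0<..} (0 + y * t))
      = (\<integral>\<^sup>+ \<tau>. h (Complex (Re w + y * \<tau>) (y * t)) *
      ennreal (indicator {0<..} t * (t powr \<alpha> * (\<bar>\<tau>\<bar> + (1 + t)) powr - (\<alpha> + 2))) \<partial>lborel)"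
    proof (cases "0 < t")
      case True
      have "(\<integral>\<^sup>+ x. h (Complex x (y * t)) * ennreal (kmaj \<alpha> w (Complex x (y * t))) \<partial>lborel)
        = ennreal \<bar>y\<bar> * (\<integral>\<^sup>+ \<tau>. h (Complex (Re w + y * \<tau>) (y * t)) * ennreal (kmaj \<alpha> w (Complex (Re w + y * \<tau>) (y * t))) \<partial>lborel)"
        using y by (intro nn_integral_real_affine) auto
      then have "ennreal \<bar>y\<bar> * ((\<integral>\<^sup>+ x. h (Complex x (0 + y * t)) * ennreal (kmaj \<alpha> w (Complex x (0 + y * t))) \<partial>lborel) * ennreal ((0 + y * t) powr \<alpha>) * indicator {0<..} (0 + y * t))
        = ennreal (y * y * (y * t) powr \<alpha>) * (\<integral>\<^sup>+ \<tau>. h (Complex (Re w + y * \<tau>) (y * t)) * ennreal (kmaj \<alpha> w (Complex (Re w + y * \<tau>) (y * t))) \<partial>lborel)"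
        using y True by (simp add: ennreal_mult mult_ac)
      also have "\<dots> = (\<integral>\<^sup>+ \<tau>. ennreal (y * y * (y * t) powr \<alpha>) * (h (Complex (Re w + y * \<tau>) (y * t)) * ennreal (kmaj \<alpha> w (Complex (Re w + y * \<tau>) (y * t)))) \<partial>lborel)"
        by (rule nn_integral_cmult[symmetric]) measurable
      also have "\<dots> = (\<integral>\<^sup>+ \<tau>. h (Complex (Re w + y * \<tau>) (y * t)) *
          ennreal (indicator {0<..} t * (t powr \<alpha> * (\<bar>\<tau>\<bar> + (1 + t)) powr - (\<alpha> + 2))) \<partial>lborel)"
      proof (rule nn_integral_cong)
        fix \<tau> :: real
        have "kmaj \<alpha> w (Complex (Re w + y * \<tau>) (y * t)) = (y * (\<bar>\<tau>\<bar> + (1 + t))) powr - (\<alpha> + 2)"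
          using y by (simp add: kmaj_def abs_mult y_def[symmetric] algebra_simps)
        also have "\<dots> = y powr - (\<alpha> + 2) * (\<bar>\<tau>\<bar> + (1 + t)) powr - (\<alpha> + 2)"
          using y True by (simp add: powr_mult)
        finally have "(y * y * (y * t) powr \<alpha>) * kmaj \<alpha> w (Complex (Re w + y * \<tau>) (y * t))
           = (y powr 1 * y powr 1 * y powr \<alpha> * y powr - (\<alpha> + 2)) * (t powr \<alpha> * (\<bar>\<tau>\<bar> + (1 + t)) powr - (\<alpha> + 2))"
          using y True by (simp add: powr_mult)
        also have "y powr 1 * y powr 1 * y powr \<alpha> * y powr - (\<alpha> + 2) = 1"
          using y by (simp only: powr_add[symmetric]) simp
        finally have "ennreal (y * y * (y * t) powr \<alpha>) * ennreal (kmaj \<alpha> w (Complex (Re w + y * \<tau>) (y * t)))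
           = ennreal (t powr \<alpha> * (\<bar>\<tau>\<bar> + (1 + t)) powr - (\<alpha> + 2))"
          using y by (simp flip: ennreal_mult)
        then show "ennreal (y * y * (y * t) powr \<alpha>) * (h (Complex (Re w + y * \<tau>) (y * t)) * ennreal (kmaj \<alpha> w (Complex (Re w + y * \<tau>) (y * t))))
          = h (Complex (Re w + y * \<tau>) (y * t)) * ennreal (indicator {0<..} t * (t powr \<alpha> * (\<bar>\<tau>\<bar> + (1 + t)) powr - (\<alpha> + 2)))"
          using True by (simp only: mult.left_commute[of "ennreal (y * y * (y * t) powr \<alpha>)"]) simp
      qed
      finally show ?thesis .
    next
      case False
      then show ?thesis using y by (simp add: zero_less_mult_iff indicator_def)
    qed
  qed
  finally show ?thesis by (simp add: y_def)
qed

text \<open>On a line of height \<open>y\<close> the map is a translation by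
  \<open>y * \<tau>\<close>, which preserves the norm of the slice; hence no dependence on
  \<open>\<tau>\<close>. The substitution \<open>y = u / t\<close> produces
  \<open>t powr (- (1 + \<alpha>) / q)\<close>, and slow variation with exponent
  \<open>q * \<eta>\<close> costs the powers with exponent \<open>\<eta>\<close> after the
  \<open>q\<close>-th root.\<close>

lemma mixed_norm_dilation:
  assumes \<Omega>: "slow_weight \<Omega>" and pq: "1 < p" "1 < q" and \<eta>: "0 < \<eta>"
  obtains C where "0 < C"
    "\<And>h t \<tau>. h \<in> borel_measurable borel \<Longrightarrow> 0 < t \<Longrightarrow>
      mixed_norm p q \<Omega> \<alpha> (\<lambda>z. h (Complex (Re z + Im z * \<tau>) (Im z * t)))
      \<le> ennreal (C * (t powr \<eta> + t powr - \<eta>) * t powr (- (1 + \<alpha>) / q)) * mixed_norm p q \<Omega> \<alpha> h"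
proof -
  obtain C where C: "0 < C" "\<And>y s. 0 < y \<Longrightarrow> 0 < s \<Longrightarrow> \<Omega> (s * y) \<le> C * (s powr (q * \<eta>) + s powr - (q * \<eta>)) * \<Omega> y"
    using slow_weightE[OF \<Omega>, of "q * \<eta>"] pq \<eta> by auto
  have "mixed_norm p q \<Omega> \<alpha> (\<lambda>z. h (Complex (Re z + Im z * \<tau>) (Im z * t)))
      \<le> ennreal (((2 * C) powr (1 / q)) * (t powr \<eta> + t powr - \<eta>) * t powr (- (1 + \<alpha>) / q)) * mixed_norm p q \<Omega> \<alpha> h"
    if [measurable]: "h \<in> borel_measurable borel" and t: "0 < t" for h t \<tau>
  proof -
    define F where "F y = enorm p lborel (\<lambda>x. h (Complex x y))" for y
    have [measurable]: "F \<in> borel_measurable borel" unfolding F_def by measurable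
    note [measurable] = slow_weight_measurable[OF \<Omega>]
    have slice: "enorm p lborel (\<lambda>x. h (Complex (x + y * \<tau>) (y * t))) = F (y * t)" for y
      unfolding F_def enorm_def
      by (subst (2) nn_integral_real_affine[where c = 1 and t = "y * \<tau>"]) (auto simp: add.commute)
    define D where "D = C * (t powr (q * \<eta>) + t powr - (q * \<eta>)) * t powr (- (1 + \<alpha>))"
    have D: "0 \<le> D" using C t by (simp add: D_def)
    have "(\<integral>\<^sup>+ y. ennreal_powr (F (y * t)) q \<partial>wmeasure \<Omega> \<alpha>)
       = (\<integral>\<^sup>+ y. ennreal_powr (F (y * t)) q * ennreal (indicator {0<..} y * (\<Omega> y * y powr \<alpha>)) \<partial>lborel)"
      unfolding wmeasure_def by (subst nn_integral_density) (auto simp: mult.commute)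
    also have "\<dots> = ennreal \<bar>1 / t\<bar> * (\<integral>\<^sup>+ u. ennreal_powr (F ((0 + 1 / t * u) * t)) q *
        ennreal (indicator {0<..} (0 + 1 / t * u) * (\<Omega> (0 + 1 / t * u) * (0 + 1 / t * u) powr \<alpha>)) \<partial>lborel)"
      using t by (intro nn_integral_real_affine) auto
    also have "\<dots> = (\<integral>\<^sup>+ u. ennreal \<bar>1 / t\<bar> * (ennreal_powr (F ((0 + 1 / t * u) * t)) q *
        ennreal (indicator {0<..} (0 + 1 / t * u) * (\<Omega> (0 + 1 / t * u) * (0 + 1 / t * u) powr \<alpha>))) \<partial>lborel)"
      by (intro nn_integral_cmult[symmetric]) measurable
    also have "\<dots> \<le> (\<integral>\<^sup>+ u. ennreal D * (ennreal_powr (F u) q * ennreal (indicator {0<..} u * (\<Omega> u * u powr \<alpha>))) \<partial>lborel)"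
    proof (rule nn_integral_mono)
      fix u :: real
      show "ennreal \<bar>1 / t\<bar> * (ennreal_powr (F ((0 + 1 / t * u) * t)) q *
          ennreal (indicator {0<..} (0 + 1 / t * u) * (\<Omega> (0 + 1 / t * u) * (0 + 1 / t * u) powr \<alpha>)))
        \<le> ennreal D * (ennreal_powr (F u) q * ennreal (indicator {0<..} u * (\<Omega> u * u powr \<alpha>)))"
      proof (cases "0 < u")
        case True
        have "1 / t * (\<Omega> (1 / t * u) * (1 / t * u) powr \<alpha>) \<le> D * (\<Omega> u * u powr \<alpha>)"
        proof -
          have "\<Omega> (1 / t * u) \<le> C * ((1 / t) powr (q * \<eta>) + (1 / t) powr - (q * \<eta>)) * \<Omega> u"
            using True t by (intro C) auto
          also have "(1 / t) powr (q * \<eta>) + (1 / t) powr - (q * \<eta>) = t powr (q * \<eta>) + t powr - (q * \<eta>)"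
            using t by (simp add: powr_divide powr_minus inverse_eq_divide)
          finally have le: "\<Omega> (1 / t * u) * (1 / t * (1 / t * u) powr \<alpha>)
             \<le> (C * (t powr (q * \<eta>) + t powr - (q * \<eta>)) * \<Omega> u) * (1 / t * (1 / t * u) powr \<alpha>)"
            using t by (intro mult_right_mono) auto
          have e: "1 / t * (1 / t * u) powr \<alpha> = t powr (- (1 + \<alpha>)) * u powr \<alpha>"
            using t True by (simp add: powr_divide powr_minus powr_add powr_diff divide_simps)
          have "1 / t * (\<Omega> (1 / t * u) * (1 / t * u) powr \<alpha>) = \<Omega> (1 / t * u) * (1 / t * (1 / t * u) powr \<alpha>)"
            by (simp only: mult.left_commute)
          also note le
          also have "(C * (t powr (q * \<eta>) + t powr - (q * \<eta>)) * \<Omega> u) * (1 / t * (1 / t * u) powr \<alpha>) = D * (\<Omega> u * u powr \<alpha>)"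
            unfolding e D_def by (simp only: mult_ac)
          finally show ?thesis .
        qed
        then have "ennreal (1 / t) * ennreal (\<Omega> (1 / t * u) * (1 / t * u) powr \<alpha>) \<le> ennreal D * ennreal (\<Omega> u * u powr \<alpha>)"
          using t D slow_weight_pos[OF \<Omega>, of "1 / t * u"] slow_weight_pos[OF \<Omega>, of u] True
          by (subst (1 2) ennreal_mult[symmetric]) (auto intro: ennreal_leI)
        from mult_left_mono[OF this, of "ennreal_powr (F u) q"] show ?thesis
          using True t by (simp add: mult_ac)
      qed (use t in \<open>simp add: zero_less_divide_iff\<close>)
    qed
    also have "\<dots> = ennreal D * (\<integral>\<^sup>+ y. ennreal_powr (F y) q \<partial>wmeasure \<Omega> \<alpha>)"
      unfolding wmeasure_def by (subst nn_integral_cmult, measurable, subst nn_integral_density) (auto simp: mult.commute)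
    finally have "mixed_norm p q \<Omega> \<alpha> (\<lambda>z. h (Complex (Re z + Im z * \<tau>) (Im z * t))) \<le>
        ennreal_powr (ennreal D * (\<integral>\<^sup>+ y. ennreal_powr (F y) q \<partial>wmeasure \<Omega> \<alpha>)) (1 / q)"
      unfolding mixed_norm_def enorm_def[of q] using pq by (simp add: slice ennreal_powr_mono)
    also have "\<dots> = ennreal (D powr (1 / q)) * mixed_norm p q \<Omega> \<alpha> h"
      using D by (simp add: ennreal_powr_mult ennreal_powr_ennreal mixed_norm_def enorm_def[of q] F_def)
    also have "D powr (1 / q) \<le> ((2 * C) powr (1 / q)) * (t powr \<eta> + t powr - \<eta>) * t powr (- (1 + \<alpha>) / q)"
    proof -
      have "(t powr (q * \<eta>) + t powr - (q * \<eta>)) powr (1 / q) \<le> (2 * max (t powr (q * \<eta>)) (t powr - (q * \<eta>))) powr (1 / q)"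
        using pq by (intro powr_mono2) auto
      also have "\<dots> = 2 powr (1 / q) * max (t powr (q * \<eta>)) (t powr - (q * \<eta>)) powr (1 / q)"
        by (simp add: powr_mult)
      also have "\<dots> \<le> 2 powr (1 / q) * (t powr \<eta> + t powr - \<eta>)"
        using pq by (intro mult_left_mono) (auto simp: max_def powr_powr)
      finally have "(t powr (q * \<eta>) + t powr - (q * \<eta>)) powr (1 / q) \<le> 2 powr (1 / q) * (t powr \<eta> + t powr - \<eta>)" .
      then have "C powr (1 / q) * (t powr (q * \<eta>) + t powr - (q * \<eta>)) powr (1 / q) * t powr (- (1 + \<alpha>) / q)
         \<le> C powr (1 / q) * (2 powr (1 / q) * (t powr \<eta> + t powr - \<eta>)) * t powr (- (1 + \<alpha>) / q)"
        by (intro mult_right_mono mult_left_mono) auto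
      then show ?thesis using C by (simp add: D_def powr_mult powr_powr mult_ac)
    qed
    finally show ?thesis by (simp add: ennreal_leI mult_right_mono)
  qed
  then show thesis using C by (intro that[of "(2 * C) powr (1 / q)"]) auto
qed

text \<open>Minkowski reduces the claim to finiteness of \<open>J\<close>, the average of the
  dilation bounds. Integrating out \<open>\<tau>\<close> leaves
  \<open>(1 + t) powr - (\<alpha> + 1)\<close> times powers of \<open>t\<close> with exponents
  \<open>\<alpha> - (1 + \<alpha>) / q\<close> plus or minus \<open>\<eta>\<close>. Convergence at 0
  asks for \<open>\<eta> < (1 + \<alpha>) - (1 + \<alpha>) / q\<close>, convergence at infinity for
  \<open>\<eta> < (1 + \<alpha>) / q\<close>.\<close>

theorem Pplus_bounded:
  assumes \<Omega>: "slow_weight \<Omega>" and pq: "1 < p" "1 < q" and \<alpha>: "-1 < \<alpha>"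
  obtains C where "0 < C"
    "\<And>h. h \<in> borel_measurable borel \<Longrightarrow> mixed_norm p q \<Omega> \<alpha> (Pplus \<alpha> h) \<le> ennreal C * mixed_norm p q \<Omega> \<alpha> h"
proof -
  \<comment> \<open>\<open>\<mu>\<close> is the smaller of the two margins for convergence at 0 and
    at infinity; half of it satisfies both strictly.\<close>
  define \<mu> where "\<mu> = (1 + \<alpha>) * min (1 / q) (1 - 1 / q)"
  define \<eta> where "\<eta> = \<mu> / 2"
  have "0 < \<mu>" using pq \<alpha> by (auto simp: \<mu>_def)
  moreover have "\<mu> \<le> (1 + \<alpha>) * (1 / q)" "\<mu> \<le> (1 + \<alpha>) * (1 - 1 / q)"
    unfolding \<mu>_def using \<alpha> by (intro mult_left_mono; simp)+
  then have "\<mu> \<le> (1 + \<alpha>) / q" "\<mu> \<le> (1 + \<alpha>) - (1 + \<alpha>) / q" by (simp_all add: right_diff_distrib)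
  ultimately have \<eta>: "0 < \<eta>" "\<eta> < (1 + \<alpha>) / q" "\<eta> < (1 + \<alpha>) - (1 + \<alpha>) / q"
    unfolding \<eta>_def by linarith+
  obtain C where C: "0 < C" "\<And>h t \<tau>. h \<in> borel_measurable borel \<Longrightarrow> 0 < t \<Longrightarrow>
      mixed_norm p q \<Omega> \<alpha> (\<lambda>z. h (Complex (Re z + Im z * \<tau>) (Im z * t)))
      \<le> ennreal (C * (t powr \<eta> + t powr - \<eta>) * t powr (- (1 + \<alpha>) / q)) * mixed_norm p q \<Omega> \<alpha> h"
  proof (rule mixed_norm_dilation[OF \<Omega> pq \<eta>(1), where \<alpha> = \<alpha>])
    fix C assume "0 < C" and "\<And>h t \<tau>. h \<in> borel_measurable borel \<Longrightarrow> 0 < t \<Longrightarrow>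
      mixed_norm p q \<Omega> \<alpha> (\<lambda>z. h (Complex (Re z + Im z * \<tau>) (Im z * t)))
      \<le> ennreal (C * (t powr \<eta> + t powr - \<eta>) * t powr (- (1 + \<alpha>) / q)) * mixed_norm p q \<Omega> \<alpha> h"
    then show thesis by (rule that)
  qed
  define m where "m t \<tau> = indicator {0<..} t * (t powr \<alpha> * (\<bar>\<tau>\<bar> + (1 + t)) powr - (\<alpha> + 2))" for t \<tau> :: real
  have [measurable]: "(\<lambda>x. m (f x) (g x)) \<in> borel_measurable M"
    if "f \<in> borel_measurable M" "g \<in> borel_measurable M" for f g and M :: "'z measure"
    unfolding m_def using that by measurable
  define J where "J = (\<integral>\<^sup>+ t. (\<integral>\<^sup>+ \<tau>. ennreal (m t \<tau>) * ennreal (C * (t powr \<eta> + t powr - \<eta>) * t powr (- (1 + \<alpha>) / q)) \<partial>lborel) \<partial>lborel)"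
  have bound: "mixed_norm p q \<Omega> \<alpha> (Pplus \<alpha> h) \<le> J * mixed_norm p q \<Omega> \<alpha> h"
    if [measurable]: "h \<in> borel_measurable borel" for h
  proof -
    have "mixed_norm p q \<Omega> \<alpha> (Pplus \<alpha> h) = mixed_norm p q \<Omega> \<alpha> (\<lambda>z. \<integral>\<^sup>+ t. \<integral>\<^sup>+ \<tau>. h (Complex (Re z + Im z * \<tau>) (Im z * t)) * ennreal (m t \<tau>) \<partial>lborel \<partial>lborel)"
      unfolding m_def by (intro mixed_norm_cong[OF \<Omega>] Pplus_scale) auto
    also have "\<dots> \<le> (\<integral>\<^sup>+ t. mixed_norm p q \<Omega> \<alpha> (\<lambda>z. \<integral>\<^sup>+ \<tau>. h (Complex (Re z + Im z * \<tau>) (Im z * t)) * ennreal (m t \<tau>) \<partial>lborel) \<partial>lborel)"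
      by (rule mixed_norm_Minkowski[OF \<Omega> pq]) (auto simp: lborel.sigma_finite_measure_axioms split_beta')
    also have "\<dots> \<le> (\<integral>\<^sup>+ t. \<integral>\<^sup>+ \<tau>. mixed_norm p q \<Omega> \<alpha> (\<lambda>z. h (Complex (Re z + Im z * \<tau>) (Im z * t)) * ennreal (m t \<tau>)) \<partial>lborel \<partial>lborel)"
      by (intro nn_integral_mono mixed_norm_Minkowski[OF \<Omega> pq]) (auto simp: lborel.sigma_finite_measure_axioms split_beta')
    also have "\<dots> \<le> (\<integral>\<^sup>+ t. \<integral>\<^sup>+ \<tau>. (ennreal (m t \<tau>) * ennreal (C * (t powr \<eta> + t powr - \<eta>) * t powr (- (1 + \<alpha>) / q))) * mixed_norm p q \<Omega> \<alpha> h \<partial>lborel \<partial>lborel)"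
    proof (intro nn_integral_mono)
      fix t \<tau> :: real
      have "mixed_norm p q \<Omega> \<alpha> (\<lambda>z. h (Complex (Re z + Im z * \<tau>) (Im z * t)) * ennreal (m t \<tau>))
        = ennreal (m t \<tau>) * mixed_norm p q \<Omega> \<alpha> (\<lambda>z. h (Complex (Re z + Im z * \<tau>) (Im z * t)))"
        using pq by (subst mixed_norm_cmult[symmetric]) (auto simp: mult.commute)
      also have "\<dots> \<le> ennreal (m t \<tau>) * (ennreal (C * (t powr \<eta> + t powr - \<eta>) * t powr (- (1 + \<alpha>) / q)) * mixed_norm p q \<Omega> \<alpha> h)"
      proof (cases "0 < t")
        case True
        then show ?thesis by (intro mult_left_mono C) auto
      qed (simp add: m_def)
      finally show "mixed_norm p q \<Omega> \<alpha> (\<lambda>z. h (Complex (Re z + Im z * \<tau>) (Im z * t)) * ennreal (m t \<tau>))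
        \<le> ennreal (m t \<tau>) * ennreal (C * (t powr \<eta> + t powr - \<eta>) * t powr (- (1 + \<alpha>) / q)) * mixed_norm p q \<Omega> \<alpha> h"
        by (simp add: mult.assoc)
    qed
    also have "\<dots> = J * mixed_norm p q \<Omega> \<alpha> h"
      unfolding J_def by (simp add: nn_integral_multc)
    finally show ?thesis .
  qed
  have "J = (\<integral>\<^sup>+ t\<in>{0<..}. ennreal (C * 2 / (\<alpha> + 1)) * (ennreal (t powr (\<alpha> - (1 + \<alpha>) / q + \<eta>) * (1 + t) powr - (\<alpha> + 1)) +
       ennreal (t powr (\<alpha> - (1 + \<alpha>) / q - \<eta>) * (1 + t) powr - (\<alpha> + 1))) \<partial>lborel)"
    unfolding J_def
  proof (rule nn_integral_cong)
    fix t :: real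
    show "(\<integral>\<^sup>+ \<tau>. ennreal (m t \<tau>) * ennreal (C * (t powr \<eta> + t powr - \<eta>) * t powr (- (1 + \<alpha>) / q)) \<partial>lborel)
      = ennreal (C * 2 / (\<alpha> + 1)) * (ennreal (t powr (\<alpha> - (1 + \<alpha>) / q + \<eta>) * (1 + t) powr - (\<alpha> + 1)) +
       ennreal (t powr (\<alpha> - (1 + \<alpha>) / q - \<eta>) * (1 + t) powr - (\<alpha> + 1))) * indicator {0<..} t"
    proof (cases "0 < t")
      case True
      have "(\<integral>\<^sup>+ \<tau>. ennreal (m t \<tau>) \<partial>lborel) = (\<integral>\<^sup>+ \<tau>. ennreal (t powr \<alpha>) * ennreal ((\<bar>\<tau>\<bar> + (1 + t)) powr - (\<alpha> + 2)) \<partial>lborel)"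
        using True by (intro nn_integral_cong) (simp add: m_def ennreal_mult)
      also have "\<dots> = ennreal (t powr \<alpha>) * (\<integral>\<^sup>+ \<tau>. ennreal ((\<bar>\<tau>\<bar> + (1 + t)) powr - (\<alpha> + 2)) \<partial>lborel)"
        by (rule nn_integral_cmult) measurable
      also have "(\<integral>\<^sup>+ \<tau>. ennreal ((\<bar>\<tau>\<bar> + (1 + t)) powr - (\<alpha> + 2)) \<partial>lborel) = ennreal (2 / (\<alpha> + 2 - 1) * (1 + t) powr (1 - (\<alpha> + 2)))"
        using True \<alpha> by (intro nn_integral_abs_powr) auto
      finally have "(\<integral>\<^sup>+ \<tau>. ennreal (m t \<tau>) * ennreal (C * (t powr \<eta> + t powr - \<eta>) * t powr (- (1 + \<alpha>) / q)) \<partial>lborel)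
        = ennreal (t powr \<alpha>) * ennreal (2 / (\<alpha> + 2 - 1) * (1 + t) powr (1 - (\<alpha> + 2))) * ennreal (C * (t powr \<eta> + t powr - \<eta>) * t powr (- (1 + \<alpha>) / q))"
        by (simp add: nn_integral_multc)
      also have "\<dots> = ennreal (t powr \<alpha> * (2 / (\<alpha> + 2 - 1) * (1 + t) powr (1 - (\<alpha> + 2))) * (C * (t powr \<eta> + t powr - \<eta>) * t powr (- (1 + \<alpha>) / q)))"
        by (rule trans[OF arg_cong2[where f = "(*)", OF ennreal_mult'[symmetric] refl] ennreal_mult'[symmetric]])
           (use \<alpha> in auto)
      also have "t powr \<alpha> * (2 / (\<alpha> + 2 - 1) * (1 + t) powr (1 - (\<alpha> + 2))) * (C * (t powr \<eta> + t powr - \<eta>) * t powr (- (1 + \<alpha>) / q))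
        = (C * 2 / (\<alpha> + 1)) * (t powr (\<alpha> - (1 + \<alpha>) / q + \<eta>) * (1 + t) powr - (\<alpha> + 1) + t powr (\<alpha> - (1 + \<alpha>) / q - \<eta>) * (1 + t) powr - (\<alpha> + 1))"
      proof -
        have "t powr (\<alpha> - (1 + \<alpha>) / q + \<eta>) = t powr \<alpha> * t powr (- (1 + \<alpha>) / q) * t powr \<eta>"
          "t powr (\<alpha> - (1 + \<alpha>) / q - \<eta>) = t powr \<alpha> * t powr (- (1 + \<alpha>) / q) * t powr - \<eta>"
          by (simp_all add: diff_divide_distrib add_divide_distrib algebra_simps flip: powr_add)
        then show ?thesis by (simp add: algebra_simps)
      qed
      also have "ennreal \<dots> = ennreal (C * 2 / (\<alpha> + 1)) * (ennreal (t powr (\<alpha> - (1 + \<alpha>) / q + \<eta>) * (1 + t) powr - (\<alpha> + 1)) +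
         ennreal (t powr (\<alpha> - (1 + \<alpha>) / q - \<eta>) * (1 + t) powr - (\<alpha> + 1)))"
        using C \<alpha> by (subst ennreal_mult) auto
      finally show ?thesis using True by simp
    qed (simp add: m_def)
  qed
  also have "\<dots> = ennreal (C * 2 / (\<alpha> + 1)) * ((\<integral>\<^sup>+ t\<in>{0<..}. ennreal (t powr (\<alpha> - (1 + \<alpha>) / q + \<eta>) * (1 + t) powr - (\<alpha> + 1)) \<partial>lborel) +
      (\<integral>\<^sup>+ t\<in>{0<..}. ennreal (t powr (\<alpha> - (1 + \<alpha>) / q - \<eta>) * (1 + t) powr - (\<alpha> + 1)) \<partial>lborel))"
    by (simp add: nn_integral_cmult nn_integral_add distrib_right mult.assoc)
  also have "\<dots> < top"
    using nn_integral_powr_finite[of "\<alpha> - (1 + \<alpha>) / q + \<eta>" "\<alpha> + 1"] nn_integral_powr_finite[of "\<alpha> - (1 + \<alpha>) / q - \<eta>" "\<alpha> + 1"] \<eta>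
    by (simp add: ennreal_mult_less_top)
  finally obtain j where j: "J = ennreal j" "0 \<le> j" by (metis ennreal_cases less_irrefl)
  have "mixed_norm p q \<Omega> \<alpha> (Pplus \<alpha> h) \<le> ennreal (j + 1) * mixed_norm p q \<Omega> \<alpha> h"
    if "h \<in> borel_measurable borel" for h
    using bound[OF that] j by (elim order_trans) (intro mult_right_mono, auto intro: ennreal_leI)
  then show thesis using j by (intro that[of "j + 1"]) auto
qed

section \<open>Compact boxes\<close>

text \<open>An exhaustion of the half-plane by compact sets. At \<open>r = 1\<close> the box
  degenerates to a segment, which is why positive measure is claimed from \<open>r = 2\<close>
  on.\<close>

definition hbox :: "real \<Rightarrow> complex set"
  where "hbox r = {z. \<bar>Re z\<bar> \<le> r \<and> 1 / r \<le> Im z \<and> Im z \<le> r}"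

lemma borel_hbox [measurable]: "hbox r \<in> sets borel"
  unfolding hbox_def by measurable

lemma hbox_subset: "1 \<le> r \<Longrightarrow> hbox r \<subseteq> \<complex>\<^sub>+"
proof
  fix z assume r: "1 \<le> r" and "z \<in> hbox r"
  then have "0 < 1 / r" "1 / r \<le> Im z" by (auto simp: hbox_def)
  then have "0 < Im z" by (rule less_le_trans)
  then show "z \<in> \<complex>\<^sub>+" by (simp add: upper_half_plane_def)
qed

lemma hbox_mono: "1 \<le> r \<Longrightarrow> r \<le> s \<Longrightarrow> hbox r \<subseteq> hbox s"
  using frac_le[of 1 1 r s] by (auto simp: hbox_def)

lemma in_hbox: "z \<in> \<complex>\<^sub>+ \<Longrightarrow> \<bar>Re z\<bar> \<le> r \<Longrightarrow> Im z \<le> r \<Longrightarrow> 1 / Im z \<le> r \<Longrightarrow> z \<in> hbox r"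
  by (auto simp: hbox_def upper_half_plane_def field_simps)

lemma compact_hbox: "compact (hbox r)"
proof -
  have "hbox r = cbox (Complex (- r) (1 / r)) (Complex r r)"
    by (auto simp: hbox_def in_cbox_complex_iff abs_le_iff)
  then show ?thesis by (simp add: compact_cbox)
qed

lemma hbox_exists:
  assumes "z \<in> \<complex>\<^sub>+" obtains r where "2 \<le> r" "z \<in> hbox r"
proof
  show "2 \<le> max 2 (max \<bar>Re z\<bar> (max (Im z) (1 / Im z)))" by simp
  show "z \<in> hbox (max 2 (max \<bar>Re z\<bar> (max (Im z) (1 / Im z))))"
    using assms by (intro in_hbox) auto
qed

text \<open>A Harnack-type estimate, uniform in \<open>z\<close>. Replacing \<open>w\<close> by
  \<open>\<zeta>\<close> changes the base of the power by at most \<open>3 * r\<close>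
  (\<open>2 * r\<close> from the real parts, \<open>r\<close> from the heights), and the base is at
  least \<open>1 / r\<close>, so the change is at most \<open>3 * r\<^sup>2\<close> times the
  base.\<close>

lemma kmaj_compare:
  assumes "- 2 < \<alpha>" "1 \<le> r" "w \<in> hbox r" "\<zeta> \<in> hbox r" "z \<in> \<complex>\<^sub>+"
  shows "kmaj \<alpha> w z \<le> (1 + 3 * r\<^sup>2) powr (\<alpha> + 2) * kmaj \<alpha> \<zeta> z"
proof -
  have "0 < 1 / r" using assms by simp
  let ?W = "\<bar>Re z - Re w\<bar> + (Im z + Im w)" and ?Z = "\<bar>Re z - Re \<zeta>\<bar> + (Im z + Im \<zeta>)"
  have b: "1 / r \<le> Im w" "1 / r \<le> Im \<zeta>" "0 < Im z" using assms by (auto simp: hbox_def upper_half_plane_def)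
  have pos: "0 < ?W" "0 < ?Z" using b \<open>0 < 1 / r\<close> by linarith+
  have "1 / r \<le> ?W" using b by simp
  then have "3 * r\<^sup>2 * (1 / r) \<le> 3 * r\<^sup>2 * ?W" by (intro mult_left_mono) auto
  then have r3: "3 * r \<le> 3 * r\<^sup>2 * ?W" using assms(2) by (simp add: power2_eq_square)
  have "\<bar>Re w\<bar> \<le> r" "\<bar>Re \<zeta>\<bar> \<le> r" "Im \<zeta> \<le> r" "0 < Im w"
    using assms less_le_trans[OF \<open>0 < 1 / r\<close> b(1)] by (auto simp: hbox_def)
  then have "?Z \<le> ?W + 3 * r" by linarith
  also have "\<dots> \<le> (1 + 3 * r\<^sup>2) * ?W" using r3 by (simp add: algebra_simps)
  finally have "((1 + 3 * r\<^sup>2) * ?W) powr - (\<alpha> + 2) \<le> ?Z powr - (\<alpha> + 2)"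
    using pos assms(1) by (intro powr_mono2') auto
  then have "(1 + 3 * r\<^sup>2) powr - (\<alpha> + 2) * ?W powr - (\<alpha> + 2) \<le> ?Z powr - (\<alpha> + 2)"
    using pos by (simp add: powr_mult)
  then have "(1 + 3 * r\<^sup>2) powr (\<alpha> + 2) * ((1 + 3 * r\<^sup>2) powr - (\<alpha> + 2) * ?W powr - (\<alpha> + 2)) \<le> (1 + 3 * r\<^sup>2) powr (\<alpha> + 2) * ?Z powr - (\<alpha> + 2)"
    by (intro mult_left_mono) auto
  moreover have "(1 + 3 * r\<^sup>2) powr (\<alpha> + 2) * (1 + 3 * r\<^sup>2) powr - (\<alpha> + 2) = 1"
  proof -
    have "0 < 1 + 3 * r\<^sup>2" using assms(2) by (simp add: add_pos_pos)
    then show ?thesis by (simp flip: powr_add)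
  qed
  ultimately show ?thesis by (simp add: kmaj_def flip: mult.assoc)
qed

lemma mixed_norm_hbox_finite:
  assumes \<Omega>: "slow_weight \<Omega>" and pq: "1 < p" "1 < q" and r: "1 \<le> r"
  shows "mixed_norm p q \<Omega> \<alpha> (indicator (hbox r)) < top"
proof -
  have "0 < 1 / r" using r by simp
  have "continuous_on {1 / r..r} (\<lambda>y. \<Omega> y * y powr \<alpha>)"
  proof -
    have "continuous_on {1 / r..r} \<Omega>"
      by (rule continuous_on_subset[of "{0<..}"]) (use \<Omega> less_le_trans[OF \<open>0 < 1 / r\<close>] in \<open>auto simp: slow_weight_def\<close>)
    then show ?thesis using \<open>0 < 1 / r\<close> by (intro continuous_intros) auto
  qed
  then have "bounded ((\<lambda>y. \<Omega> y * y powr \<alpha>) ` {1 / r..r})"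
    by (intro compact_imp_bounded compact_continuous_image) auto
  then obtain B where B: "\<forall>y\<in>{1 / r..r}. \<bar>\<Omega> y * y powr \<alpha>\<bar> \<le> B"
    by (auto simp: bounded_iff)
  have slice: "enorm p lborel (\<lambda>x. indicator (hbox r) (Complex x y)) = ennreal ((2 * r) powr (1 / p)) * indicator {1 / r..r} y" for y
  proof (cases "y \<in> {1 / r..r}")
    case True
    then have "(\<integral>\<^sup>+ x. ennreal_powr (indicator (hbox r) (Complex x y)) p \<partial>lborel) = (\<integral>\<^sup>+ x. indicator {-r..r} x \<partial>lborel)"
      by (intro nn_integral_cong) (auto simp: hbox_def indicator_def ennreal_powr_def)
    also have "\<dots> = ennreal (2 * r)" using r by simp
    finally show ?thesis using True r by (simp add: enorm_def ennreal_powr_ennreal)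
  next
    case False
    then have "indicator (hbox r) (Complex x y) = (0::ennreal)" for x by (auto simp: hbox_def indicator_def)
    then show ?thesis using False by (simp add: enorm_def)
  qed
  have "(\<integral>\<^sup>+ y. ennreal_powr (ennreal ((2 * r) powr (1 / p)) * indicator {1 / r..r} y) q \<partial>wmeasure \<Omega> \<alpha>)
     = (\<integral>\<^sup>+ y\<in>{0<..}. ennreal_powr (ennreal ((2 * r) powr (1 / p)) * indicator {1 / r..r} y) q * ennreal (\<Omega> y * y powr \<alpha>) \<partial>lborel)"
    by (rule nn_integral_wmeasure[OF \<Omega>]) measurable
  also have "\<dots> \<le> (\<integral>\<^sup>+ y. ennreal ((2 * r) powr (q / p) * B) * indicator {1 / r..r} y \<partial>lborel)"
  proof (rule nn_integral_mono)
    fix y :: real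
    show "ennreal_powr (ennreal ((2 * r) powr (1 / p)) * indicator {1 / r..r} y) q * ennreal (\<Omega> y * y powr \<alpha>) * indicator {0<..} y
      \<le> ennreal ((2 * r) powr (q / p) * B) * indicator {1 / r..r} y"
    proof (cases "y \<in> {1 / r..r}")
      case True
      then have "0 < y" using less_le_trans[OF \<open>0 < 1 / r\<close>] by auto
      have "ennreal ((2 * r) powr (q / p)) * ennreal (\<Omega> y * y powr \<alpha>) \<le> ennreal ((2 * r) powr (q / p)) * ennreal B"
        using B True by (intro mult_left_mono ennreal_leI) force+
      also have "\<dots> = ennreal ((2 * r) powr (q / p) * B)" by (simp add: ennreal_mult')
      finally show ?thesis using True \<open>0 < y\<close> by (simp add: ennreal_powr_ennreal powr_powr)
    qed simp
  qed
  also have "\<dots> < top" by (simp add: nn_integral_cmult ennreal_mult_less_top emeasure_lborel_Icc_eq)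
  finally show ?thesis unfolding mixed_norm_def slice by (simp add: enorm_def)
qed

lemma emeasure_hbox:
  assumes "2 \<le> r" shows "emeasure (dV \<alpha>) (hbox r) \<noteq> 0" and "emeasure (dV \<alpha>) (hbox r) < top"
proof -
  have "0 < 1 / r" using assms by simp
  have e: "emeasure (dV \<alpha>) (hbox r) = (\<integral>\<^sup>+ y. ennreal (2 * r) * ennreal (y powr \<alpha>) * indicator {1 / r..r} y \<partial>lborel)"
  proof -
    have "emeasure (dV \<alpha>) (hbox r) = (\<integral>\<^sup>+ z. indicator (hbox r) z \<partial>dV \<alpha>)" by simp
    also have "\<dots> = (\<integral>\<^sup>+ y\<in>{0<..}. (\<integral>\<^sup>+ x. indicator (hbox r) (Complex x y) \<partial>lborel) * ennreal (y powr \<alpha>) \<partial>lborel)"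
      by (rule nn_integral_dV) measurable
    also have "\<dots> = (\<integral>\<^sup>+ y. ennreal (2 * r) * ennreal (y powr \<alpha>) * indicator {1 / r..r} y \<partial>lborel)"
    proof (rule nn_integral_cong)
      fix y :: real
      have "(\<lambda>x. indicator (hbox r) (Complex x y) :: ennreal) = (\<lambda>x. indicator {-r..r} x * indicator {1 / r..r} y)"
        by (auto simp: hbox_def indicator_def abs_le_iff fun_eq_iff)
      moreover have "0 < y" if "y \<in> {1 / r..r}" using that less_le_trans[OF \<open>0 < 1 / r\<close>] by auto
      ultimately show "(\<integral>\<^sup>+ x. indicator (hbox r) (Complex x y) \<partial>lborel) * ennreal (y powr \<alpha>) * indicator {0<..} y
        = ennreal (2 * r) * ennreal (y powr \<alpha>) * indicator {1 / r..r} y"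
        using assms by (cases "y \<in> {1 / r..r}") (simp_all add: nn_integral_multc)
    qed
    finally show ?thesis .
  qed
  have c: "continuous_on {1 / r..r} (\<lambda>y. y powr \<alpha>)"
    using \<open>0 < 1 / r\<close> by (intro continuous_intros) auto
  then have "bounded ((\<lambda>y. y powr \<alpha>) ` {1 / r..r})"
    by (intro compact_imp_bounded compact_continuous_image) auto
  then obtain B where B: "\<forall>y\<in>{1 / r..r}. y powr \<alpha> \<le> B"
    by (auto simp: bounded_iff)
  have "emeasure (dV \<alpha>) (hbox r) \<le> (\<integral>\<^sup>+ y. (ennreal (2 * r) * ennreal B) * indicator {1 / r..r} y \<partial>lborel)"
    unfolding e using B by (intro nn_integral_mono) (auto simp: indicator_def intro!: mult_left_mono ennreal_leI)
  also have "\<dots> < top" by (simp add: nn_integral_cmult ennreal_mult_less_top emeasure_lborel_Icc_eq)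
  finally show "emeasure (dV \<alpha>) (hbox r) < top" .
  show "emeasure (dV \<alpha>) (hbox r) \<noteq> 0"
  proof
    assume "emeasure (dV \<alpha>) (hbox r) = 0"
    then have "AE y in lborel. ennreal (2 * r) * ennreal (y powr \<alpha>) * indicator {1 / r..r} y = 0"
      unfolding e by (subst (asm) nn_integral_0_iff_AE) auto
    then have "AE y in lborel. y \<notin> {1 / r..r}"
      by eventually_elim (use assms \<open>0 < 1 / r\<close> in \<open>auto simp: indicator_def\<close>)
    then have "emeasure lborel {1 / r..r} = 0"
      by (subst (asm) AE_iff_measurable[where N = "{1 / r..r}"]) auto
    moreover have "1 / r < r" using frac_le[of 1 1 2 r] assms by linarith
    ultimately show False by (simp add: emeasure_lborel_Icc_eq)
  qed
qed

text \<open>Averaging \<open>kmaj_compare\<close> over a box around \<open>w\<close> dominates the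
  majorant by a multiple of \<open>Pplus\<close> applied to the indicator of the box. Boundedness of
  \<open>Pplus\<close> thus replaces a computation of the norm; the box must have positive measure
  \<open>V\<close> for this division.\<close>

lemma mixed_norm_kmaj_finite:
  assumes \<Omega>: "slow_weight \<Omega>" and pq: "1 < p" "1 < q" and \<alpha>: "-1 < \<alpha>" and w: "w \<in> \<complex>\<^sub>+"
  shows "mixed_norm p q \<Omega> \<alpha> (\<lambda>z. ennreal (kmaj \<alpha> w z)) < top"
proof -
  obtain r where r: "2 \<le> r" "w \<in> hbox r" using hbox_exists[OF w] .
  define c where "c = (1 + 3 * r\<^sup>2) powr (\<alpha> + 2)"
  define V where "V = emeasure (dV \<alpha>) (hbox r)"
  have V: "V \<noteq> 0" "V < top" using emeasure_hbox[OF r(1)] by (auto simp: V_def)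
  obtain C where C: "0 < C"
    "\<And>h. h \<in> borel_measurable borel \<Longrightarrow> mixed_norm p q \<Omega> \<alpha> (Pplus \<alpha> h) \<le> ennreal C * mixed_norm p q \<Omega> \<alpha> h"
    using Pplus_bounded[OF \<Omega> pq \<alpha>] by blast
  have "V * mixed_norm p q \<Omega> \<alpha> (\<lambda>z. ennreal (kmaj \<alpha> w z)) = mixed_norm p q \<Omega> \<alpha> (\<lambda>z. V * ennreal (kmaj \<alpha> w z))"
    using pq by (subst mixed_norm_cmult) auto
  also have "\<dots> \<le> mixed_norm p q \<Omega> \<alpha> (\<lambda>z. ennreal c * Pplus \<alpha> (indicator (hbox r)) z)"
  proof (rule mixed_norm_mono[OF \<Omega>])
    fix z assume z: "z \<in> \<complex>\<^sub>+"
    have "V * ennreal (kmaj \<alpha> w z) = (\<integral>\<^sup>+ \<zeta>. ennreal (kmaj \<alpha> w z) * indicator (hbox r) \<zeta> \<partial>dV \<alpha>)"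
      unfolding V_def by (subst nn_integral_cmult) (auto simp: mult.commute)
    also have "\<dots> \<le> (\<integral>\<^sup>+ \<zeta>. ennreal c * (indicator (hbox r) \<zeta> * ennreal (kmaj \<alpha> z \<zeta>)) \<partial>dV \<alpha>)"
    proof (rule nn_integral_mono)
      fix \<zeta>
      show "ennreal (kmaj \<alpha> w z) * indicator (hbox r) \<zeta> \<le> ennreal c * (indicator (hbox r) \<zeta> * ennreal (kmaj \<alpha> z \<zeta>))"
        using kmaj_compare[of \<alpha> r w \<zeta> z] r \<alpha> z
        by (cases "\<zeta> \<in> hbox r") (auto simp: c_def kmaj_commute[of \<alpha> z] intro!: ennreal_leI simp flip: ennreal_mult)
    qed
    also have "\<dots> = ennreal c * Pplus \<alpha> (indicator (hbox r)) z"
      unfolding Pplus_def by (rule nn_integral_cmult) measurable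
    finally show "V * ennreal (kmaj \<alpha> w z) \<le> ennreal c * Pplus \<alpha> (indicator (hbox r)) z" .
  qed (use pq in auto)
  also have "\<dots> = ennreal c * mixed_norm p q \<Omega> \<alpha> (Pplus \<alpha> (indicator (hbox r)))"
  proof (rule mixed_norm_cmult)
    interpret sigma_finite_measure "dV \<alpha>"
      unfolding dV_def by (subst sigma_finite_measure.sigma_finite_iff_density_finite[OF lborel.sigma_finite_measure_axioms]) auto
    show "Pplus \<alpha> (indicator (hbox r)) \<in> borel_measurable borel"
      unfolding Pplus_def[abs_def] by measurable
  qed (use pq in auto)
  also have "\<dots> \<le> ennreal c * (ennreal C * mixed_norm p q \<Omega> \<alpha> (indicator (hbox r)))"
    by (intro mult_left_mono C) auto
  also have "\<dots> < top"
    using mixed_norm_hbox_finite[OF \<Omega> pq, of r \<alpha>] r by (simp add: ennreal_mult_less_top)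
  finally show ?thesis using V by (auto simp: ennreal_mult_less_top)
qed

section \<open>Cauchy's theorem on rectangles and strips\<close>

text \<open>Interchanging real and imaginary parts turns the segment into a vertical one; the factor
  \<i> that this produces cancels.\<close>

lemma contour_integral_linepath_horizontal:
  assumes "a < b"
  shows "contour_integral (linepath (Complex a y) (Complex b y)) f = integral {a..b} (\<lambda>x. f (Complex x y))"
proof -
  define g where "g \<zeta> = f (Complex (Im \<zeta>) (Re \<zeta>))" for \<zeta>
  have "\<i> * integral {a..b} (\<lambda>x. f (Complex x y)) = contour_integral (linepath (Complex y a) (Complex y b)) g"
    using assms by (subst contour_integral_linepath_same_Re[of _ y _ a b]) (auto simp: g_def)
  also have "\<dots> = (Complex y b - Complex y a) * integral {0..1} (\<lambda>t. g (linepath (Complex y a) (Complex y b) t))"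
    by (simp add: contour_integral_integral)
  also have "(\<lambda>t. g (linepath (Complex y a) (Complex y b) t)) = (\<lambda>t. f (linepath (Complex a y) (Complex b y) t))"
    by (auto simp: g_def linepath_def complex_eq_iff intro!: arg_cong[of _ _ f])
  also have "Complex y b - Complex y a = \<i> * (Complex b y - Complex a y)"
    by (simp add: complex_eq_iff)
  finally show ?thesis by (simp add: contour_integral_integral)
qed

lemma contour_integral_rectpath:
  assumes "x1 < x2" "y1 < y2"
    and cont: "continuous_on (path_image (rectpath (Complex x1 y1) (Complex x2 y2))) f"
  shows "contour_integral (rectpath (Complex x1 y1) (Complex x2 y2)) f =
     integral {x1..x2} (\<lambda>x. f (Complex x y1)) + \<i> * integral {y1..y2} (\<lambda>y. f (Complex x2 y)) -
     integral {x1..x2} (\<lambda>x. f (Complex x y2)) - \<i> * integral {y1..y2} (\<lambda>y. f (Complex x1 y))"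
proof -
  let ?a = "Complex x1 y1" and ?b = "Complex x2 y1" and ?c = "Complex x2 y2" and ?d = "Complex x1 y2"
  have "path_image (rectpath ?a ?c) = closed_segment ?a ?b \<union> closed_segment ?b ?c \<union> closed_segment ?c ?d \<union> closed_segment ?d ?a"
    by (simp add: rectpath_def Let_def path_image_join Un_assoc)
  then have c: "continuous_on (closed_segment ?a ?b) f" "continuous_on (closed_segment ?b ?c) f"
    "continuous_on (closed_segment ?c ?d) f" "continuous_on (closed_segment ?d ?a) f"
    using cont by (auto elim: continuous_on_subset)
  note ci = c[THEN contour_integrable_continuous_linepath]
  have "contour_integral (rectpath ?a ?c) f = contour_integral (linepath ?a ?b) f +
     (contour_integral (linepath ?b ?c) f + (contour_integral (linepath ?c ?d) f + contour_integral (linepath ?d ?a) f))"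
    using ci by (simp add: rectpath_def Let_def)
  also have "contour_integral (linepath ?c ?d) f = - contour_integral (linepath ?d ?c) f"
    using c by (intro contour_integral_reverse_linepath) auto
  also have "contour_integral (linepath ?d ?a) f = - contour_integral (linepath ?a ?d) f"
    using c by (intro contour_integral_reverse_linepath) auto
  finally show ?thesis
    using assms by (simp add: contour_integral_linepath_horizontal contour_integral_linepath_same_Re[of _ _ _ y1 y2])
qed

lemma path_image_rectpath_Complex:
  assumes "x1 < x2" "y1 < y2"
  shows "path_image (rectpath (Complex x1 y1) (Complex x2 y2)) =
    {z. (Re z = x1 \<or> Re z = x2) \<and> y1 \<le> Im z \<and> Im z \<le> y2} \<union> {z. (Im z = y1 \<or> Im z = y2) \<and> x1 \<le> Re z \<and> Re z \<le> x2}"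
  using assms by (subst path_image_rectpath) auto

lemma rectpath_Cauchy_formula:
  assumes xy: "x1 < Re w" "Re w < x2" "y1 < Im w" "Im w < y2"
    and f: "f holomorphic_on {z. x1 \<le> Re z \<and> Re z \<le> x2 \<and> y1 \<le> Im z \<and> Im z \<le> y2}"
  shows "2 * pi * \<i> * f w =
     integral {x1..x2} (\<lambda>x. f (Complex x y1) / (Complex x y1 - w)) +
     \<i> * integral {y1..y2} (\<lambda>y. f (Complex x2 y) / (Complex x2 y - w)) -
     integral {x1..x2} (\<lambda>x. f (Complex x y2) / (Complex x y2 - w)) -
     \<i> * integral {y1..y2} (\<lambda>y. f (Complex x1 y) / (Complex x1 y - w))"
proof -
  let ?R = "rectpath (Complex x1 y1) (Complex x2 y2)"
  let ?S = "cbox (Complex x1 y1) (Complex x2 y2)"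
  have S: "?S = {z. x1 \<le> Re z \<and> Re z \<le> x2 \<and> y1 \<le> Im z \<and> Im z \<le> y2}"
    by (auto simp: in_cbox_complex_iff)
  have im: "path_image ?R \<subseteq> ?S - {w}"
    using xy by (subst path_image_rectpath_Complex) (auto simp: in_cbox_complex_iff)
  have "((\<lambda>z. f z / (z - w)) has_contour_integral (2 * pi * \<i> * winding_number ?R w * f w)) ?R"
    using f im xy unfolding S[symmetric]
    by (intro Cauchy_integral_formula_convex_simple[of ?S]) (auto simp: in_box_complex_iff)
  moreover have "winding_number ?R w = 1"
    using xy by (intro winding_number_rectpath) (auto simp: in_box_complex_iff)
  ultimately have "2 * pi * \<i> * f w = contour_integral ?R (\<lambda>z. f z / (z - w))"
    by (simp add: contour_integral_unique)
  also have "continuous_on (path_image ?R) (\<lambda>z. f z / (z - w))"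
    using im holomorphic_on_imp_continuous_on[OF f] unfolding S[symmetric]
    by (intro continuous_intros) (auto elim: continuous_on_subset)
  note contour_integral_rectpath[OF _ _ this]
  finally show ?thesis using xy by simp
qed

lemma rectpath_Cauchy_theorem:
  assumes xy: "x1 < x2" "y1 < y2"
    and f: "f holomorphic_on {z. x1 \<le> Re z \<and> Re z \<le> x2 \<and> y1 \<le> Im z \<and> Im z \<le> y2}"
  shows "integral {x1..x2} (\<lambda>x. f (Complex x y1)) - integral {x1..x2} (\<lambda>x. f (Complex x y2)) =
    \<i> * integral {y1..y2} (\<lambda>y. f (Complex x1 y)) - \<i> * integral {y1..y2} (\<lambda>y. f (Complex x2 y))"
proof -
  let ?R = "rectpath (Complex x1 y1) (Complex x2 y2)"
  let ?S = "cbox (Complex x1 y1) (Complex x2 y2)"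
  have S: "?S = {z. x1 \<le> Re z \<and> Re z \<le> x2 \<and> y1 \<le> Im z \<and> Im z \<le> y2}"
    by (auto simp: in_cbox_complex_iff)
  have im: "path_image ?R \<subseteq> ?S"
    using xy by (subst path_image_rectpath_Complex) (auto simp: in_cbox_complex_iff)
  have "(f has_contour_integral 0) ?R"
    using f im unfolding S[symmetric] by (intro Cauchy_theorem_convex_simple[of f ?S]) auto
  then have "0 = contour_integral ?R f" by (simp add: contour_integral_unique)
  also have "continuous_on (path_image ?R) f"
    using im holomorphic_on_imp_continuous_on[OF f] unfolding S[symmetric] by (auto elim: continuous_on_subset)
  note contour_integral_rectpath[OF xy this]
  finally show ?thesis by (simp add: algebra_simps)
qed

lemma integral_tendsto_lebesgue:
  fixes f :: "real \<Rightarrow> complex"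
  assumes "integrable lborel f"
  shows "(\<lambda>n. integral {- real n..real n} f) \<longlonglongrightarrow> (\<integral>x. f x \<partial>lborel)"
proof -
  have "integral {- real n..real n} f = (\<integral>x. indicator {- real n..real n} x *\<^sub>R f x \<partial>lborel)" for n
    using set_borel_integral_eq_integral(2)[of "{- real n..real n}" f] integrable_mult_indicator[OF _ assms, of "{- real n..real n}"]
    by (simp add: set_integrable_def set_lebesgue_integral_def)
  moreover have "(\<lambda>n. \<integral>x. indicator {- real n..real n} x *\<^sub>R f x \<partial>lborel) \<longlonglongrightarrow> (\<integral>x. f x \<partial>lborel)"
  proof (rule integral_dominated_convergence[where w = "\<lambda>x. norm (f x)"])
    show "AE x in lborel. (\<lambda>n. indicator {- real n..real n} x *\<^sub>R f x) \<longlonglongrightarrow> f x"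
    proof (rule AE_I2)
      fix x :: real
      have "eventually (\<lambda>n. \<bar>x\<bar> \<le> real n) sequentially"
        by (meson eventually_sequentiallyI nat_ceiling_le_eq)
      then have "eventually (\<lambda>n. indicator {- real n..real n} x *\<^sub>R f x = f x) sequentially"
        by eventually_elim (auto simp: indicator_def abs_le_iff)
      then show "(\<lambda>n. indicator {- real n..real n} x *\<^sub>R f x) \<longlonglongrightarrow> f x"
        by (rule tendsto_eventually)
    qed
  qed (use assms in \<open>auto simp: indicator_def\<close>)
  ultimately show ?thesis by simp
qed

lemma integrable_powr_decay:
  fixes f :: "real \<Rightarrow> complex"
  assumes [measurable]: "f \<in> borel_measurable borel" and s: "1 < s" "\<And>x. cmod (f x) \<le> C * (1 + \<bar>x\<bar>) powr - s"
  shows "integrable lborel f"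
proof (rule integrableI_bounded)
  have C: "0 \<le> C" using s(2)[of 0] by (auto intro: order_trans[OF norm_ge_zero])
  have "(\<integral>\<^sup>+ x. ennreal (norm (f x)) \<partial>lborel) \<le> (\<integral>\<^sup>+ x. ennreal C * ennreal ((\<bar>x\<bar> + 1) powr - s) \<partial>lborel)"
    using s C by (intro nn_integral_mono) (simp add: ennreal_leI add.commute flip: ennreal_mult)
  also have "\<dots> = ennreal C * ennreal (2 / (s - 1) * 1 powr (1 - s))"
    using s by (subst nn_integral_cmult) (auto simp: nn_integral_abs_powr)
  also have "\<dots> < \<infinity>" by (simp add: ennreal_mult_less_top)
  finally show "(\<integral>\<^sup>+ x. ennreal (norm (f x)) \<partial>lborel) < \<infinity>" .
qed simp

lemma horizontal_line_continuous:
  assumes "continuous_on S f" "\<And>x. Complex x y \<in> S"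
  shows "continuous_on UNIV (\<lambda>x. f (Complex x y))"
  by (rule continuous_on_compose2[OF assms(1)]) (auto simp: Complex_eq assms intro!: continuous_intros, use assms(2) in \<open>simp add: Complex_eq\<close>)

text \<open>Cauchy's theorem on the rectangles over \<open>{- n..n}\<close>. The decay of order
  \<open>s > 1\<close> makes both line integrals converge, and it kills the vertical sides, whose
  length \<open>b - a\<close> is fixed.\<close>

lemma horizontal_shift:
  fixes f :: "complex \<Rightarrow> complex"
  assumes ab: "a < b" and f: "f holomorphic_on {z. a \<le> Im z \<and> Im z \<le> b}"
    and s: "1 < s" and le: "\<And>z. a \<le> Im z \<Longrightarrow> Im z \<le> b \<Longrightarrow> cmod (f z) \<le> C * (1 + \<bar>Re z\<bar>) powr - s"
  shows "(\<integral>x. f (Complex x a) \<partial>lborel) = (\<integral>x. f (Complex x b) \<partial>lborel)"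
proof -
  note c = holomorphic_on_imp_continuous_on[OF f]
  have int: "integrable lborel (\<lambda>x. f (Complex x y))" if "a \<le> y" "y \<le> b" for y
  proof (rule integrable_powr_decay[OF _ s])
    show "(\<lambda>x. f (Complex x y)) \<in> borel_measurable borel"
      by (intro borel_measurable_continuous_onI horizontal_line_continuous[OF c]) (use that in auto)
    show "cmod (f (Complex x y)) \<le> C * (1 + \<bar>x\<bar>) powr - s" for x
      using le[of "Complex x y"] that by simp
  qed
  have side: "norm (integral {a..b} (\<lambda>y. f (Complex x y))) \<le> C * (1 + \<bar>x\<bar>) powr - s * (b - a)" for x
  proof (rule integral_bound)
    show "continuous_on {a..b} (\<lambda>y. f (Complex x y))"
      by (rule continuous_on_compose2[OF c]) (auto simp: Complex_eq intro!: continuous_intros)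
    show "norm (f (Complex x t)) \<le> C * (1 + \<bar>x\<bar>) powr - s" if "t \<in> {a..b}" for t
      using le[of "Complex x t"] that by simp
  qed (use ab in auto)
  have lim0: "(\<lambda>n. C * (1 + real n) powr - s * (b - a)) \<longlonglongrightarrow> 0"
  proof -
    have "filterlim (\<lambda>n. 1 + real n) at_top sequentially"
      by (intro filterlim_tendsto_add_at_top[OF tendsto_const] filterlim_real_sequentially)
    then have "(\<lambda>n. (1 + real n) powr - s) \<longlonglongrightarrow> 0" using s by (intro tendsto_neg_powr) auto
    then have "(\<lambda>n. C * (1 + real n) powr - s * (b - a)) \<longlonglongrightarrow> C * 0 * (b - a)" by (intro tendsto_intros)
    then show ?thesis by simp
  qed
  have "(\<lambda>n. integral {- real n..real n} (\<lambda>x. f (Complex x a)) - integral {- real n..real n} (\<lambda>x. f (Complex x b)))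
      \<longlonglongrightarrow> (\<integral>x. f (Complex x a) \<partial>lborel) - (\<integral>x. f (Complex x b) \<partial>lborel)"
    using ab by (intro tendsto_diff integral_tendsto_lebesgue int) auto
  moreover have "(\<lambda>n. integral {- real n..real n} (\<lambda>x. f (Complex x a)) - integral {- real n..real n} (\<lambda>x. f (Complex x b))) \<longlonglongrightarrow> 0"
  proof (rule Lim_null_comparison)
    show "\<forall>\<^sub>F n in sequentially. norm (integral {- real n..real n} (\<lambda>x. f (Complex x a)) - integral {- real n..real n} (\<lambda>x. f (Complex x b)))
       \<le> C * (1 + real n) powr - s * (b - a) + C * (1 + real n) powr - s * (b - a)"
      using eventually_gt_at_top[of 0]
    proof eventually_elim
      fix n :: nat assume n: "0 < n"
      have "integral {- real n..real n} (\<lambda>x. f (Complex x a)) - integral {- real n..real n} (\<lambda>x. f (Complex x b))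
        = \<i> * integral {a..b} (\<lambda>y. f (Complex (- real n) y)) - \<i> * integral {a..b} (\<lambda>y. f (Complex (real n) y))"
        using n ab by (intro rectpath_Cauchy_theorem holomorphic_on_subset[OF f]) auto
      also have "norm \<dots> \<le> norm (\<i> * integral {a..b} (\<lambda>y. f (Complex (- real n) y))) + norm (\<i> * integral {a..b} (\<lambda>y. f (Complex (real n) y)))"
        by (rule norm_triangle_ineq4)
      also have "\<dots> \<le> C * (1 + real n) powr - s * (b - a) + C * (1 + real n) powr - s * (b - a)"
        using add_mono[OF side[of "- real n"] side[of "real n"]] by (simp add: norm_mult)
      finally show "norm (integral {- real n..real n} (\<lambda>x. f (Complex x a)) - integral {- real n..real n} (\<lambda>x. f (Complex x b)))
       \<le> C * (1 + real n) powr - s * (b - a) + C * (1 + real n) powr - s * (b - a)" .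
    qed
    show "(\<lambda>n. C * (1 + real n) powr - s * (b - a) + C * (1 + real n) powr - s * (b - a)) \<longlonglongrightarrow> 0"
      using tendsto_add[OF lim0 lim0] by simp
  qed
  ultimately have "(\<integral>x. f (Complex x a) \<partial>lborel) - (\<integral>x. f (Complex x b) \<partial>lborel) = 0"
    by (rule LIMSEQ_unique)
  then show ?thesis by simp
qed

text \<open>Cauchy's formula on rectangles of width \<open>2 * n\<close> and height \<open>n\<close>
  standing on the line. The other three sides have total length \<open>4 * n\<close>, and the
  integrand there is at most \<open>D n\<close>, of order \<open>1 / n\<^sup>2\<close>.\<close>

lemma Cauchy_half_plane_decay:
  fixes f :: "complex \<Rightarrow> complex"
  assumes w: "h < Im w" "0 < h" and f: "f holomorphic_on {z. h \<le> Im z}"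
    and le: "\<And>z. h \<le> Im z \<Longrightarrow> cmod (f z) \<le> C / (1 + cmod z)"
    and int: "integrable lborel (\<lambda>x. f (Complex x h) / (Complex x h - w))"
  shows "(\<integral>x. f (Complex x h) / (Complex x h - w) \<partial>lborel) = 2 * pi * \<i> * f w"
proof -
  note c = holomorphic_on_imp_continuous_on[OF f]
  have C: "0 \<le> C" using le[of "Complex 0 h"] w norm_ge_zero[of "f (Complex 0 h)"]
    by (smt (verit, best) complex.sel(2) divide_neg_pos norm_ge_zero)
  define D where "D n = C / (real n * (real n - cmod w))" for n
  have bound: "cmod (f z / (z - w)) \<le> D n" if "h \<le> Im z" "real n \<le> cmod z" "cmod w < real n" for z n
  proof -
    have "0 < real n" using le_less_trans[OF norm_ge_zero that(3)] .
    have "real n - cmod w \<le> cmod (z - w)" using that norm_triangle_ineq2[of z w] by simp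
    moreover have "cmod (f z) \<le> C / real n"
      by (rule order_trans[OF le[OF that(1)]]) (use C that \<open>0 < real n\<close> in \<open>auto intro!: divide_left_mono\<close>)
    ultimately have "cmod (f z) / cmod (z - w) \<le> (C / real n) / (real n - cmod w)"
      using that C \<open>0 < real n\<close> by (intro frac_le) auto
    then show ?thesis by (simp add: norm_divide D_def)
  qed
  have lim0: "(\<lambda>n. D n * real n + D n * (2 * real n) + D n * real n) \<longlonglongrightarrow> 0"
  proof -
    have "filterlim (\<lambda>n. - cmod w + real n) at_top sequentially"
      by (intro filterlim_tendsto_add_at_top[OF tendsto_const] filterlim_real_sequentially)
    then have "(\<lambda>n. 4 * C / (- cmod w + real n)) \<longlonglongrightarrow> 0"
      by (rule tendsto_divide_0[OF tendsto_const filterlim_at_top_imp_at_infinity])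
    moreover have "eventually (\<lambda>n. 4 * C / (- cmod w + real n) = D n * real n + D n * (2 * real n) + D n * real n) sequentially"
      using eventually_gt_at_top[of 0] by eventually_elim (simp add: D_def)
    ultimately show ?thesis by (rule Lim_transform_eventually)
  qed
  have ev: "\<forall>\<^sub>F n in sequentially. cmod w < real n \<and> Im w < h + real n"
  proof -
    have "\<forall>\<^sub>F n in sequentially. cmod w < real n" using filterlim_real_sequentially by (simp add: filterlim_at_top_dense)
    then show ?thesis
      by eventually_elim (use w abs_Im_le_cmod[of w] in auto)
  qed
  have "(\<lambda>n. integral {- real n..real n} (\<lambda>x. f (Complex x h) / (Complex x h - w)) - 2 * pi * \<i> * f w)
     \<longlonglongrightarrow> (\<integral>x. f (Complex x h) / (Complex x h - w) \<partial>lborel) - 2 * pi * \<i> * f w"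
    by (intro tendsto_diff integral_tendsto_lebesgue int tendsto_const)
  moreover have "(\<lambda>n. integral {- real n..real n} (\<lambda>x. f (Complex x h) / (Complex x h - w)) - 2 * pi * \<i> * f w) \<longlonglongrightarrow> 0"
  proof (rule Lim_null_comparison[OF _ lim0])
    show "\<forall>\<^sub>F n in sequentially. norm (integral {- real n..real n} (\<lambda>x. f (Complex x h) / (Complex x h - w)) - 2 * pi * \<i> * f w)
        \<le> D n * real n + D n * (2 * real n) + D n * real n"
      using ev
    proof eventually_elim
      fix n :: nat assume n: "cmod w < real n \<and> Im w < h + real n"
      then have n0: "0 < real n" using le_less_trans[OF norm_ge_zero, of w "real n"] by blast
      let ?R = "integral {h..h + real n} (\<lambda>y. f (Complex (real n) y) / (Complex (real n) y - w))"
      let ?L = "integral {h..h + real n} (\<lambda>y. f (Complex (- real n) y) / (Complex (- real n) y - w))"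
      let ?T = "integral {- real n..real n} (\<lambda>x. f (Complex x (h + real n)) / (Complex x (h + real n) - w))"
      have ne: "z \<noteq> w" if "real n \<le> cmod z" for z using that n by auto
      have cR: "real n \<le> cmod (Complex (real n) y)" "real n \<le> cmod (Complex (- real n) y)" for y
        using abs_Re_le_cmod[of "Complex (real n) y"] abs_Re_le_cmod[of "Complex (- real n) y"] by auto
      have cT: "real n \<le> cmod (Complex x (h + real n))" for x
        using abs_Im_le_cmod[of "Complex x (h + real n)"] w by auto
      have contR: "continuous_on {h..h + real n} (\<lambda>y. f (Complex x y) / (Complex x y - w))"
        if "x = real n \<or> x = - real n" for x
      proof -
        have "Complex x y - w \<noteq> 0" for y using ne cR that by auto
        moreover have "continuous_on {h..h + real n} (\<lambda>y. f (Complex x y))"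
          by (rule continuous_on_compose2[OF c]) (auto simp: Complex_eq intro!: continuous_intros)
        ultimately show ?thesis by (intro continuous_intros) (auto simp: Complex_eq intro!: continuous_intros)
      qed
      have contT: "continuous_on {- real n..real n} (\<lambda>x. f (Complex x (h + real n)) / (Complex x (h + real n) - w))"
      proof -
        have "Complex x (h + real n) - w \<noteq> 0" for x using ne cT by auto
        moreover have "continuous_on {- real n..real n} (\<lambda>x. f (Complex x (h + real n)))"
          by (rule continuous_on_compose2[OF c]) (auto simp: Complex_eq intro!: continuous_intros)
        ultimately show ?thesis by (intro continuous_intros) (auto simp: Complex_eq intro!: continuous_intros)
      qed
      have R: "norm ?R \<le> D n * (h + real n - h)" "norm ?L \<le> D n * (h + real n - h)"
        using n n0 cR by (intro integral_bound contR bound; simp)+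
      have T: "norm ?T \<le> D n * (real n - - real n)"
        using n n0 cT w by (intro integral_bound contT bound; simp)+
      have "\<bar>Re w\<bar> < real n" using n abs_Re_le_cmod[of w] by simp
      then have "2 * pi * \<i> * f w = integral {- real n..real n} (\<lambda>x. f (Complex x h) / (Complex x h - w)) + \<i> * ?R - ?T - \<i> * ?L"
        using n w by (intro rectpath_Cauchy_formula holomorphic_on_subset[OF f]) auto
      then have "integral {- real n..real n} (\<lambda>x. f (Complex x h) / (Complex x h - w)) - 2 * pi * \<i> * f w = \<i> * ?L + ?T - \<i> * ?R"
        by simp
      then have "norm (integral {- real n..real n} (\<lambda>x. f (Complex x h) / (Complex x h - w)) - 2 * pi * \<i> * f w)
         = norm (\<i> * ?L + ?T - \<i> * ?R)" by (rule arg_cong)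
      moreover have "norm (\<i> * ?L + ?T - \<i> * ?R) \<le> norm (\<i> * ?L) + norm ?T + norm (\<i> * ?R)"
        using norm_triangle_ineq4[of "\<i> * ?L + ?T" "\<i> * ?R"] norm_triangle_ineq[of "\<i> * ?L" ?T] by linarith
      moreover have "h + real n - h = real n" "real n - - real n = 2 * real n" by simp_all
      then have "norm (\<i> * ?L) \<le> D n * real n" "norm ?T \<le> D n * (2 * real n)" "norm (\<i> * ?R) \<le> D n * real n"
        using R T by (simp_all only: norm_mult norm_ii mult_1)
      ultimately show "norm (integral {- real n..real n} (\<lambda>x. f (Complex x h) / (Complex x h - w)) - 2 * pi * \<i> * f w)
        \<le> D n * real n + D n * (2 * real n) + D n * real n" by linarith
    qed
  qed
  ultimately have "(\<integral>x. f (Complex x h) / (Complex x h - w) \<partial>lborel) - 2 * pi * \<i> * f w = 0"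
    by (rule LIMSEQ_unique)
  then show ?thesis by simp
qed

text \<open>The polynomial growth is removed by the convergence factors \<open>(1 - i z / k)\<^sup>-\<^sup>m\<^sup>-\<^sup>1\<close>.\<close>

lemma Cauchy_half_plane:
  fixes f :: "complex \<Rightarrow> complex"
  assumes w: "h < Im w" "0 < h" and f: "f holomorphic_on {z. h \<le> Im z}"
    and le: "\<And>z. h \<le> Im z \<Longrightarrow> cmod (f z) \<le> C * (1 + cmod z) ^ m"
    and int: "integrable lborel (\<lambda>x. f (Complex x h) / (Complex x h - w))"
  shows "(\<integral>x. f (Complex x h) / (Complex x h - w) \<partial>lborel) = 2 * pi * \<i> * f w"
proof -
  define e where "e k z = 1 - \<i> * of_real (1 / real (Suc k)) * z" for k z
  define F where "F k z = f z / e k z ^ Suc m" for k z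
  have "0 < (1 + cmod (Complex 0 h)) ^ m" by (intro zero_less_power add_pos_nonneg) auto
  then have C: "0 \<le> C"
    using order_trans[OF norm_ge_zero le[of "Complex 0 h"]] by (simp add: zero_le_mult_iff)
  \<comment> \<open>The real part of \<open>e k z\<close> is \<open>1 + Im z / (k + 1)\<close>, so
    there are no zeros. The first bound gives \<open>cmod (F k z) \<le> cmod (f z)\<close>, needed
    for domination; the second, raised to the power \<open>m + 1\<close>, beats the growth of
    \<open>f\<close> by one order.\<close>
  have e: "1 \<le> cmod (e k z)" "(1 + cmod z) / (2 * real (Suc k)) \<le> cmod (e k z)" if "h \<le> Im z" for k z
  proof -
    define \<epsilon> where "\<epsilon> = 1 / real (Suc k)"
    have \<epsilon>: "0 < \<epsilon>" "\<epsilon> \<le> 1" by (auto simp: \<epsilon>_def)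
    have y: "0 < Im z" using that w by simp
    have Re: "Re (e k z) = 1 + \<epsilon> * Im z" and Im: "Im (e k z) = - (\<epsilon> * Re z)"
      by (simp_all add: e_def \<epsilon>_def)
    have 1: "1 + \<epsilon> * Im z \<le> cmod (e k z)" using complex_Re_le_cmod[of "e k z"] Re by simp
    have "0 \<le> \<epsilon> * Im z" using \<epsilon> y by simp
    then show "1 \<le> cmod (e k z)" using 1 by linarith
    have 2: "\<epsilon> * \<bar>Re z\<bar> \<le> cmod (e k z)" using abs_Im_le_cmod[of "e k z"] Im \<epsilon> by (simp add: abs_mult)
    have "\<epsilon> * cmod z \<le> \<epsilon> * (\<bar>Re z\<bar> + Im z)" using \<epsilon> y cmod_le[of z] by (intro mult_left_mono) auto
    then have "\<epsilon> + \<epsilon> * cmod z \<le> 2 * cmod (e k z)" using 1 2 \<epsilon> by (simp add: algebra_simps)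
    then have "\<epsilon> * (1 + cmod z) / 2 \<le> cmod (e k z)" by (simp add: algebra_simps)
    then show "(1 + cmod z) / (2 * real (Suc k)) \<le> cmod (e k z)" by (simp add: \<epsilon>_def mult.commute)
  qed
  have e0: "e k z \<noteq> 0" if "h \<le> Im z" for k z using e(1)[OF that, of k] by auto
  have e_hol: "e k holomorphic_on S" for k S unfolding e_def by (intro holomorphic_intros)
  have Fle: "cmod (F k z) \<le> cmod (f z)" if "h \<le> Im z" for k z
  proof -
    have "1 \<le> cmod (e k z ^ Suc m)" using e(1)[OF that, of k] by (simp only: norm_power one_le_power)
    then have "cmod (f z) / cmod (e k z ^ Suc m) \<le> cmod (f z) / 1" by (intro divide_left_mono) auto
    then show ?thesis by (simp add: F_def norm_divide)
  qed
  have [measurable]: "(\<lambda>x. f (Complex x h)) \<in> borel_measurable borel" "(\<lambda>x. F k (Complex x h)) \<in> borel_measurable borel" for k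
    unfolding F_def
    by (intro borel_measurable_continuous_onI horizontal_line_continuous[where S = "{z. h \<le> Im z}"]
          holomorphic_on_imp_continuous_on f holomorphic_intros e_hol; use e0 in auto)+
  have Fint: "integrable lborel (\<lambda>x. F k (Complex x h) / (Complex x h - w))" for k
  proof (rule Bochner_Integration.integrable_bound[OF int])
    show "AE x in lborel. norm (F k (Complex x h) / (Complex x h - w)) \<le> norm (f (Complex x h) / (Complex x h - w))"
      by (rule AE_I2) (auto simp: norm_divide intro!: divide_right_mono Fle)
  qed measurable
  have eq: "(\<integral>x. F k (Complex x h) / (Complex x h - w) \<partial>lborel) = 2 * pi * \<i> * F k w" for k
  proof (rule Cauchy_half_plane_decay[OF w _ _ Fint])
    show "F k holomorphic_on {z. h \<le> Im z}"
      unfolding F_def by (intro holomorphic_intros f e_hol) (use e0 in auto)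
    show "cmod (F k z) \<le> (C * (2 * real (Suc k)) ^ Suc m) / (1 + cmod z)" if "h \<le> Im z" for z
    proof -
      have "((1 + cmod z) / (2 * real (Suc k))) ^ Suc m \<le> cmod (e k z) ^ Suc m"
        using e(2)[OF that, of k] by (intro power_mono) auto
      moreover have "0 < 1 + cmod z" by (simp add: add_pos_nonneg)
      ultimately have "cmod (f z) / cmod (e k z) ^ Suc m \<le> (C * (1 + cmod z) ^ m) / ((1 + cmod z) / (2 * real (Suc k))) ^ Suc m"
        using le[OF that] C by (intro frac_le) auto
      also have "\<dots> = (C * (2 * real (Suc k)) ^ Suc m) / (1 + cmod z)"
        using \<open>0 < 1 + cmod z\<close> by (simp add: power_divide del: of_nat_Suc)
      finally show ?thesis by (simp only: F_def norm_divide norm_power)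
    qed
  qed
  have lim: "(\<lambda>k. F k z) \<longlonglongrightarrow> f z" for z
  proof -
    have "(\<lambda>k. e k z) \<longlonglongrightarrow> 1 - \<i> * of_real 0 * z"
      unfolding e_def by (intro tendsto_intros LIMSEQ_Suc[OF lim_1_over_n])
    then have "(\<lambda>k. F k z) \<longlonglongrightarrow> f z / 1 ^ Suc m"
      unfolding F_def by (intro tendsto_intros) auto
    then show ?thesis by simp
  qed
  have "(\<lambda>k. \<integral>x. F k (Complex x h) / (Complex x h - w) \<partial>lborel) \<longlonglongrightarrow> (\<integral>x. f (Complex x h) / (Complex x h - w) \<partial>lborel)"
  proof (rule integral_dominated_convergence[where w = "\<lambda>x. norm (f (Complex x h) / (Complex x h - w))"])
    show "AE x in lborel. (\<lambda>k. F k (Complex x h) / (Complex x h - w)) \<longlonglongrightarrow> f (Complex x h) / (Complex x h - w)"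
      using w by (intro AE_I2 tendsto_intros lim) (auto simp: complex_eq_iff)
    show "AE x in lborel. norm (F k (Complex x h) / (Complex x h - w)) \<le> norm (f (Complex x h) / (Complex x h - w))" for k
      by (rule AE_I2) (auto simp: norm_divide intro!: divide_right_mono Fle)
  qed (use int in auto)
  moreover have "(\<lambda>k. 2 * pi * \<i> * F k w) \<longlonglongrightarrow> 2 * pi * \<i> * f w"
    by (intro tendsto_intros lim)
  ultimately show ?thesis
    unfolding eq by (rule LIMSEQ_unique)
qed

section \<open>Growth of functions in the Bergman spaces\<close>

lemma norm_integral_le_nn_integral:
  fixes g :: "real \<Rightarrow> complex"
  assumes "continuous_on {c..d} g"
  shows "ennreal (norm (integral {c..d} g)) \<le> (\<integral>\<^sup>+ x\<in>{c..d}. ennreal (norm (g x)) \<partial>lborel)"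
proof -
  note si = borel_integrable_atLeastAtMost'[OF assms]
  have "ennreal (norm (integral {c..d} g)) = ennreal (norm (\<integral>x. indicator {c..d} x *\<^sub>R g x \<partial>lborel))"
    using set_borel_integral_eq_integral(2)[OF si] by (simp add: set_lebesgue_integral_def)
  also have "\<dots> \<le> (\<integral>\<^sup>+ x. ennreal (norm (indicator {c..d} x *\<^sub>R g x)) \<partial>lborel)"
    using si by (intro integral_norm_bound_ennreal) (simp add: set_integrable_def)
  also have "\<dots> = (\<integral>\<^sup>+ x\<in>{c..d}. ennreal (norm (g x)) \<partial>lborel)"
    by (intro nn_integral_cong) (auto simp: indicator_def)
  finally show ?thesis .
qed

text \<open>Average Cauchy's formula over the squares of half-width \<open>t \<in> [a, 2a]\<close> around \<open>w\<close>.\<close>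

lemma cmod_le_area_integral:
  fixes f :: "complex \<Rightarrow> complex"
  assumes f: "f holomorphic_on \<complex>\<^sub>+" and [measurable]: "f \<in> borel_measurable borel"
    and a: "0 < a" "2 * a < Im w"
  shows "ennreal (2 * pi * a\<^sup>2 * cmod (f w)) \<le> 4 * (\<integral>\<^sup>+ y\<in>{Im w - 2 * a..Im w + 2 * a}.
    (\<integral>\<^sup>+ x\<in>{Re w - 2 * a..Re w + 2 * a}. ennreal (cmod (f (Complex x y))) \<partial>lborel) \<partial>lborel)"
proof -
  define u v where "u = Re w" and "v = Im w"
  define H where "H y = (\<integral>\<^sup>+ x\<in>{u - 2 * a..u + 2 * a}. ennreal (cmod (f (Complex x y))) \<partial>lborel)" for y
  define V where "V x = (\<integral>\<^sup>+ y\<in>{v - 2 * a..v + 2 * a}. ennreal (cmod (f (Complex x y))) \<partial>lborel)" for x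
  have [measurable]: "H \<in> borel_measurable borel" "V \<in> borel_measurable borel"
    unfolding H_def V_def by measurable
  define I where "I = (\<integral>\<^sup>+ y\<in>{v - 2 * a..v + 2 * a}. H y \<partial>lborel)"
  have IV: "(\<integral>\<^sup>+ x\<in>{u - 2 * a..u + 2 * a}. V x \<partial>lborel) = I"
    unfolding I_def H_def V_def
    by (subst nn_integral_multc[symmetric], measurable)+ (subst lborel_pair.Fubini', measurable, simp add: mult_ac)
  have box: "{z. u - t \<le> Re z \<and> Re z \<le> u + t \<and> v - t \<le> Im z \<and> Im z \<le> v + t} \<subseteq> \<complex>\<^sub>+" if "t \<le> 2 * a" for t
    using that a by (auto simp: upper_half_plane_def v_def)
  \<comment> \<open>On a side of the square the distance to \<open>w\<close> is at least
    \<open>t \<ge> a\<close>, so the factor \<open>a\<close> compensates the Cauchy kernel.\<close>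
  have segment: "ennreal (a * norm (integral {c - t..c + t} (\<lambda>s. f (\<gamma> s) / (\<gamma> s - w)))) \<le>
      (\<integral>\<^sup>+ s\<in>{c - 2 * a..c + 2 * a}. ennreal (cmod (f (\<gamma> s))) \<partial>lborel)"
    if t: "t \<in> {a..2 * a}" and \<gamma>: "\<And>s. s \<in> {c - t..c + t} \<Longrightarrow> \<gamma> s \<in> \<complex>\<^sub>+" "\<And>s. t \<le> cmod (\<gamma> s - w)"
      and c\<gamma>: "continuous_on UNIV \<gamma>" for t c and \<gamma> :: "real \<Rightarrow> complex"
  proof -
    have [measurable]: "\<gamma> \<in> borel_measurable borel" using c\<gamma> by (rule borel_measurable_continuous_onI)
    have t0: "0 < t" using t a by simp
    have "continuous_on {c - t..c + t} (\<lambda>s. f (\<gamma> s))"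
      by (rule continuous_on_compose2[OF holomorphic_on_imp_continuous_on[OF f]])
         (use \<gamma> in \<open>auto intro: continuous_on_subset[OF c\<gamma>]\<close>)
    moreover have "\<gamma> s - w \<noteq> 0" for s using \<gamma>(2)[of s] t0 by auto
    ultimately have "continuous_on {c - t..c + t} (\<lambda>s. f (\<gamma> s) / (\<gamma> s - w))"
      by (intro continuous_intros continuous_on_subset[OF c\<gamma>]) auto
    from norm_integral_le_nn_integral[OF this]
    have "ennreal a * ennreal (norm (integral {c - t..c + t} (\<lambda>s. f (\<gamma> s) / (\<gamma> s - w)))) \<le>
        ennreal a * (\<integral>\<^sup>+ s\<in>{c - t..c + t}. ennreal (norm (f (\<gamma> s) / (\<gamma> s - w))) \<partial>lborel)"
      by (rule mult_left_mono) simp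
    also have "\<dots> = (\<integral>\<^sup>+ s. ennreal a * (ennreal (norm (f (\<gamma> s) / (\<gamma> s - w))) * indicator {c - t..c + t} s) \<partial>lborel)"
      by (rule nn_integral_cmult[symmetric]) measurable
    also have "\<dots> \<le> (\<integral>\<^sup>+ s\<in>{c - 2 * a..c + 2 * a}. ennreal (cmod (f (\<gamma> s))) \<partial>lborel)"
    proof (rule nn_integral_mono)
      fix s :: real
      have le: "a \<le> cmod (\<gamma> s - w)" "0 < cmod (\<gamma> s - w)" using \<gamma>(2)[of s] t t0 by auto
      have "a * norm (f (\<gamma> s) / (\<gamma> s - w)) \<le> cmod (f (\<gamma> s))"
        using mult_right_mono[OF le(1), of "cmod (f (\<gamma> s))"] le(2) by (simp add: norm_divide field_simps)
      then show "ennreal a * (ennreal (norm (f (\<gamma> s) / (\<gamma> s - w))) * indicator {c - t..c + t} s)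
        \<le> ennreal (cmod (f (\<gamma> s))) * indicator {c - 2 * a..c + 2 * a} s"
        using t a by (auto simp: indicator_def intro!: ennreal_leI simp flip: ennreal_mult)
    qed
    finally show ?thesis using a by (simp add: ennreal_mult)
  qed
  have main: "ennreal (2 * pi * cmod (f w) * a) \<le> H (v + - 1 * t) + V (u + 1 * t) + H (v + 1 * t) + V (u + - 1 * t)"
    if t: "t \<in> {a..2 * a}" for t
  proof -
    let ?B = "integral {u - t..u + t} (\<lambda>x. f (Complex x (v - t)) / (Complex x (v - t) - w))"
    let ?R = "integral {v - t..v + t} (\<lambda>y. f (Complex (u + t) y) / (Complex (u + t) y - w))"
    let ?T = "integral {u - t..u + t} (\<lambda>x. f (Complex x (v + t)) / (Complex x (v + t) - w))"
    let ?L = "integral {v - t..v + t} (\<lambda>y. f (Complex (u - t) y) / (Complex (u - t) y - w))"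
    have "2 * pi * \<i> * f w = ?B + \<i> * ?R - ?T - \<i> * ?L"
      using t a by (intro rectpath_Cauchy_formula holomorphic_on_subset[OF f] box) (auto simp: u_def v_def)
    then have "norm (2 * pi * \<i> * f w) = norm (?B + \<i> * ?R - ?T - \<i> * ?L)" by (rule arg_cong)
    moreover have "norm (2 * pi * \<i> * f w) = 2 * pi * cmod (f w)" by (simp add: norm_mult)
    moreover have "norm (?B + \<i> * ?R - ?T - \<i> * ?L) \<le> norm ?B + norm (\<i> * ?R) + norm ?T + norm (\<i> * ?L)"
      using norm_triangle_ineq4[of "?B + \<i> * ?R - ?T" "\<i> * ?L"] norm_triangle_ineq4[of "?B + \<i> * ?R" ?T]
        norm_triangle_ineq[of ?B "\<i> * ?R"] by linarith
    ultimately have "2 * pi * cmod (f w) \<le> norm ?B + norm ?R + norm ?T + norm ?L"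
      by (simp only: norm_mult norm_ii mult_1)
    from mult_left_mono[OF this, of a] a
    have "2 * pi * cmod (f w) * a \<le> a * norm ?B + a * norm ?R + a * norm ?T + a * norm ?L"
      by (simp only: distrib_left mult_ac less_imp_le)
    then have "ennreal (2 * pi * cmod (f w) * a) \<le> ennreal (a * norm ?B) + ennreal (a * norm ?R) + ennreal (a * norm ?T) + ennreal (a * norm ?L)"
      using a by (simp add: ennreal_leI flip: ennreal_plus)
    also have "\<dots> \<le> H (v - t) + V (u + t) + H (v + t) + V (u - t)"
    proof (intro add_mono)
      have im: "t \<le> cmod (Complex x (v + t) - w)" "t \<le> cmod (Complex x (v - t) - w)" for x
        using abs_Im_le_cmod[of "Complex x (v + t) - w"] abs_Im_le_cmod[of "Complex x (v - t) - w"] by (auto simp: v_def)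
      have re: "t \<le> cmod (Complex (u + t) y - w)" "t \<le> cmod (Complex (u - t) y - w)" for y
        using abs_Re_le_cmod[of "Complex (u + t) y - w"] abs_Re_le_cmod[of "Complex (u - t) y - w"] by (auto simp: u_def)
      have cont: "continuous_on UNIV (\<lambda>x. Complex x y)" "continuous_on UNIV (\<lambda>x. Complex y x)" for y
        by (auto simp: Complex_eq intro!: continuous_intros)
      have pos: "0 < v - t" using t a by (simp add: v_def)
      show "ennreal (a * norm ?B) \<le> H (v - t)" "ennreal (a * norm ?T) \<le> H (v + t)"
        unfolding H_def using t pos a by (intro segment im cont; simp add: upper_half_plane_def)+
      show "ennreal (a * norm ?R) \<le> V (u + t)" "ennreal (a * norm ?L) \<le> V (u - t)"
        unfolding V_def using t pos by (intro segment re cont; simp add: upper_half_plane_def)+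
    qed
    finally show ?thesis by simp
  qed
  have shift: "(\<integral>\<^sup>+ t\<in>{a..2 * a}. G (c + \<sigma> * t) \<partial>lborel) \<le> (\<integral>\<^sup>+ s\<in>{c - 2 * a..c + 2 * a}. G s \<partial>lborel)"
    if [measurable]: "G \<in> borel_measurable borel" and \<sigma>: "\<sigma> = 1 \<or> \<sigma> = - 1" for G :: "real \<Rightarrow> ennreal" and c \<sigma>
  proof -
    have "(\<integral>\<^sup>+ s\<in>{c - 2 * a..c + 2 * a}. G s \<partial>lborel) = ennreal \<bar>\<sigma>\<bar> * (\<integral>\<^sup>+ t. G (c + \<sigma> * t) * indicator {c - 2 * a..c + 2 * a} (c + \<sigma> * t) \<partial>lborel)"
      using \<sigma> by (intro nn_integral_real_affine) auto
    moreover have "(\<integral>\<^sup>+ t\<in>{a..2 * a}. G (c + \<sigma> * t) \<partial>lborel) \<le> (\<integral>\<^sup>+ t. G (c + \<sigma> * t) * indicator {c - 2 * a..c + 2 * a} (c + \<sigma> * t) \<partial>lborel)"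
      using \<sigma> a by (intro nn_integral_mono mult_left_mono) (auto simp: indicator_def)
    ultimately show ?thesis using \<sigma> by auto
  qed
  have "ennreal (2 * pi * a\<^sup>2 * cmod (f w)) = ennreal (2 * pi * cmod (f w) * a) * ennreal a"
    using a by (simp add: power2_eq_square mult_ac flip: ennreal_mult)
  also have "\<dots> = (\<integral>\<^sup>+ t\<in>{a..2 * a}. ennreal (2 * pi * cmod (f w) * a) \<partial>lborel)"
    using a by (subst nn_integral_cmult_indicator) auto
  also have "\<dots> \<le> (\<integral>\<^sup>+ t\<in>{a..2 * a}. (H (v + - 1 * t) + V (u + 1 * t) + H (v + 1 * t) + V (u + - 1 * t)) \<partial>lborel)"
  proof (rule nn_integral_mono)
    fix t
    show "ennreal (2 * pi * cmod (f w) * a) * indicator {a..2 * a} t \<le> (H (v + - 1 * t) + V (u + 1 * t) + H (v + 1 * t) + V (u + - 1 * t)) * indicator {a..2 * a} t"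
      using main[of t] by (cases "t \<in> {a..2 * a}") (auto simp del: mult_1 mult_minus1)
  qed
  also have "\<dots> = (\<integral>\<^sup>+ t\<in>{a..2 * a}. H (v + - 1 * t) \<partial>lborel) + (\<integral>\<^sup>+ t\<in>{a..2 * a}. V (u + 1 * t) \<partial>lborel) +
     (\<integral>\<^sup>+ t\<in>{a..2 * a}. H (v + 1 * t) \<partial>lborel) + (\<integral>\<^sup>+ t\<in>{a..2 * a}. V (u + - 1 * t) \<partial>lborel)"
    by (simp add: nn_integral_add distrib_right)
  \<comment> \<open>As \<open>t\<close> varies, each of the four sides sweeps out a part of the
    large square and contributes at most \<open>I\<close>; \<open>IV\<close> covers the vertical
    sides by Tonelli.\<close>
  also have "\<dots> \<le> I + I + I + I"
    unfolding IV[symmetric] unfolding IV unfolding I_def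
    by (intro add_mono shift order_trans[OF shift eq_refl[OF IV[unfolded I_def]]]) auto
  also have "I + I + I + I = 4 * I"
  proof -
    have "(4::ennreal) = 1 + 1 + 1 + 1" by simp
    then show ?thesis by (simp only: distrib_right mult_1)
  qed
  finally show ?thesis unfolding I_def H_def u_def v_def .
qed

text \<open>One factor \<open>1 + y\<close> pays for the weight, by slow variation with
  \<open>\<delta> = 1\<close> between \<open>y\<close> and 1, and the other for
  \<open>y powr - \<alpha>\<close>, where \<open>- \<alpha> < 1\<close>.\<close>

lemma slow_weight_lower_bound:
  assumes \<Omega>: "slow_weight \<Omega>" and h: "0 < h" and \<alpha>: "-1 < \<alpha>"
  obtains B where "0 < B" "\<And>y. h \<le> y \<Longrightarrow> 1 \<le> B * (1 + y)\<^sup>2 * (\<Omega> y * y powr \<alpha>)"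
proof -
  obtain C where C: "0 < C" "\<And>y s. 0 < y \<Longrightarrow> 0 < s \<Longrightarrow> \<Omega> (s * y) \<le> C * (s powr 1 + s powr - 1) * \<Omega> y"
    using slow_weightE[OF \<Omega>, of 1] by auto
  have \<Omega>1: "0 < \<Omega> 1" using slow_weight_pos[OF \<Omega>] by simp
  define B where "B = C * (1 / h + 1) * (h powr - \<alpha> + 1) / \<Omega> 1"
  have B: "0 < B" using C h \<Omega>1 by (auto simp: B_def intro!: divide_pos_pos mult_pos_pos add_pos_pos)
  have "1 \<le> B * (1 + y)\<^sup>2 * (\<Omega> y * y powr \<alpha>)" if y: "h \<le> y" for y
  proof -
    have y0: "0 < y" using y h by simp
    have \<Omega>y: "0 < \<Omega> y" using slow_weight_pos[OF \<Omega> y0] .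
    have "\<Omega> 1 \<le> C * (1 / y + y) * \<Omega> y"
      using C(2)[of y "1 / y"] y0 by (simp add: powr_minus)
    also have "\<dots> \<le> C * ((1 / h + 1) * (1 + y)) * \<Omega> y"
    proof (intro mult_right_mono mult_left_mono)
      have "1 / y \<le> 1 / h" using y h by (simp add: frac_le)
      moreover have "0 \<le> 1 / h * y" using h y0 by simp
      ultimately show "1 / y + y \<le> (1 / h + 1) * (1 + y)" by (simp add: algebra_simps add_divide_distrib)
    qed (use C \<Omega>y in auto)
    finally have 1: "\<Omega> 1 \<le> C * ((1 / h + 1) * (1 + y)) * \<Omega> y" .
    have 2: "y powr - \<alpha> \<le> (h powr - \<alpha> + 1) * (1 + y)"
    proof (cases "0 \<le> \<alpha>")
      case True
      then have "y powr - \<alpha> \<le> h powr - \<alpha>" using y h by (intro powr_mono2') auto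
      also have "\<dots> \<le> (h powr - \<alpha> + 1) * (1 + y)" using y0 by (simp add: algebra_simps)
      finally show ?thesis .
    next
      case False
      have "y powr - \<alpha> \<le> (1 + y) powr - \<alpha>" using False y0 by (intro powr_mono2) auto
      also have "\<dots> \<le> (1 + y) powr 1" using \<alpha> y0 by (intro powr_mono) auto
      also have "\<dots> \<le> (h powr - \<alpha> + 1) * (1 + y)" using y0 by (simp add: algebra_simps)
      finally show ?thesis .
    qed
    have "1 = (\<Omega> 1 / \<Omega> 1) * (y powr - \<alpha> * y powr \<alpha>)" using \<Omega>1 y0 by (simp flip: powr_add)
    also have "\<dots> \<le> (C * ((1 / h + 1) * (1 + y)) * \<Omega> y / \<Omega> 1) * (((h powr - \<alpha> + 1) * (1 + y)) * y powr \<alpha>)"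
      using 1 2 \<Omega>1 C h y0 \<Omega>y
      by (intro mult_mono divide_right_mono mult_right_mono) auto
    also have "\<dots> = B * (1 + y)\<^sup>2 * (\<Omega> y * y powr \<alpha>)"
      by (simp add: B_def power2_eq_square mult_ac)
    finally show ?thesis .
  qed
  then show thesis using B that by blast
qed

text \<open>The area estimate on a square of fixed size, Hoelder on its horizontal lines, and the
  lower bound for the weight to return to the weighted integral; the exponent 2 comes from that
  lower bound. Only the existence of \<open>C\<close> matters, so no linear dependence on the norm
  of \<open>f\<close> is sought.\<close>

theorem bergman_growth:
  assumes \<Omega>: "slow_weight \<Omega>" and pq: "1 < p" "1 < q" and \<alpha>: "-1 < \<alpha>"
    and f: "f \<in> bergman p q \<Omega> \<alpha>" and h: "0 < h"
  obtains C where "0 \<le> C" "\<And>z. h \<le> Im z \<Longrightarrow> cmod (f z) \<le> C * (1 + Im z)\<^sup>2"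
proof -
  have [measurable]: "f \<in> borel_measurable borel" using bergman_measurable[OF f] .
  have hol: "f holomorphic_on \<complex>\<^sub>+" and fin: "mixed_cnorm p q \<Omega> \<alpha> f < top"
    using f bergman_iff[OF \<Omega>, of p q f \<alpha>] pq by auto
  define p' where "p' = p / (p - 1)"
  have p': "1 / p + 1 / p' = 1" using pq by (auto simp: p'_def field_simps)
  have p'1: "1 < p'" using conjugate_exponent_gt_1[OF pq(1) p'] .
  define F where "F y = enorm p lborel (\<lambda>x. ennreal (cmod (f (Complex x y))))" for y
  have [measurable]: "F \<in> borel_measurable borel" unfolding F_def by measurable
  define S where "S = (\<integral>\<^sup>+ y\<in>{0<..}. ennreal_powr (F y) q * ennreal (\<Omega> y * y powr \<alpha>) \<partial>lborel)"
  have "S < top"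
    using fin pq \<Omega> unfolding mixed_norm_def F_def[symmetric] enorm_def[of q]
    by (simp add: nn_integral_wmeasure S_def)
  then obtain s where s: "S = ennreal s" "0 \<le> s" by (metis ennreal_cases less_irrefl)
  \<comment> \<open>The square of half-width \<open>2 * a\<close> around a point of height at least
    \<open>h\<close> then stays at height at least \<open>2 * a\<close>.\<close>
  define a where "a = h / 4"
  have a: "0 < a" "h = 4 * a" using h by (auto simp: a_def)
  obtain B where B: "0 < B" "\<And>y. 2 * a \<le> y \<Longrightarrow> 1 \<le> B * (1 + y)\<^sup>2 * (\<Omega> y * y powr \<alpha>)"
    using slow_weight_lower_bound[OF \<Omega> _ \<alpha>, of "2 * a"] a by auto
  define K where "K = (4 * a) powr (1 / p')"
  have K: "0 \<le> K" by (simp add: K_def)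
  define C where "C = 4 * K * (4 * a + 4 * B * s) / (2 * pi * a\<^sup>2)"
  have "cmod (f w) \<le> C * (1 + Im w)\<^sup>2" if w: "h \<le> Im w" for w
  proof -
    define u v where "u = Re w" and "v = Im w"
    have v: "4 * a \<le> v" using w a by (simp add: v_def)
    have inner: "(\<integral>\<^sup>+ x\<in>{u - 2 * a..u + 2 * a}. ennreal (cmod (f (Complex x y))) \<partial>lborel) \<le> ennreal K * (1 + ennreal_powr (F y) q)" for y
    proof -
      have "(\<integral>\<^sup>+ x\<in>{u - 2 * a..u + 2 * a}. ennreal (cmod (f (Complex x y))) \<partial>lborel) \<le> F y * enorm p' lborel (indicator {u - 2 * a..u + 2 * a})"
        unfolding F_def by (intro Hoelder_nn_integral p' pq) auto
      also have "enorm p' lborel (indicator {u - 2 * a..u + 2 * a}) = ennreal K"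
      proof -
        have "(\<integral>\<^sup>+ x. ennreal_powr (indicator {u - 2 * a..u + 2 * a} x) p' \<partial>lborel) = (\<integral>\<^sup>+ x. indicator {u - 2 * a..u + 2 * a} x \<partial>lborel)"
          by (intro nn_integral_cong) (auto simp: indicator_def ennreal_powr_def)
        also have "\<dots> = ennreal (4 * a)" using a by simp
        finally show ?thesis using a by (simp add: enorm_def ennreal_powr_ennreal K_def)
      qed
      also have "F y * ennreal K \<le> (1 + ennreal_powr (F y) q) * ennreal K"
      proof (rule mult_right_mono)
        \<comment> \<open>This crude bound replaces Hoelder in the height.\<close>
        have "F y \<le> 1 + ennreal_powr (F y) q"
        proof (cases "F y \<le> 1")
          case False
          then have "ennreal_powr 1 (q - 1) \<le> ennreal_powr (F y) (q - 1)" using pq by (intro ennreal_powr_mono) auto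
          then have "F y * 1 \<le> F y * ennreal_powr (F y) (q - 1)" by (intro mult_left_mono) (auto simp: ennreal_powr_def)
          also have "\<dots> = ennreal_powr (F y) q" using ennreal_powr_add[of "F y" 1 "q - 1"] by simp
          finally show ?thesis by (simp add: add_increasing)
        qed (simp add: add_increasing2)
        then show "F y \<le> 1 + ennreal_powr (F y) q" .
      qed simp
      finally show ?thesis by (simp add: mult.commute)
    qed
    have "ennreal (2 * pi * a\<^sup>2 * cmod (f w)) \<le> 4 * (\<integral>\<^sup>+ y\<in>{v - 2 * a..v + 2 * a}.
        (\<integral>\<^sup>+ x\<in>{u - 2 * a..u + 2 * a}. ennreal (cmod (f (Complex x y))) \<partial>lborel) \<partial>lborel)"
      unfolding u_def v_def using w a by (intro cmod_le_area_integral hol) auto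
    also have "\<dots> \<le> 4 * (\<integral>\<^sup>+ y. ennreal K * indicator {v - 2 * a..v + 2 * a} y +
        ennreal (K * (4 * B * (1 + v)\<^sup>2)) * (ennreal_powr (F y) q * ennreal (\<Omega> y * y powr \<alpha>) * indicator {0<..} y) \<partial>lborel)"
    proof (intro mult_left_mono nn_integral_mono)
      fix y :: real
      show "(\<integral>\<^sup>+ x\<in>{u - 2 * a..u + 2 * a}. ennreal (cmod (f (Complex x y))) \<partial>lborel) * indicator {v - 2 * a..v + 2 * a} y
        \<le> ennreal K * indicator {v - 2 * a..v + 2 * a} y + ennreal (K * (4 * B * (1 + v)\<^sup>2)) * (ennreal_powr (F y) q * ennreal (\<Omega> y * y powr \<alpha>) * indicator {0<..} y)"
      proof (cases "y \<in> {v - 2 * a..v + 2 * a}")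
        case True
        have y: "2 * a \<le> y" "0 < y" "y \<le> 2 * v" using True v a by auto
        have "0 < \<Omega> y * y powr \<alpha>" using slow_weight_pos[OF \<Omega> y(2)] y by simp
        have "1 \<le> B * (1 + y)\<^sup>2 * (\<Omega> y * y powr \<alpha>)" using B(2)[OF y(1)] .
        also have "\<dots> \<le> B * (2 * (1 + v))\<^sup>2 * (\<Omega> y * y powr \<alpha>)"
          using B \<open>0 < \<Omega> y * y powr \<alpha>\<close> y by (intro mult_right_mono mult_left_mono power_mono) auto
        also have "B * (2 * (1 + v))\<^sup>2 = 4 * B * (1 + v)\<^sup>2" unfolding power_mult_distrib by simp
        finally have "1 \<le> 4 * B * (1 + v)\<^sup>2 * (\<Omega> y * y powr \<alpha>)" .
        then have "K * 1 \<le> K * (4 * B * (1 + v)\<^sup>2 * (\<Omega> y * y powr \<alpha>))"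
          by (intro mult_left_mono K)
        then have "ennreal K \<le> ennreal (K * (4 * B * (1 + v)\<^sup>2)) * ennreal (\<Omega> y * y powr \<alpha>)"
          using \<open>0 < \<Omega> y * y powr \<alpha>\<close> K B by (simp add: ennreal_leI mult_ac flip: ennreal_mult)
        from mult_left_mono[OF this, of "ennreal_powr (F y) q"]
        have "ennreal K * ennreal_powr (F y) q \<le> ennreal (K * (4 * B * (1 + v)\<^sup>2)) * (ennreal_powr (F y) q * ennreal (\<Omega> y * y powr \<alpha>))"
          by (simp add: mult_ac)
        then show ?thesis
          using inner[of y] True y by (simp add: distrib_left) (meson add_left_mono order_trans)
      qed simp
    qed simp
    also have "\<dots> = 4 * (ennreal (K * (4 * a)) + ennreal (K * (4 * B * (1 + v)\<^sup>2) * s))"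
    proof -
      have "(\<integral>\<^sup>+ y. ennreal K * indicator {v - 2 * a..v + 2 * a} y +
          ennreal (K * (4 * B * (1 + v)\<^sup>2)) * (ennreal_powr (F y) q * ennreal (\<Omega> y * y powr \<alpha>) * indicator {0<..} y) \<partial>lborel)
        = (\<integral>\<^sup>+ y. ennreal K * indicator {v - 2 * a..v + 2 * a} y \<partial>lborel) + ennreal (K * (4 * B * (1 + v)\<^sup>2)) * S"
      proof -
        have [measurable]: "(\<lambda>y. ennreal (indicator {0<..} y * (\<Omega> y * y powr \<alpha>))) \<in> borel_measurable borel"
          using slow_weight_measurable[OF \<Omega>] by measurable
        have e: "ennreal_powr (F y) q * ennreal (\<Omega> y * y powr \<alpha>) * indicator {0<..} y =
            ennreal_powr (F y) q * ennreal (indicator {0<..} y * (\<Omega> y * y powr \<alpha>))" for y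
          by (simp add: indicator_def)
        show ?thesis
          unfolding S_def e by (subst nn_integral_add, measurable, subst nn_integral_cmult, measurable)
      qed
      also have "(\<integral>\<^sup>+ y. ennreal K * indicator {v - 2 * a..v + 2 * a} y \<partial>lborel) = ennreal (K * (4 * a))"
        using a K by (simp add: nn_integral_cmult_indicator ennreal_mult)
      also have "ennreal (K * (4 * B * (1 + v)\<^sup>2)) * S = ennreal (K * (4 * B * (1 + v)\<^sup>2) * s)"
        using s K B by (simp add: ennreal_mult)
      finally show ?thesis by simp
    qed
    also have "\<dots> = ennreal (4 * (K * (4 * a) + K * (4 * B * (1 + v)\<^sup>2) * s))"
    proof -
      have "4 * (ennreal X + ennreal Y) = ennreal (4 * (X + Y))" if "0 \<le> X" "0 \<le> Y" for X Y
        using that ennreal_mult'[of 4 "X + Y"] by simp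
      then show ?thesis using K B s a by simp
    qed
    finally have "2 * pi * a\<^sup>2 * cmod (f w) \<le> 4 * (K * (4 * a) + K * (4 * B * (1 + v)\<^sup>2) * s)"
      using K B s a by (subst (asm) ennreal_le_iff) auto
    also have "\<dots> \<le> 4 * (K * (4 * a) * (1 + v)\<^sup>2 + K * (4 * B * (1 + v)\<^sup>2) * s)"
    proof -
      have "K * (4 * a) * 1 \<le> K * (4 * a) * (1 + v)\<^sup>2"
        using K a v by (intro mult_left_mono one_le_power) auto
      then show ?thesis by simp
    qed
    also have "\<dots> = C * (2 * pi * a\<^sup>2) * (1 + v)\<^sup>2"
    proof -
      have "C * (2 * pi * a\<^sup>2) = 4 * K * (4 * a + 4 * B * s)" using a by (simp add: C_def)
      then show ?thesis by (simp only:) (simp add: algebra_simps)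
    qed
    finally show ?thesis using a by (simp add: v_def mult_ac)
  qed
  moreover have "0 \<le> C" using K B s a by (simp add: C_def)
  ultimately show thesis using that by blast
qed

section \<open>The Bergman kernel\<close>

text \<open>The reproducing kernel of the unweighted space, holomorphic in \<open>z\<close> and
  antiholomorphic in \<open>w\<close>. Dividing by \<i> makes the real part of the base equal to
  \<open>Im z + Im w\<close>, positive on the half-plane, so the principal power is holomorphic
  there. Only the variable \<open>z\<close> is cut off.\<close>

definition bkernel :: "real \<Rightarrow> complex \<Rightarrow> complex \<Rightarrow> complex"
  where "bkernel \<alpha> w z = (if z \<in> \<complex>\<^sub>+
    then of_real (2 powr \<alpha> * (\<alpha> + 1) / pi) * ((z - cnj w) / \<i>) powr of_real (- (\<alpha> + 2)) else 0)"

lemma Re_kernel_arg: "Re ((z - cnj w) / \<i>) = Im z + Im w" "Im ((z - cnj w) / \<i>) = - (Re z - Re w)"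
  by (simp_all add: Re_divide Im_divide)

lemma not_nonpos_Reals: "0 < Re u \<Longrightarrow> u \<notin> \<real>\<^sub>\<le>\<^sub>0"
  by (auto simp: complex_nonpos_Reals_iff)

lemma cmod_ge_half: "(\<bar>Re u\<bar> + \<bar>Im u\<bar>) / 2 \<le> cmod u"
  using abs_Re_le_cmod[of u] abs_Im_le_cmod[of u] by simp

lemma cmod_powr_le:
  assumes "0 \<le> s" "0 < m" "m \<le> \<bar>Re u\<bar> + \<bar>Im u\<bar>"
  shows "cmod (u powr of_real (- s)) \<le> 2 powr s * m powr - s"
proof -
  have "cmod (u powr of_real (- s)) = cmod u powr - s"
    by (subst norm_powr_real_powr') auto
  also have "\<dots> \<le> (m / 2) powr - s"
    using assms cmod_ge_half[of u] by (intro powr_mono2') auto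
  also have "\<dots> = 2 powr s * m powr - s"
    using assms by (simp add: powr_divide powr_minus field_simps)
  finally show ?thesis .
qed

text \<open>The constant of the kernel times \<open>2 powr (\<alpha> + 2)\<close>, the loss in
  bounding the modulus below by half the sum of the moduli of real and imaginary parts.\<close>

definition kconst :: "real \<Rightarrow> real"
  where "kconst \<alpha> = 2 powr \<alpha> * (\<alpha> + 1) / pi * 2 powr (\<alpha> + 2)"

lemma kconst_pos: "-1 < \<alpha> \<Longrightarrow> 0 < kconst \<alpha>"
  by (simp add: kconst_def)

lemma cmod_bkernel_le:
  assumes "-1 < \<alpha>" "w \<in> \<complex>\<^sub>+"
  shows "cmod (bkernel \<alpha> w z) \<le> kconst \<alpha> * kmaj \<alpha> w z"
proof (cases "z \<in> \<complex>\<^sub>+")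
  case True
  have "cmod (((z - cnj w) / \<i>) powr of_real (- (\<alpha> + 2))) \<le> 2 powr (\<alpha> + 2) * (\<bar>Re z - Re w\<bar> + (Im z + Im w)) powr - (\<alpha> + 2)"
    using assms True by (intro cmod_powr_le) (auto simp: Re_kernel_arg upper_half_plane_def)
  then have "(2 powr \<alpha> * (\<alpha> + 1) / pi) * cmod (((z - cnj w) / \<i>) powr of_real (- (\<alpha> + 2)))
      \<le> (2 powr \<alpha> * (\<alpha> + 1) / pi) * (2 powr (\<alpha> + 2) * (\<bar>Re z - Re w\<bar> + (Im z + Im w)) powr - (\<alpha> + 2))"
    using assms by (intro mult_left_mono) auto
  moreover have "cmod (bkernel \<alpha> w z) = (2 powr \<alpha> * (\<alpha> + 1) / pi) * cmod (((z - cnj w) / \<i>) powr of_real (- (\<alpha> + 2)))"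
    unfolding bkernel_def norm_mult norm_of_real if_P[OF True] using assms by simp
  ultimately show ?thesis by (simp only: kconst_def kmaj_def mult.assoc)
next
  case False
  then show ?thesis using kconst_pos[OF assms(1)] by (simp add: bkernel_def)
qed

text \<open>Hermitian symmetry: the principal power commutes with conjugation away from the negative
  real axis.\<close>

lemma cnj_bkernel:
  assumes "w \<in> \<complex>\<^sub>+" "z \<in> \<complex>\<^sub>+"
  shows "cnj (bkernel \<alpha> w z) = bkernel \<alpha> z w"
proof -
  have "cnj (((z - cnj w) / \<i>) powr of_real (- (\<alpha> + 2))) = cnj ((z - cnj w) / \<i>) powr of_real (- (\<alpha> + 2))"
    using assms by (subst cnj_powr) (auto simp: Re_kernel_arg upper_half_plane_def simp del: of_real_minus of_real_add)
  also have "cnj ((z - cnj w) / \<i>) = (w - cnj z) / \<i>"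
    by (simp add: complex_eq_iff Re_divide Im_divide)
  finally show ?thesis using assms by (simp add: bkernel_def del: of_real_minus of_real_add)
qed

lemma bkernel_holomorphic:
  assumes "w \<in> \<complex>\<^sub>+" shows "bkernel \<alpha> w holomorphic_on \<complex>\<^sub>+"
proof -
  have "(\<lambda>z. of_real (2 powr \<alpha> * (\<alpha> + 1) / pi) * ((z - cnj w) / \<i>) powr of_real (- (\<alpha> + 2))) holomorphic_on \<complex>\<^sub>+"
    using assms by (intro holomorphic_intros not_nonpos_Reals) (auto simp: Re_kernel_arg upper_half_plane_def)
  then show ?thesis by (rule holomorphic_transform) (simp add: bkernel_def)
qed

lemma bkernel_measurable: "w \<in> \<complex>\<^sub>+ \<Longrightarrow> bkernel \<alpha> w \<in> borel_measurable borel"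
  by (rule holomorphic_zero_ext_measurable[OF bkernel_holomorphic]) (auto simp: bkernel_def)

lemma bkernel_in_bergman:
  assumes \<Omega>: "slow_weight \<Omega>" and pq: "1 < p" "1 < q" and \<alpha>: "-1 < \<alpha>" and w: "w \<in> \<complex>\<^sub>+"
  shows "bkernel \<alpha> w \<in> bergman p q \<Omega> \<alpha>"
proof -
  have "mixed_cnorm p q \<Omega> \<alpha> (bkernel \<alpha> w) \<le> mixed_norm p q \<Omega> \<alpha> (\<lambda>z. ennreal (kconst \<alpha>) * ennreal (kmaj \<alpha> w z))"
    using pq kconst_pos[OF \<alpha>] cmod_bkernel_le[OF \<alpha> w]
    by (intro mixed_norm_mono[OF \<Omega>]) (auto simp: ennreal_leI simp flip: ennreal_mult)
  also have "\<dots> = ennreal (kconst \<alpha>) * mixed_norm p q \<Omega> \<alpha> (\<lambda>z. ennreal (kmaj \<alpha> w z))"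
    using pq by (intro mixed_norm_cmult) auto
  also have "\<dots> < top"
    using mixed_norm_kmaj_finite[OF \<Omega> pq \<alpha> w] by (simp add: ennreal_mult_less_top)
  finally show ?thesis
    using pq bkernel_holomorphic[OF w] by (simp add: bergman_iff[OF \<Omega>] bkernel_def)
qed

section \<open>The reproducing formula\<close>

lemma integrable_product_complex:
  fixes g :: "complex \<Rightarrow> complex"
  assumes "integrable (dV \<alpha>) g"
  shows "integrable (lborel \<Otimes>\<^sub>M lborel) (\<lambda>(y, x). (indicator {0<..} y * y powr \<alpha>) *\<^sub>R g (Complex x y))"
    and "(\<integral>z. g z \<partial>dV \<alpha>) = (\<integral>y. (indicator {0<..} y * y powr \<alpha>) *\<^sub>R (\<integral>x. g (Complex x y) \<partial>lborel) \<partial>lborel)"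
proof -
  have [measurable]: "g \<in> borel_measurable borel"
    using borel_measurable_integrable[OF assms] by simp
  have e: "indicator \<complex>\<^sub>+ (Complex x y) = (indicator {0<..} y :: real)" for x y
    by (simp add: upper_half_plane_def indicator_def)
  have "integrable lborel (\<lambda>z. (indicator \<complex>\<^sub>+ z * Im z powr \<alpha>) *\<^sub>R g z)"
    using assms unfolding dV_def by (subst (asm) integrable_density) auto
  then show int: "integrable (lborel \<Otimes>\<^sub>M lborel) (\<lambda>(y, x). (indicator {0<..} y * y powr \<alpha>) *\<^sub>R g (Complex x y))"
    by (subst (asm) lborel_complex_eq, subst (asm) integrable_distr_eq) (auto simp: split_beta' e)
  have "(\<integral>z. g z \<partial>dV \<alpha>) = (\<integral>z. (indicator \<complex>\<^sub>+ z * Im z powr \<alpha>) *\<^sub>R g z \<partial>lborel)"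
    unfolding dV_def by (rule integral_density) auto
  also have "\<dots> = (\<integral>yx. (case yx of (y, x) \<Rightarrow> (indicator {0<..} y * y powr \<alpha>) *\<^sub>R g (Complex x y)) \<partial>(lborel \<Otimes>\<^sub>M lborel))"
    by (subst lborel_complex_eq, subst integral_distr) (auto simp: split_beta' e)
  also have "\<dots> = (\<integral>y. (\<integral>x. (indicator {0<..} y * y powr \<alpha>) *\<^sub>R g (Complex x y) \<partial>lborel) \<partial>lborel)"
    using lborel_pair.integral_fst[OF int] by simp
  finally show "(\<integral>z. g z \<partial>dV \<alpha>) = (\<integral>y. (indicator {0<..} y * y powr \<alpha>) *\<^sub>R (\<integral>x. g (Complex x y) \<partial>lborel) \<partial>lborel)"
    by simp
qed

lemma nn_integral_powr_shift_finite:
  fixes a b c :: real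
  assumes "-1 < a" "1 < b - a" "0 < c"
  shows "(\<integral>\<^sup>+ y. ennreal (indicator {0<..} y * (y powr a * (c + y) powr - b)) \<partial>lborel) < \<infinity>"
proof -
  define m where "m = min 1 c"
  have m: "0 < m" "m \<le> 1" "m \<le> c" using assms by (auto simp: m_def)
  have "(\<integral>\<^sup>+ y. ennreal (indicator {0<..} y * (y powr a * (c + y) powr - b)) \<partial>lborel)
    \<le> (\<integral>\<^sup>+ y. ennreal (m powr - b) * (ennreal (y powr a * (1 + y) powr - b) * indicator {0<..} y) \<partial>lborel)"
  proof (rule nn_integral_mono)
    fix y :: real
    show "ennreal (indicator {0<..} y * (y powr a * (c + y) powr - b)) \<le>
        ennreal (m powr - b) * (ennreal (y powr a * (1 + y) powr - b) * indicator {0<..} y)"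
    proof (cases "0 < y")
      case True
      have "m * y \<le> 1 * y" using m True by (intro mult_right_mono) auto
      then have "m * (1 + y) \<le> c + y" using m by (simp add: distrib_left)
      then have "(c + y) powr - b \<le> (m * (1 + y)) powr - b"
        using m True assms by (intro powr_mono2') auto
      then have "y powr a * (c + y) powr - b \<le> m powr - b * (y powr a * (1 + y) powr - b)"
        using m True mult_left_mono[of "(c + y) powr - b" "(m * (1 + y)) powr - b" "y powr a"] by (simp add: powr_mult mult_ac)
      then show ?thesis using True by (simp add: ennreal_leI flip: ennreal_mult)
    qed simp
  qed
  also have "\<dots> = ennreal (m powr - b) * (\<integral>\<^sup>+ y\<in>{0<..}. ennreal (y powr a * (1 + y) powr - b) \<partial>lborel)"
    by (rule nn_integral_cmult) measurable
  also have "\<dots> < \<infinity>"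
    using nn_integral_powr_finite[OF assms(1,2)] by (simp add: ennreal_mult_less_top)
  finally show ?thesis .
qed

text \<open>The integrand has the primitive \<open>(y / (u + 2 y))\<^sup>\<alpha>\<^sup>+\<^sup>1 / ((\<alpha> + 1) u)\<close>.\<close>

lemma integral_powr_complex_shift:
  assumes \<alpha>: "-1 < \<alpha>" and u: "0 < Re u"
  shows "(\<integral>y. (indicator {0<..} y * y powr \<alpha>) *\<^sub>R (u + 2 * of_real y) powr of_real (- (\<alpha> + 2)) \<partial>lborel)
    = of_real (2 powr - (\<alpha> + 1) / (\<alpha> + 1)) / u"
proof -
  define f where "f y = of_real (y powr \<alpha>) * (u + 2 * of_real y) powr of_real (- (\<alpha> + 2))" for y
  define F where "F y = of_real (y powr (\<alpha> + 1)) * (u + 2 * of_real y) powr of_real (- (\<alpha> + 1)) / (of_real (\<alpha> + 1) * u)" for y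
  have u0: "u \<noteq> 0" and a0: "complex_of_real (\<alpha> + 1) \<noteq> 0" using u \<alpha> by (auto simp del: of_real_add)
  have Re: "0 < Re (u + 2 * of_real y)" if "0 \<le> y" for y using u that by simp
  have nz: "u + 2 * of_real y \<noteq> 0" if "0 \<le> y" for y
    using Re[OF that] by (metis less_irrefl zero_complex.sel(1))
  have "interval_lebesgue_integral lborel 0 \<infinity> f = of_real (2 powr - (\<alpha> + 1)) / (of_real (\<alpha> + 1) * u) - 0"
  proof (rule interval_integral_FTC_integrable)
    fix y :: real assume "0 < ereal y" then have y: "0 < y" by simp
    let ?z = "u + 2 * of_real y"
    have z: "?z \<noteq> 0" using Re[of y] y by (auto simp: complex_eq_iff)
    have "((\<lambda>y. y powr (\<alpha> + 1)) has_real_derivative (\<alpha> + 1) * y powr \<alpha>) (at y)"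
      using has_real_derivative_powr[OF y, of "\<alpha> + 1"] by simp
    then have 1: "((\<lambda>y. complex_of_real (y powr (\<alpha> + 1))) has_vector_derivative of_real ((\<alpha> + 1) * y powr \<alpha>)) (at y)"
      by (rule has_vector_derivative_of_real)
    have "((\<lambda>y. u + 2 * complex_of_real y) has_vector_derivative 2) (at y)"
      by (auto intro!: derivative_eq_intros)
    from field_vector_diff_chain_at[OF this has_field_derivative_powr[of _ "of_real (- (\<alpha> + 1))"]] Re[of y] y
    have 2: "((\<lambda>y. (u + 2 * complex_of_real y) powr of_real (- (\<alpha> + 1))) has_vector_derivative
        2 * (of_real (- (\<alpha> + 1)) * ?z powr (of_real (- (\<alpha> + 1)) - 1))) (at y)"
      by (simp add: o_def not_nonpos_Reals)
    have "of_real (- (\<alpha> + 1)) - 1 = complex_of_real (- (\<alpha> + 2))" by simp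
    note 2 = 2[unfolded this]
    have z1: "?z powr of_real (- (\<alpha> + 1)) = ?z powr of_real (- (\<alpha> + 2)) * ?z"
      using powr_add[of ?z "of_real (- (\<alpha> + 2))" 1] z by (simp add: algebra_simps)
    have y1: "complex_of_real (y powr (\<alpha> + 1)) = of_real (y powr \<alpha>) * of_real y"
      using y by (simp add: powr_add)
    have "(F has_vector_derivative (of_real ((\<alpha> + 1) * y powr \<alpha>) * ?z powr of_real (- (\<alpha> + 1)) +
        of_real (y powr (\<alpha> + 1)) * (2 * (of_real (- (\<alpha> + 1)) * ?z powr of_real (- (\<alpha> + 2))))) / (of_real (\<alpha> + 1) * u)) (at y)"
      unfolding F_def
      by (intro has_vector_derivative_divide)
         (use has_vector_derivative_mult[OF 1 2] in \<open>simp add: add.commute\<close>)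
    moreover have "(of_real ((\<alpha> + 1) * y powr \<alpha>) * ?z powr of_real (- (\<alpha> + 1)) +
        of_real (y powr (\<alpha> + 1)) * (2 * (of_real (- (\<alpha> + 1)) * ?z powr of_real (- (\<alpha> + 2))))) / (of_real (\<alpha> + 1) * u) = f y"
    proof -
      have "of_real ((\<alpha> + 1) * y powr \<alpha>) * ?z powr of_real (- (\<alpha> + 1)) +
        of_real (y powr (\<alpha> + 1)) * (2 * (of_real (- (\<alpha> + 1)) * ?z powr of_real (- (\<alpha> + 2))))
        = (of_real (\<alpha> + 1) * u) * f y"
        unfolding z1 y1 f_def by (simp add: algebra_simps)
      then show ?thesis using u0 a0 by simp
    qed
    ultimately show "(F has_vector_derivative f y) (at y)" by simp
    show "isCont f y"
      unfolding f_def using y Re[of y]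
      by (intro continuous_intros) (auto simp: not_nonpos_Reals)
  next
    have ei: "einterval 0 \<infinity> = {0<..}" by (auto simp: einterval_def)
    have [measurable]: "(\<lambda>y. indicator {0<..} y *\<^sub>R f y) \<in> borel_measurable borel"
      unfolding f_def
      by (intro borel_measurable_continuous_on_indicator continuous_intros) (use u nz in auto)
    show "set_integrable lborel (einterval 0 \<infinity>) f"
      unfolding ei set_integrable_def
    proof (rule integrableI_bounded)
      have "(\<integral>\<^sup>+ y. ennreal (norm (indicator {0<..} y *\<^sub>R f y)) \<partial>lborel)
         \<le> (\<integral>\<^sup>+ y. ennreal (2 powr (\<alpha> + 2)) * ennreal (indicator {0<..} y * (y powr \<alpha> * (Re u + y) powr - (\<alpha> + 2))) \<partial>lborel)"
      proof (rule nn_integral_mono)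
        fix y :: real
        have "cmod (f y) \<le> 2 powr (\<alpha> + 2) * (y powr \<alpha> * (Re u + y) powr - (\<alpha> + 2))" if "0 < y"
        proof -
          have "cmod ((u + 2 * of_real y) powr of_real (- (\<alpha> + 2))) \<le> 2 powr (\<alpha> + 2) * (Re u + y) powr - (\<alpha> + 2)"
            using \<alpha> u that by (intro cmod_powr_le) auto
          from mult_left_mono[OF this, of "y powr \<alpha>"] show ?thesis by (simp add: f_def norm_mult mult_ac)
        qed
        then show "ennreal (norm (indicator {0<..} y *\<^sub>R f y)) \<le>
           ennreal (2 powr (\<alpha> + 2)) * ennreal (indicator {0<..} y * (y powr \<alpha> * (Re u + y) powr - (\<alpha> + 2)))"
          by (auto simp: indicator_def intro!: ennreal_leI simp flip: ennreal_mult)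
      qed
      also have "\<dots> = ennreal (2 powr (\<alpha> + 2)) * (\<integral>\<^sup>+ y. ennreal (indicator {0<..} y * (y powr \<alpha> * (Re u + y) powr - (\<alpha> + 2))) \<partial>lborel)"
        by (rule nn_integral_cmult) measurable
      also have "\<dots> < \<infinity>"
        using nn_integral_powr_shift_finite[of \<alpha> "\<alpha> + 2" "Re u"] \<alpha> u by (simp add: ennreal_mult_less_top)
      finally show "(\<integral>\<^sup>+ y. ennreal (norm (indicator {0<..} y *\<^sub>R f y)) \<partial>lborel) < \<infinity>" .
    qed simp
    have "((\<lambda>y. y powr (\<alpha> + 1)) \<longlongrightarrow> 0) (at_right (0::real))"
      using \<alpha> by (intro tendsto_zero_powrI[OF _ tendsto_const]) (auto simp: eventually_at_right_less eventually_at_filter intro!: tendsto_intros)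
    then have "(F \<longlongrightarrow> of_real 0 * (u + 2 * of_real 0) powr of_real (- (\<alpha> + 1)) / (of_real (\<alpha> + 1) * u)) (at_right 0)"
      unfolding F_def using u u0 a0
      by (intro tendsto_intros tendsto_powr_complex) (auto simp: not_nonpos_Reals simp del: of_real_add)
    then show "((F \<circ> real_of_ereal) \<longlongrightarrow> 0) (at_right 0)"
      unfolding zero_ereal_def by (simp add: ereal_tendsto_simps)
    \<comment> \<open>For \<open>y > 0\<close> the positive factor \<open>y\<close> can be pulled
      out of the complex power and cancels \<open>y powr (\<alpha> + 1)\<close>; so
      \<open>F y\<close> depends on \<open>u / y\<close> only, apart from the constant denominator,
      and its limit at infinity is visible.\<close>
    have "((\<lambda>y. (u * of_real (1 / y) + 2) powr of_real (- (\<alpha> + 1)) / (of_real (\<alpha> + 1) * u)) \<longlongrightarrow>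
        (u * of_real 0 + 2) powr of_real (- (\<alpha> + 1)) / (of_real (\<alpha> + 1) * u)) at_top"
      using u0 a0 by (intro tendsto_intros tendsto_powr_complex)
         (auto intro!: tendsto_divide_0[OF tendsto_const] filterlim_at_top_imp_at_infinity filterlim_ident simp: not_nonpos_Reals simp del: of_real_add of_real_divide)
    moreover have "(u * of_real 0 + 2) powr of_real (- (\<alpha> + 1)) = complex_of_real (2 powr - (\<alpha> + 1))"
      using powr_of_real[of 2 "- (\<alpha> + 1)"] by simp
    ultimately have "((\<lambda>y. (u * of_real (1 / y) + 2) powr of_real (- (\<alpha> + 1)) / (of_real (\<alpha> + 1) * u)) \<longlongrightarrow>
        complex_of_real (2 powr - (\<alpha> + 1)) / (of_real (\<alpha> + 1) * u)) at_top"
      by (simp only:)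
    moreover have "\<forall>\<^sub>F y in at_top. (u * of_real (1 / y) + 2) powr of_real (- (\<alpha> + 1)) / (of_real (\<alpha> + 1) * u) = F y"
      using eventually_gt_at_top[of 0]
    proof eventually_elim
      fix y :: real assume y: "0 < y"
      have "u + 2 * of_real y = of_real y * (u * of_real (1 / y) + 2)" using y by (simp add: field_simps)
      then have "(u + 2 * of_real y) powr of_real (- (\<alpha> + 1)) = of_real y powr of_real (- (\<alpha> + 1)) * (u * of_real (1 / y) + 2) powr of_real (- (\<alpha> + 1))"
        using y by (simp only: powr_times_real_left Reals_of_real Re_complex_of_real less_imp_le)
      also have "of_real y powr of_real (- (\<alpha> + 1)) = complex_of_real (y powr - (\<alpha> + 1))"
        using powr_of_real[of y "- (\<alpha> + 1)"] y by simp
      finally have "of_real (y powr (\<alpha> + 1)) * (u + 2 * of_real y) powr of_real (- (\<alpha> + 1)) =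
          complex_of_real (y powr (\<alpha> + 1) * y powr - (\<alpha> + 1)) * (u * of_real (1 / y) + 2) powr of_real (- (\<alpha> + 1))"
        by (simp only: of_real_mult mult.assoc)
      also have "y powr (\<alpha> + 1) * y powr - (\<alpha> + 1) = 1" using y by (simp flip: powr_add)
      finally show "(u * of_real (1 / y) + 2) powr of_real (- (\<alpha> + 1)) / (of_real (\<alpha> + 1) * u) = F y"
        by (simp add: F_def)
    qed
    ultimately show "((F \<circ> real_of_ereal) \<longlongrightarrow> of_real (2 powr - (\<alpha> + 1)) / (of_real (\<alpha> + 1) * u)) (at_left \<infinity>)"
      unfolding ereal_tendsto_simps by (rule Lim_transform_eventually)
  qed simp
  moreover have "einterval 0 \<infinity> = {0<..}" by (auto simp: einterval_def)
  moreover have "(\<lambda>y. indicator {0<..} y *\<^sub>R f y) = (\<lambda>y. (indicator {0<..} y * y powr \<alpha>) *\<^sub>R (u + 2 * of_real y) powr of_real (- (\<alpha> + 2)))"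
    by (auto simp: f_def scaleR_conv_of_real indicator_def)
  ultimately show ?thesis
    by (simp add: interval_lebesgue_integral_def set_lebesgue_integral_def divide_divide_eq_left del: of_real_add of_real_minus)
qed

lemma measurable_cnj [measurable]: "cnj \<in> borel_measurable borel"
  by (intro borel_measurable_continuous_onI continuous_intros)

text \<open>Hoelder, since \<open>\<sigma> * p' > 1\<close> puts the power into the dual Lebesgue
  space. It is used with exponent 1 for the Cauchy kernel and with an exponent below 1 for
  Fubini.\<close>

lemma line_integral_finite:
  assumes p: "1 < p" "1 / p + 1 / p' = 1" and \<sigma>: "1 < \<sigma> * p'" and b: "0 < b"
    and [measurable]: "g \<in> borel_measurable borel" and g: "enorm p lborel g < top"
  shows "(\<integral>\<^sup>+ x. g x * ennreal ((\<bar>x - a\<bar> + b) powr - \<sigma>) \<partial>lborel) < top"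
proof -
  have "(\<integral>\<^sup>+ x. g x * ennreal ((\<bar>x - a\<bar> + b) powr - \<sigma>) \<partial>lborel)
      \<le> enorm p lborel g * enorm p' lborel (\<lambda>x. ennreal ((\<bar>x - a\<bar> + b) powr - \<sigma>))"
    using p by (intro Hoelder_nn_integral) auto
  also have "\<dots> < top"
  proof -
    have "(\<integral>\<^sup>+ x. ennreal_powr (ennreal ((\<bar>x - a\<bar> + b) powr - \<sigma>)) p' \<partial>lborel)
        = (\<integral>\<^sup>+ x. ennreal ((\<bar>x - a\<bar> + b) powr - (\<sigma> * p')) \<partial>lborel)"
      by (simp add: ennreal_powr_ennreal powr_powr)
    also have "\<dots> = (\<integral>\<^sup>+ x. ennreal ((\<bar>x\<bar> + b) powr - (\<sigma> * p')) \<partial>lborel)"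
      by (subst nn_integral_real_affine[where c = 1 and t = a]) auto
    also have "\<dots> < top" using b \<sigma> by (simp add: nn_integral_abs_powr)
    finally show ?thesis using g by (simp add: enorm_def ennreal_mult_less_top)
  qed
  finally show ?thesis .
qed

text \<open>Almost every slice has finite norm, and every interval \<open>{0<..<b}\<close> has
  positive measure. This supplies the line on which Cauchy's formula is applied.\<close>

lemma exists_finite_slice:
  assumes \<Omega>: "slow_weight \<Omega>" and q: "0 < q" and [measurable]: "g \<in> borel_measurable borel"
    and g: "mixed_norm p q \<Omega> \<alpha> g < top" and b: "0 < b"
  obtains h where "0 < h" "h < b" "enorm p lborel (\<lambda>x. g (Complex x h)) < top"
proof -
  have "AE y in wmeasure \<Omega> \<alpha>. ennreal_powr (enorm p lborel (\<lambda>x. g (Complex x y))) q \<noteq> \<infinity>"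
    using g q unfolding mixed_norm_def enorm_def[of q] by (intro nn_integral_PInf_AE) auto
  then have ae: "AE y in lborel. 0 < y \<longrightarrow> enorm p lborel (\<lambda>x. g (Complex x y)) < top"
    unfolding AE_wmeasure_iff[OF \<Omega>] by (auto simp: less_top elim!: eventually_mono)
  have "\<exists>h. 0 < h \<and> h < b \<and> enorm p lborel (\<lambda>x. g (Complex x h)) < top"
  proof (rule ccontr)
    assume "\<not> ?thesis"
    with ae have "AE y in lborel. y \<notin> {0<..<b}" by (auto elim!: eventually_mono)
    then have "emeasure lborel {0<..<b} = 0"
      by (subst (asm) AE_iff_measurable[where N = "{0<..<b}"]) auto
    then show False using b by simp
  qed
  then show thesis using that by blast
qed

lemma bergman_pairing_integrable:
  assumes \<Omega>: "slow_weight \<Omega>" "slow_weight \<Omega>'" "\<And>y. 0 < y \<Longrightarrow> \<Omega>' y = \<Omega> y powr (1 - q')"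
    and pq: "1 < p" "1 < q" "1 / p + 1 / p' = 1" "1 / q + 1 / q' = 1"
    and [measurable]: "f \<in> borel_measurable borel" "g \<in> borel_measurable borel"
    and "mixed_cnorm p q \<Omega> \<alpha> f < top" "mixed_cnorm p' q' \<Omega>' \<alpha> g < top"
  shows "integrable (dV \<alpha>) (\<lambda>z. f z * g z)"
proof (rule integrableI_bounded)
  have "(\<integral>\<^sup>+ z. ennreal (norm (f z * g z)) \<partial>dV \<alpha>) = (\<integral>\<^sup>+ z. ennreal (cmod (f z)) * ennreal (cmod (g z)) \<partial>dV \<alpha>)"
    by (simp add: norm_mult ennreal_mult)
  also have "\<dots> \<le> mixed_cnorm p q \<Omega> \<alpha> f * mixed_cnorm p' q' \<Omega>' \<alpha> g"
    by (rule mixed_norm_Hoelder[OF \<Omega> pq]) auto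
  also have "\<dots> < \<infinity>" using assms(10,11) by (simp add: ennreal_mult_less_top)
  finally show "(\<integral>\<^sup>+ z. ennreal (norm (f z * g z)) \<partial>dV \<alpha>) < \<infinity>" .
qed simp

text \<open>On the line \<open>Im z = y\<close> the kernel is a holomorphic function of \<open>z\<close> below the height
  \<open>Im w + 2 y\<close>. So the line can be moved to a height \<open>h < Im w\<close> independent of \<open>y\<close>, after which the
  integral over \<open>y\<close> is explicit and produces the Cauchy kernel.\<close>

theorem bergman_reproducing:
  assumes \<Omega>: "slow_weight \<Omega>" "slow_weight \<Omega>'" "\<And>y. 0 < y \<Longrightarrow> \<Omega>' y = \<Omega> y powr (1 - q')"
    and pq: "1 < p" "1 < q" "1 / p + 1 / p' = 1" "1 / q + 1 / q' = 1" and \<alpha>: "-1 < \<alpha>"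
    and f: "f \<in> bergman p q \<Omega> \<alpha>" and w: "w \<in> \<complex>\<^sub>+"
  shows "integrable (dV \<alpha>) (\<lambda>z. f z * bkernel \<alpha> z w)"
    and "(\<integral>z. f z * bkernel \<alpha> z w \<partial>dV \<alpha>) = f w"
proof -
  have p': "1 < p'" "1 < q'" using conjugate_exponent_gt_1 pq by blast+
  have [measurable]: "f \<in> borel_measurable borel" using bergman_measurable[OF f] .
  have hol: "f holomorphic_on \<complex>\<^sub>+" and fin: "mixed_cnorm p q \<Omega> \<alpha> f < top" and f0: "\<And>z. z \<notin> \<complex>\<^sub>+ \<Longrightarrow> f z = 0"
    using f bergman_iff[OF \<Omega>(1), of p q f \<alpha>] pq by auto
  have fK: "f z * bkernel \<alpha> z w = f z * cnj (bkernel \<alpha> w z)" for z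
    using cnj_bkernel[OF w, of z] f0[of z] by (cases "z \<in> \<complex>\<^sub>+") auto
  have K: "bkernel \<alpha> w \<in> bergman p' q' \<Omega>' \<alpha>" by (rule bkernel_in_bergman[OF \<Omega>(2) p' \<alpha> w])
  have [measurable]: "bkernel \<alpha> w \<in> borel_measurable borel" using bkernel_measurable[OF w] .
  have "mixed_cnorm p' q' \<Omega>' \<alpha> (\<lambda>z. cnj (bkernel \<alpha> w z)) < top"
    using K p' by (simp add: bergman_iff[OF \<Omega>(2)])
  then have int: "integrable (dV \<alpha>) (\<lambda>z. f z * cnj (bkernel \<alpha> w z))"
    using fin by (intro bergman_pairing_integrable[OF \<Omega> pq]) auto
  then show int': "integrable (dV \<alpha>) (\<lambda>z. f z * bkernel \<alpha> z w)" by (simp add: fK)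
  have w0: "0 < Im w" using w by (simp add: upper_half_plane_def)
  obtain h where h: "0 < h" "h < Im w" and slice: "enorm p lborel (\<lambda>x. ennreal (cmod (f (Complex x h)))) < top"
    using exists_finite_slice[OF \<Omega>(1) _ _ fin w0] pq by auto
  define b where "b = Im w - h"
  have b: "0 < b" using h by (simp add: b_def)
  define c where "c = 2 powr \<alpha> * (\<alpha> + 1) / pi"
  define s where "s = \<alpha> + 2"
  define U where "U x y = ((w - Complex x h) / \<i> + 2 * of_real y) powr of_real (- s)" for x y
  have Re: "Re ((w - Complex x h) / \<i>) = b" "Im ((w - Complex x h) / \<i>) = x - Re w" for x
    by (simp_all add: b_def Re_divide Im_divide)
  have Ule: "cmod (U x y) \<le> 2 powr s * (\<bar>x - Re w\<bar> + (b + 2 * y)) powr - s" if "0 < y" for x y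
    unfolding U_def using that h b \<alpha> by (intro cmod_powr_le) (auto simp: Re s_def b_def)
  have shift: "(\<integral>x. f (Complex x y) * bkernel \<alpha> (Complex x y) w \<partial>lborel) = of_real c * (\<integral>x. f (Complex x h) * U x y \<partial>lborel)"
    if y: "0 < y" for y
  proof -
    \<comment> \<open>On the line of height \<open>y\<close> one has
      \<open>cnj z = z - 2 * \<i> * y\<close>, so \<open>G\<close> agrees there with
      \<open>f\<close> times the kernel up to the constant \<open>c\<close>, while being holomorphic
      in \<open>z\<close>.\<close>
    define G where "G z = f z * ((w + 2 * \<i> * of_real y - z) / \<i>) powr of_real (- s)" for z
    have ReG: "Re ((w + 2 * \<i> * of_real y - z) / \<i>) = Im w + 2 * y - Im z"
      "Im ((w + 2 * \<i> * of_real y - z) / \<i>) = Re z - Re w" for z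
      by (simp_all add: Re_divide Im_divide)
    define l m where "l = min y h" and "m = max y h"
    have lm: "0 < l" "l \<le> m" "m < Im w + 2 * y" using y h by (auto simp: l_def m_def)
    define d where "d = Im w + 2 * y - m"
    have d: "0 < d" using lm by (simp add: d_def)
    \<comment> \<open>On the strip between the two heights \<open>f\<close> is bounded, so all the
      decay needed for the shift comes from the kernel.\<close>
    obtain C where C: "0 \<le> C" "\<And>z. l \<le> Im z \<Longrightarrow> cmod (f z) \<le> C * (1 + Im z)\<^sup>2"
      using bergman_growth[OF \<Omega>(1) pq(1,2) \<alpha> f lm(1)] by blast
    \<comment> \<open>Chosen so that \<open>\<kappa> * (1 + \<bar>Re z\<bar>) \<le> \<bar>Re z - Re
      w\<bar> + d\<close>, which trades decay away from \<open>Re w\<close> for decay away from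
      0.\<close>
    define \<kappa> where "\<kappa> = 1 / ((1 + \<bar>Re w\<bar>) / d + 1)"
    have \<kappa>: "0 < \<kappa>" using d by (auto simp: \<kappa>_def intro!: divide_pos_pos add_nonneg_pos)
    have G_hol: "G holomorphic_on {z. l \<le> Im z \<and> Im z \<le> m}"
      unfolding G_def using lm
      by (intro holomorphic_intros holomorphic_on_subset[OF hol] not_nonpos_Reals) (auto simp: ReG upper_half_plane_def)
    have G_le: "cmod (G z) \<le> (C * (1 + m)\<^sup>2 * (2 powr s * \<kappa> powr - s)) * (1 + \<bar>Re z\<bar>) powr - s"
      if z: "l \<le> Im z" "Im z \<le> m" for z
    proof -
      have "1 + \<bar>Re z\<bar> \<le> (1 + \<bar>Re w\<bar>) + \<bar>Re z - Re w\<bar>" by simp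
      also have "\<dots> \<le> ((1 + \<bar>Re w\<bar>) / d + 1) * (\<bar>Re z - Re w\<bar> + d)"
      proof -
        have "0 \<le> (1 + \<bar>Re w\<bar>) / d * \<bar>Re z - Re w\<bar>" "(1 + \<bar>Re w\<bar>) / d * d = 1 + \<bar>Re w\<bar>" using d by auto
        then show ?thesis using d by (simp only: distrib_left distrib_right mult_1)
      qed
      finally have le: "\<kappa> * (1 + \<bar>Re z\<bar>) \<le> \<bar>Re z - Re w\<bar> + d"
        using d by (simp add: \<kappa>_def pos_divide_le_eq add_nonneg_pos mult.commute)
      have "cmod (((w + 2 * \<i> * of_real y - z) / \<i>) powr of_real (- s)) \<le> 2 powr s * (\<kappa> * (1 + \<bar>Re z\<bar>)) powr - s"
      proof (rule cmod_powr_le)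
        show "\<kappa> * (1 + \<bar>Re z\<bar>) \<le> \<bar>Re ((w + 2 * \<i> * of_real y - z) / \<i>)\<bar> + \<bar>Im ((w + 2 * \<i> * of_real y - z) / \<i>)\<bar>"
          unfolding ReG using le z(2) by (simp add: d_def)
      qed (use \<kappa> \<alpha> in \<open>auto simp: s_def intro!: mult_pos_pos add_pos_nonneg\<close>)
      moreover have "cmod (f z) \<le> C * (1 + m)\<^sup>2"
        by (rule order_trans[OF C(2)[OF z(1)]]) (use C(1) z lm in \<open>auto intro!: mult_left_mono power_mono\<close>)
      ultimately have "cmod (G z) \<le> (C * (1 + m)\<^sup>2) * (2 powr s * (\<kappa> * (1 + \<bar>Re z\<bar>)) powr - s)"
        unfolding G_def norm_mult using C(1) by (intro mult_mono) auto
      then show ?thesis using \<kappa> by (simp add: powr_mult mult_ac)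
    qed
    have s1: "1 < s" using \<alpha> by (simp add: s_def)
    have "(\<integral>x. G (Complex x y) \<partial>lborel) = (\<integral>x. G (Complex x h) \<partial>lborel)"
    proof (cases y h rule: linorder_cases)
      case less
      then show ?thesis using G_hol G_le s1 by (intro horizontal_shift) (auto simp: l_def m_def)
    next
      case greater
      then show ?thesis using G_hol G_le s1 by (intro horizontal_shift[symmetric]) (auto simp: l_def m_def)
    qed simp
    moreover have "f (Complex x y) * bkernel \<alpha> (Complex x y) w = of_real c * G (Complex x y)" for x
    proof -
      have "w - cnj (Complex x y) = w + 2 * \<i> * of_real y - Complex x y" by (simp add: complex_eq_iff)
      then show ?thesis unfolding bkernel_def G_def c_def s_def if_P[OF w] by (simp only: mult.left_commute)
    qed
    moreover have "G (Complex x h) = f (Complex x h) * U x y" for x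
    proof -
      have "(w + 2 * \<i> * of_real y - Complex x h) / \<i> = (w - Complex x h) / \<i> + 2 * of_real y"
        by (simp add: complex_eq_iff Re_divide Im_divide)
      then show ?thesis by (simp add: G_def U_def)
    qed
    ultimately show ?thesis by simp
  qed
  \<comment> \<open>The midpoint of \<open>1 / p'\<close> and 1: \<open>\<sigma> * p' > 1\<close>
    makes the integral over the line finite by Hoelder, and \<open>\<sigma> < 1\<close> leaves
    exponent \<open>s - \<sigma> > \<alpha> + 1\<close> for the integral over
    \<open>y\<close>.\<close>
  define \<sigma> where "\<sigma> = (1 + 1 / p') / 2"
  have \<sigma>: "0 < \<sigma>" "\<sigma> < 1" "1 < \<sigma> * p'" using p' by (auto simp: \<sigma>_def field_simps)
  have int2: "integrable (lborel \<Otimes>\<^sub>M lborel) (\<lambda>(y, x). (indicator {0<..} y * y powr \<alpha>) *\<^sub>R (f (Complex x h) * U x y))"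
  proof (rule integrableI_bounded)
    define A where "A = (\<integral>\<^sup>+ x. ennreal (cmod (f (Complex x h))) * ennreal ((\<bar>x - Re w\<bar> + b) powr - \<sigma>) \<partial>lborel)"
    have A: "A < top" unfolding A_def using pq \<sigma> b slice by (intro line_integral_finite) auto
    have [measurable]: "(\<lambda>(y, x). U x y) \<in> borel_measurable (lborel \<Otimes>\<^sub>M lborel)"
      unfolding U_def powr_def by measurable
    show meas: "(\<lambda>(y, x). (indicator {0<..} y * y powr \<alpha>) *\<^sub>R (f (Complex x h) * U x y)) \<in> borel_measurable (lborel \<Otimes>\<^sub>M lborel)"
      unfolding U_def powr_def by measurable
    have "(\<integral>\<^sup>+ z. ennreal (norm (case z of (y, x) \<Rightarrow> (indicator {0<..} y * y powr \<alpha>) *\<^sub>R (f (Complex x h) * U x y))) \<partial>(lborel \<Otimes>\<^sub>M lborel))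
       = (\<integral>\<^sup>+ y. \<integral>\<^sup>+ x. ennreal (norm ((indicator {0<..} y * y powr \<alpha>) *\<^sub>R (f (Complex x h) * U x y))) \<partial>lborel \<partial>lborel)"
      using meas by (subst lborel.nn_integral_fst[symmetric]) auto
    also have "\<dots> \<le> (\<integral>\<^sup>+ y. ennreal (2 powr s) * (ennreal (indicator {0<..} y * (y powr \<alpha> * (b + y) powr - (s - \<sigma>))) * A) \<partial>lborel)"
    proof (rule nn_integral_mono)
      fix y :: real
      have "(\<integral>\<^sup>+ x. ennreal (norm ((indicator {0<..} y * y powr \<alpha>) *\<^sub>R (f (Complex x h) * U x y))) \<partial>lborel)
        \<le> (\<integral>\<^sup>+ x. (ennreal (2 powr s) * ennreal (indicator {0<..} y * (y powr \<alpha> * (b + y) powr - (s - \<sigma>)))) *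
            (ennreal (cmod (f (Complex x h))) * ennreal ((\<bar>x - Re w\<bar> + b) powr - \<sigma>)) \<partial>lborel)"
      proof (rule nn_integral_mono)
        fix x :: real
        show "ennreal (norm ((indicator {0<..} y * y powr \<alpha>) *\<^sub>R (f (Complex x h) * U x y)))
          \<le> (ennreal (2 powr s) * ennreal (indicator {0<..} y * (y powr \<alpha> * (b + y) powr - (s - \<sigma>)))) *
            (ennreal (cmod (f (Complex x h))) * ennreal ((\<bar>x - Re w\<bar> + b) powr - \<sigma>))"
        proof (cases "0 < y")
          case True
          have "(\<bar>x - Re w\<bar> + (b + 2 * y)) powr - s = (\<bar>x - Re w\<bar> + (b + 2 * y)) powr - \<sigma> * (\<bar>x - Re w\<bar> + (b + 2 * y)) powr - (s - \<sigma>)"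
            by (simp flip: powr_add)
          also have "\<dots> \<le> (\<bar>x - Re w\<bar> + b) powr - \<sigma> * (b + y) powr - (s - \<sigma>)"
            using True b \<sigma> \<alpha> by (intro mult_mono powr_mono2') (auto simp: s_def)
          finally have "cmod (U x y) \<le> 2 powr s * ((\<bar>x - Re w\<bar> + b) powr - \<sigma> * (b + y) powr - (s - \<sigma>))"
            by (intro order_trans[OF Ule[OF True]] mult_left_mono) auto
          then have "y powr \<alpha> * (cmod (f (Complex x h)) * cmod (U x y)) \<le>
             y powr \<alpha> * (cmod (f (Complex x h)) * (2 powr s * ((\<bar>x - Re w\<bar> + b) powr - \<sigma> * (b + y) powr - (s - \<sigma>))))"
            by (intro mult_left_mono) auto
          then show ?thesis
            using True by (simp add: norm_mult ennreal_leI mult_ac flip: ennreal_mult)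
        qed simp
      qed
      also have "\<dots> = ennreal (2 powr s) * ennreal (indicator {0<..} y * (y powr \<alpha> * (b + y) powr - (s - \<sigma>))) * A"
        unfolding A_def by (rule nn_integral_cmult) measurable
      finally show "(\<integral>\<^sup>+ x. ennreal (norm ((indicator {0<..} y * y powr \<alpha>) *\<^sub>R (f (Complex x h) * U x y))) \<partial>lborel)
        \<le> ennreal (2 powr s) * (ennreal (indicator {0<..} y * (y powr \<alpha> * (b + y) powr - (s - \<sigma>))) * A)"
        by (simp add: mult.assoc)
    qed
    also have "\<dots> = ennreal (2 powr s) * ((\<integral>\<^sup>+ y. ennreal (indicator {0<..} y * (y powr \<alpha> * (b + y) powr - (s - \<sigma>))) \<partial>lborel) * A)"
      by (subst nn_integral_cmult, measurable, subst nn_integral_multc, measurable)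
    also have "\<dots> < \<infinity>"
      using nn_integral_powr_shift_finite[of \<alpha> "s - \<sigma>" b] \<alpha> \<sigma> b A by (simp add: ennreal_mult_less_top s_def)
    finally show "(\<integral>\<^sup>+ z. ennreal (norm (case z of (y, x) \<Rightarrow> (indicator {0<..} y * y powr \<alpha>) *\<^sub>R (f (Complex x h) * U x y))) \<partial>(lborel \<Otimes>\<^sub>M lborel)) < \<infinity>" .
  qed
  have Cint: "integrable lborel (\<lambda>x. f (Complex x h) / (Complex x h - w))"
  proof (rule integrableI_bounded)
    have "(\<integral>\<^sup>+ x. ennreal (norm (f (Complex x h) / (Complex x h - w))) \<partial>lborel)
      \<le> (\<integral>\<^sup>+ x. 2 * (ennreal (cmod (f (Complex x h))) * ennreal ((\<bar>x - Re w\<bar> + b) powr - 1)) \<partial>lborel)"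
    proof (rule nn_integral_mono)
      fix x :: real
      have "(\<bar>x - Re w\<bar> + b) / 2 \<le> cmod (Complex x h - w)"
        using cmod_ge_half[of "Complex x h - w"] h by (simp add: b_def)
      then have "cmod (f (Complex x h)) / cmod (Complex x h - w) \<le> cmod (f (Complex x h)) / ((\<bar>x - Re w\<bar> + b) / 2)"
        using b by (intro divide_left_mono mult_pos_pos) (auto intro: less_le_trans[rotated])
      also have "\<dots> = 2 * (cmod (f (Complex x h)) * (\<bar>x - Re w\<bar> + b) powr - 1)"
        using b by (simp add: powr_minus field_simps)
      finally have "ennreal (norm (f (Complex x h) / (Complex x h - w))) \<le> ennreal (2 * (cmod (f (Complex x h)) * (\<bar>x - Re w\<bar> + b) powr - 1))"
        by (simp add: norm_divide ennreal_leI)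
      moreover have "ennreal (2 * (A * B)) = 2 * (ennreal A * ennreal B)" if "0 \<le> A" "0 \<le> B" for A B :: real
        using that by (simp add: ennreal_mult)
      ultimately show "ennreal (norm (f (Complex x h) / (Complex x h - w))) \<le> 2 * (ennreal (cmod (f (Complex x h))) * ennreal ((\<bar>x - Re w\<bar> + b) powr - 1))"
        using powr_ge_zero by (metis norm_ge_zero)
    qed
    also have "\<dots> = 2 * (\<integral>\<^sup>+ x. ennreal (cmod (f (Complex x h))) * ennreal ((\<bar>x - Re w\<bar> + b) powr - 1) \<partial>lborel)"
      by (rule nn_integral_cmult) measurable
    also have "\<dots> < \<infinity>"
      using line_integral_finite[OF pq(1,3) _ b _ slice, of 1 "Re w"] p' by (simp add: ennreal_mult_less_top)
    finally show "(\<integral>\<^sup>+ x. ennreal (norm (f (Complex x h) / (Complex x h - w))) \<partial>lborel) < \<infinity>" .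
  qed measurable
  have Cauchy: "(\<integral>x. f (Complex x h) / (Complex x h - w) \<partial>lborel) = 2 * pi * \<i> * f w"
  proof -
    obtain C where C: "0 \<le> C" "\<And>z. h \<le> Im z \<Longrightarrow> cmod (f z) \<le> C * (1 + Im z)\<^sup>2"
      using bergman_growth[OF \<Omega>(1) pq(1,2) \<alpha> f h(1)] by blast
    have "cmod (f z) \<le> C * (1 + cmod z) ^ 2" if "h \<le> Im z" for z
      by (rule order_trans[OF C(2)[OF that]])
         (use C(1) h that abs_Im_le_cmod[of z] in \<open>auto intro!: mult_left_mono power_mono\<close>)
    moreover have "f holomorphic_on {z. h \<le> Im z}"
      by (rule holomorphic_on_subset[OF hol]) (use h in \<open>auto simp: upper_half_plane_def\<close>)
    ultimately show ?thesis by (intro Cauchy_half_plane h Cint)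
  qed
  have "(\<integral>z. f z * bkernel \<alpha> z w \<partial>dV \<alpha>) = (\<integral>y. (indicator {0<..} y * y powr \<alpha>) *\<^sub>R (\<integral>x. f (Complex x y) * bkernel \<alpha> (Complex x y) w \<partial>lborel) \<partial>lborel)"
    by (rule integrable_product_complex(2)[OF int'])
  also have "\<dots> = (\<integral>y. of_real c * (\<integral>x. (indicator {0<..} y * y powr \<alpha>) *\<^sub>R (f (Complex x h) * U x y) \<partial>lborel) \<partial>lborel)"
  proof (rule Bochner_Integration.integral_cong[OF refl])
    fix y :: real
    show "(indicator {0<..} y * y powr \<alpha>) *\<^sub>R (\<integral>x. f (Complex x y) * bkernel \<alpha> (Complex x y) w \<partial>lborel) =
      of_real c * (\<integral>x. (indicator {0<..} y * y powr \<alpha>) *\<^sub>R (f (Complex x h) * U x y) \<partial>lborel)"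
      by (cases "0 < y") (simp_all add: shift scaleR_conv_of_real mult.left_commute)
  qed
  also have "\<dots> = of_real c * (\<integral>y. (\<integral>x. (indicator {0<..} y * y powr \<alpha>) *\<^sub>R (f (Complex x h) * U x y) \<partial>lborel) \<partial>lborel)"
    by (rule integral_mult_right_zero)
  also have "(\<integral>y. (\<integral>x. (indicator {0<..} y * y powr \<alpha>) *\<^sub>R (f (Complex x h) * U x y) \<partial>lborel) \<partial>lborel)
    = (\<integral>x. (\<integral>y. (indicator {0<..} y * y powr \<alpha>) *\<^sub>R (f (Complex x h) * U x y) \<partial>lborel) \<partial>lborel)"
    by (rule lborel_pair.Fubini_integral[symmetric]) (use int2 in simp)
  also have "\<dots> = (\<integral>x. of_real (2 powr - (\<alpha> + 1) / (\<alpha> + 1)) * (- \<i> * (f (Complex x h) / (Complex x h - w))) \<partial>lborel)"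
  proof (rule Bochner_Integration.integral_cong[OF refl])
    fix x :: real
    have "(\<integral>y. (indicator {0<..} y * y powr \<alpha>) *\<^sub>R (f (Complex x h) * U x y) \<partial>lborel)
      = (\<integral>y. f (Complex x h) * ((indicator {0<..} y * y powr \<alpha>) *\<^sub>R U x y) \<partial>lborel)"
      by simp
    also have "\<dots> = f (Complex x h) * (\<integral>y. (indicator {0<..} y * y powr \<alpha>) *\<^sub>R U x y \<partial>lborel)"
      by (rule integral_mult_right_zero)
    also have "(\<integral>y. (indicator {0<..} y * y powr \<alpha>) *\<^sub>R U x y \<partial>lborel) = of_real (2 powr - (\<alpha> + 1) / (\<alpha> + 1)) / ((w - Complex x h) / \<i>)"
      unfolding U_def s_def by (rule integral_powr_complex_shift[OF \<alpha>]) (use h in simp)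
    also have "f (Complex x h) * (of_real (2 powr - (\<alpha> + 1) / (\<alpha> + 1)) / ((w - Complex x h) / \<i>))
      = of_real (2 powr - (\<alpha> + 1) / (\<alpha> + 1)) * (- \<i> * (f (Complex x h) / (Complex x h - w)))"
    proof -
      have "w - Complex x h \<noteq> 0" "Complex x h - w \<noteq> 0" using h by (auto simp: complex_eq_iff)
      then have "1 / ((w - Complex x h) / \<i>) = - \<i> / (Complex x h - w)" by (simp add: field_simps)
      then show ?thesis by (simp only: divide_inverse mult_1) (simp add: mult_ac)
    qed
    finally show "(\<integral>y. (indicator {0<..} y * y powr \<alpha>) *\<^sub>R (f (Complex x h) * U x y) \<partial>lborel)
      = of_real (2 powr - (\<alpha> + 1) / (\<alpha> + 1)) * (- \<i> * (f (Complex x h) / (Complex x h - w)))" .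
  qed
  also have "\<dots> = of_real (2 powr - (\<alpha> + 1) / (\<alpha> + 1)) * (- \<i> * (2 * pi * \<i> * f w))"
    by (simp only: integral_mult_right_zero Cauchy)
  also have "of_real c * (of_real (2 powr - (\<alpha> + 1) / (\<alpha> + 1)) * (- \<i> * (2 * pi * \<i> * f w)))
     = of_real (c * (2 powr - (\<alpha> + 1) / (\<alpha> + 1)) * (2 * pi)) * f w"
    by (simp add: mult_ac)
  \<comment> \<open>This identity fixes the constant in \<open>bkernel\<close>.\<close>
  also have "c * (2 powr - (\<alpha> + 1) / (\<alpha> + 1)) * (2 * pi) = 1"
  proof -
    have "2 powr \<alpha> * 2 powr - (\<alpha> + 1) * 2 = (1::real)" by (simp add: powr_diff powr_minus field_simps powr_add)
    moreover have "\<alpha> + 1 \<noteq> 0" using \<alpha> by simp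
    then have "c * (2 powr - (\<alpha> + 1) / (\<alpha> + 1)) * (2 * pi) = 2 powr \<alpha> * 2 powr - (\<alpha> + 1) * 2"
      by (simp add: c_def)
    ultimately show ?thesis by (simp only:)
  qed
  finally show "(\<integral>z. f z * bkernel \<alpha> z w \<partial>dV \<alpha>) = f w" by simp
qed

section \<open>Continuity of the kernel and Riemann sums\<close>

text \<open>The point \<i> lies in every box and serves as common reference: kernels with pole in a
  fixed box are all compared with \<open>kmaj \<alpha> \<i>\<close>.\<close>

lemma ii_in_hbox: "1 \<le> r \<Longrightarrow> \<i> \<in> hbox r"
  by (simp add: hbox_def)

lemma kmaj_ii_le_1:
  assumes "-1 < \<alpha>" "w \<in> \<complex>\<^sub>+" shows "kmaj \<alpha> \<i> w \<le> 1"
  using assms powr_mono2'[of "- (\<alpha> + 2)" 1 "\<bar>Re w\<bar> + (Im w + 1)"]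
  by (simp add: kmaj_def upper_half_plane_def)

lemma cmod_bkernel_le_ii:
  assumes \<alpha>: "-1 < \<alpha>" and r: "1 \<le> r" and z: "z \<in> hbox r" and w: "w \<in> \<complex>\<^sub>+"
  shows "cmod (bkernel \<alpha> z w) \<le> kconst \<alpha> * (1 + 3 * r\<^sup>2) powr (\<alpha> + 2) * kmaj \<alpha> \<i> w"
proof -
  have "z \<in> \<complex>\<^sub>+" using z hbox_subset[OF r] by auto
  then have "cmod (bkernel \<alpha> z w) \<le> kconst \<alpha> * kmaj \<alpha> z w" by (rule cmod_bkernel_le[OF \<alpha>])
  also have "\<dots> \<le> kconst \<alpha> * ((1 + 3 * r\<^sup>2) powr (\<alpha> + 2) * kmaj \<alpha> \<i> w)"
    using kconst_pos[OF \<alpha>] \<alpha> by (intro mult_left_mono kmaj_compare r z w ii_in_hbox) auto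
  finally show ?thesis by (simp add: mult.assoc)
qed

text \<open>The bound is asked only up to distance \<open>1 / (2 * r)\<close>, half the least height
  in the box: for the kernel it comes from the mean value inequality on a disc that has to stay
  inside the domain of holomorphy.\<close>

definition hbox_Lipschitz :: "real \<Rightarrow> real \<Rightarrow> (complex \<Rightarrow> complex) \<Rightarrow> bool"
  where "hbox_Lipschitz r E G \<longleftrightarrow>
    (\<forall>z\<in>hbox r. \<forall>z'\<in>hbox r. cmod (z - z') \<le> 1 / (2 * r) \<longrightarrow> cmod (G z - G z') \<le> E * cmod (z - z'))"

text \<open>The derivative of the power has exponent \<open>- (s + 1)\<close>; the extra order costs
  a factor \<open>r\<close>, because the base has modulus at least \<open>1 / r\<close>, and the
  rest is compared with \<open>kmaj \<alpha> \<i>\<close>. As a function of \<open>w\<close> the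
  Lipschitz constant has finite mixed norm, so \<open>z \<mapsto> bkernel \<alpha> z\<close> is
  locally Lipschitz into the Bergman space.\<close>

lemma bkernel_Lipschitz:
  assumes \<alpha>: "-1 < \<alpha>" and r: "1 \<le> r"
  shows "\<exists>D\<ge>0. \<forall>w\<in>\<complex>\<^sub>+. hbox_Lipschitz r (D * kmaj \<alpha> \<i> w) (\<lambda>z. bkernel \<alpha> z w)"
proof -
  define s where "s = \<alpha> + 2"
  have s: "1 < s" using \<alpha> by (simp add: s_def)
  define c where "c = 2 powr \<alpha> * (\<alpha> + 1) / pi"
  have c: "0 \<le> c" using \<alpha> by (simp add: c_def)
  define E where "E = (1 + 3 * r\<^sup>2) powr (\<alpha> + 2)"
  define D where "D = c * (s * (2 powr (s + 1) * r * 2 powr s * E))"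
  have "cmod (bkernel \<alpha> z w - bkernel \<alpha> z' w) \<le> D * kmaj \<alpha> \<i> w * cmod (z - z')"
    if z: "z \<in> hbox r" "z' \<in> hbox r" and d: "cmod (z - z') \<le> 1 / (2 * r)" and w: "w \<in> \<complex>\<^sub>+" for z z' w
  proof -
    define a a' where "a = (w - cnj z) / \<i>" and "a' = (w - cnj z') / \<i>"
    have aa: "cmod (a' - a) = cmod (z - z')"
    proof -
      have "a' - a = cnj (z - z') / \<i>" by (simp add: a_def a'_def diff_divide_distrib algebra_simps)
      then show ?thesis by (simp add: norm_mult del: complex_cnj_diff)
    qed
    have Rea: "1 / r \<le> Re a" using z w by (simp add: a_def hbox_def upper_half_plane_def)
    have a0: "0 < 1 / r" "1 / r \<le> cmod a" using r Rea complex_Re_le_cmod[of a] by (auto intro: order_trans)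
    \<comment> \<open>The radius is at most \<open>1 / (2 * r)\<close>, half the lower bound
      \<open>1 / r\<close> for both \<open>Re a\<close> and \<open>cmod a\<close>.\<close>
    have S: "0 < Re u" "cmod a / 2 \<le> cmod u" if "u \<in> cball a (cmod (a' - a))" for u
    proof -
      have u: "cmod (a - u) \<le> 1 / (2 * r)" using that d by (simp add: aa dist_norm)
      have half: "1 / (2 * r) = (1 / r) / 2" by simp
      have "Re a - Re u \<le> 1 / (2 * r)" using u complex_Re_le_cmod[of "a - u"] by simp
      then show "0 < Re u" using Rea a0 half by linarith
      have "cmod a - cmod u \<le> 1 / (2 * r)" using u norm_triangle_ineq2[of a u] by linarith
      then show "cmod a / 2 \<le> cmod u" using a0 half by linarith
    qed
    have "cmod (a powr of_real (- s) - a' powr of_real (- s)) \<le> (s * (cmod a / 2) powr - (s + 1)) * cmod (a - a')"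
    proof (rule field_differentiable_bound[where S = "cball a (cmod (a' - a))" and f' = "\<lambda>u. of_real (- s) * u powr (of_real (- s) - 1)"])
      fix u assume u: "u \<in> cball a (cmod (a' - a))"
      show "((\<lambda>u. u powr of_real (- s)) has_field_derivative of_real (- s) * u powr (of_real (- s) - 1)) (at u within cball a (cmod (a' - a)))"
        by (rule has_field_derivative_at_within[OF has_field_derivative_powr[OF not_nonpos_Reals[OF S(1)[OF u]]]])
      have "cmod (of_real (- s) * u powr (of_real (- s) - 1)) = s * cmod u powr - (s + 1)"
        using s by (simp add: norm_mult norm_powr_real_powr')
      also have "\<dots> \<le> s * (cmod a / 2) powr - (s + 1)"
        using s S(2)[OF u] less_le_trans[OF a0] by (intro mult_left_mono powr_mono2') auto
      finally show "cmod (of_real (- s) * u powr (of_real (- s) - 1)) \<le> s * (cmod a / 2) powr - (s + 1)" .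
    qed (auto simp: dist_norm norm_minus_commute)
    also have "(cmod a / 2) powr - (s + 1) \<le> 2 powr (s + 1) * r * 2 powr s * E * kmaj \<alpha> \<i> w"
    proof -
      have a1: "0 < cmod a" using less_le_trans[OF a0] .
      have zH: "z \<in> \<complex>\<^sub>+" using z hbox_subset[OF r] by auto
      have "cmod a powr - s = cmod (a powr of_real (- s))" by (simp add: norm_powr_real_powr')
      also have "\<dots> \<le> 2 powr s * (\<bar>Re w - Re z\<bar> + (Im w + Im z)) powr - s"
        using s zH w by (intro cmod_powr_le) (auto simp: a_def upper_half_plane_def)
      also have "\<dots> = 2 powr s * kmaj \<alpha> z w" by (simp add: kmaj_def s_def)
      also have "\<dots> \<le> 2 powr s * (E * kmaj \<alpha> \<i> w)"
        unfolding E_def using \<alpha> by (intro mult_left_mono kmaj_compare r z w ii_in_hbox) auto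
      finally have 1: "cmod a powr - s \<le> 2 powr s * (E * kmaj \<alpha> \<i> w)" .
      have 2: "cmod a powr - 1 \<le> r"
        using a0 a1 r by (simp add: powr_minus field_simps)
      have "(cmod a / 2) powr - (s + 1) = 2 powr (s + 1) * (cmod a powr - 1 * cmod a powr - s)"
        using a1 by (simp add: powr_divide powr_minus field_simps flip: powr_add)
      also have "\<dots> \<le> 2 powr (s + 1) * (r * (2 powr s * (E * kmaj \<alpha> \<i> w)))"
        using 1 2 r by (intro mult_left_mono mult_mono) auto
      finally show ?thesis by (simp add: mult_ac)
    qed
    finally have "cmod (a powr of_real (- s) - a' powr of_real (- s)) \<le> (s * (2 powr (s + 1) * r * 2 powr s * E * kmaj \<alpha> \<i> w)) * cmod (a - a')"
      using s by (simp add: mult_left_mono mult_right_mono)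
    then have "c * cmod (a powr of_real (- s) - a' powr of_real (- s)) \<le> c * ((s * (2 powr (s + 1) * r * 2 powr s * E * kmaj \<alpha> \<i> w)) * cmod (a - a'))"
      using c by (rule mult_left_mono)
    moreover have "cmod (bkernel \<alpha> z w - bkernel \<alpha> z' w) = c * cmod (a powr of_real (- s) - a' powr of_real (- s))"
    proof -
      have "bkernel \<alpha> z w - bkernel \<alpha> z' w = of_real c * (a powr of_real (- s) - a' powr of_real (- s))"
        unfolding bkernel_def if_P[OF w] c_def s_def a_def a'_def by (simp only: right_diff_distrib)
      then show ?thesis using c by (simp add: norm_mult)
    qed
    ultimately show ?thesis using aa by (simp add: D_def norm_minus_commute mult_ac)
  qed
  moreover have "0 \<le> D" using c s r by (simp add: D_def E_def)
  ultimately show ?thesis unfolding hbox_Lipschitz_def by blast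
qed

text \<open>\<open>\<pi>\<close> rounds both coordinates down to multiples of
  \<open>\<delta>\<close>, so it takes finitely many values on the box, and the coefficient of a
  node is the integral of \<open>h\<close> over its cell. The integral of
  \<open>h z * \<phi> (\<pi> z)\<close> is then exactly a sum, with the same coefficients for every
  \<open>\<phi>\<close>. Rounding may leave the box, but not the doubled one, as
  \<open>\<delta> \<le> 1 / (2 * r)\<close>.\<close>

lemma Riemann_sum:
  fixes h :: "complex \<Rightarrow> complex"
  assumes h: "integrable (dV \<alpha>) h" and supp: "\<forall>z. z \<notin> hbox r \<longrightarrow> h z = 0" and r: "1 \<le> r" and \<delta>: "0 < \<delta>" "\<delta> \<le> 1 / (2 * r)"
  shows "\<exists>(\<pi> :: complex \<Rightarrow> complex) Z c. finite Z \<and> Z \<subseteq> hbox (2 * r) \<and>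
    (\<forall>z\<in>hbox r. \<pi> z \<in> Z \<and> cmod (z - \<pi> z) \<le> 2 * \<delta>) \<and>
    (\<forall>\<phi> :: complex \<Rightarrow> complex. integrable (dV \<alpha>) (\<lambda>z. h z * \<phi> (\<pi> z)) \<and> (\<integral>z. h z * \<phi> (\<pi> z) \<partial>dV \<alpha>) = (\<Sum>\<zeta>\<in>Z. c \<zeta> * \<phi> \<zeta>))"
proof -
  define \<pi> where "\<pi> z = Complex (\<delta> * of_int \<lfloor>Re z / \<delta>\<rfloor>) (\<delta> * of_int \<lfloor>Im z / \<delta>\<rfloor>)" for z
  have [measurable]: "\<pi> \<in> borel_measurable borel" unfolding \<pi>_def by measurable
  define Z where "Z = \<pi> ` hbox r"
  define c where "c \<zeta> = (\<integral>z. h z * indicator {z. \<pi> z = \<zeta>} z \<partial>dV \<alpha>)" for \<zeta>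
  have fl: "\<delta> * of_int \<lfloor>t / \<delta>\<rfloor> \<le> t" "t - \<delta> \<le> \<delta> * of_int \<lfloor>t / \<delta>\<rfloor>" for t
    using \<delta>(1) mult_left_mono[OF of_int_floor_le[of "t / \<delta>"], of \<delta>]
      mult_left_mono[OF real_of_int_floor_ge_diff_one[of "t / \<delta>"], of \<delta>] by (auto simp: right_diff_distrib)
  have dist: "cmod (z - \<pi> z) \<le> 2 * \<delta>" for z
    using cmod_le[of "z - \<pi> z"] fl[of "Re z"] fl[of "Im z"] by (simp add: \<pi>_def abs_le_iff)
  have Zsub: "Z \<subseteq> hbox (2 * r)"
  proof
    fix \<zeta> assume "\<zeta> \<in> Z"
    then obtain z where z: "z \<in> hbox r" "\<zeta> = \<pi> z" by (auto simp: Z_def)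
    have "1 / (2 * r) = 1 / r / 2" by simp
    moreover have "1 / (2 * r) \<le> r" using r frac_le[of 1 1 1 "2 * r"] by linarith
    ultimately show "\<zeta> \<in> hbox (2 * r)"
      using z fl[of "Re z"] fl[of "Im z"] \<delta> r by (auto simp: hbox_def \<pi>_def abs_le_iff)
  qed
  have fin: "finite Z"
  proof -
    define N where "N = \<lceil>r / \<delta>\<rceil> + 1"
    have "\<lfloor>t / \<delta>\<rfloor> \<in> {- N..N}" if "\<bar>t\<bar> \<le> r" for t
    proof -
      have "t \<le> r" "- r \<le> t" using that by auto
      then have "t / \<delta> \<le> r / \<delta>" "- (r / \<delta>) \<le> t / \<delta>"
        using \<delta> divide_right_mono[of t r \<delta>] divide_right_mono[of "- r" t \<delta>] by simp_all
      then show ?thesis unfolding N_def atLeastAtMost_iff by linarith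
    qed
    note N = this
    have "Z \<subseteq> (\<lambda>(m, n). Complex (\<delta> * of_int m) (\<delta> * of_int n)) ` ({- N..N} \<times> {- N..N})"
    proof
      fix \<zeta> assume "\<zeta> \<in> Z"
      then obtain z where z: "z \<in> hbox r" "\<zeta> = \<pi> z" by (auto simp: Z_def)
      then have "\<bar>Re z\<bar> \<le> r" "\<bar>Im z\<bar> \<le> r"
        using hbox_subset[OF r] by (auto simp: hbox_def upper_half_plane_def)
      then show "\<zeta> \<in> (\<lambda>(m, n). Complex (\<delta> * of_int m) (\<delta> * of_int n)) ` ({- N..N} \<times> {- N..N})"
        using N z(2) by (intro image_eqI[of _ _ "(\<lfloor>Re z / \<delta>\<rfloor>, \<lfloor>Im z / \<delta>\<rfloor>)"]) (auto simp: \<pi>_def)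
    qed
    then show ?thesis by (rule finite_subset) auto
  qed
  have "integrable (dV \<alpha>) (\<lambda>z. h z * \<phi> (\<pi> z)) \<and> (\<integral>z. h z * \<phi> (\<pi> z) \<partial>dV \<alpha>) = (\<Sum>\<zeta>\<in>Z. c \<zeta> * \<phi> \<zeta>)" for \<phi> :: "complex \<Rightarrow> complex"
  proof -
    have e: "h z * \<phi> (\<pi> z) = (\<Sum>\<zeta>\<in>Z. h z * indicator {z. \<pi> z = \<zeta>} z * \<phi> \<zeta>)" for z
    proof (cases "z \<in> hbox r")
      case True
      then have "(\<Sum>\<zeta>\<in>Z. h z * indicator {z. \<pi> z = \<zeta>} z * \<phi> \<zeta>) = (\<Sum>\<zeta>\<in>Z. if \<zeta> = \<pi> z then h z * \<phi> \<zeta> else 0)"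
        by (intro sum.cong) (auto simp: indicator_def)
      then show ?thesis using fin True by (simp add: Z_def)
    qed (simp add: supp)
    have i: "integrable (dV \<alpha>) (\<lambda>z. h z * indicator {z. \<pi> z = \<zeta>} z)" for \<zeta>
      using integrable_mult_indicator[of "{z. \<pi> z = \<zeta>}" "dV \<alpha>" h] h by (simp add: scaleR_conv_of_real mult.commute of_real_indicator)
    show ?thesis unfolding e by (simp add: i c_def)
  qed
  then show ?thesis using fin Zsub dist by (intro exI[of _ \<pi>] exI[of _ Z] exI[of _ c]) (auto simp: Z_def)
qed

section \<open>The Bergman projection\<close>

text \<open>The variable \<open>w\<close> is the second argument of the kernel, so
  \<open>Pop \<alpha> h\<close> is a superposition of the holomorphic functions
  \<open>bkernel \<alpha> z\<close> and vanishes off the half-plane.\<close>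

definition Pop :: "real \<Rightarrow> (complex \<Rightarrow> complex) \<Rightarrow> complex \<Rightarrow> complex"
  where "Pop \<alpha> h w = (\<integral>z. h z * bkernel \<alpha> z w \<partial>dV \<alpha>)"

lemma measurable_bkernel_left: "(\<lambda>z. bkernel \<alpha> z w) \<in> borel_measurable borel"
proof (cases "w \<in> \<complex>\<^sub>+")
  case True
  then show ?thesis unfolding bkernel_def powr_def by simp measurable
qed (simp add: bkernel_def)

lemma AE_dV_half_plane: "AE z in dV \<alpha>. z \<in> \<complex>\<^sub>+"
  unfolding dV_def by (subst AE_density) (auto simp: indicator_def)

lemma cmod_Pop_le:
  assumes \<alpha>: "-1 < \<alpha>" and [measurable]: "h \<in> borel_measurable borel"
  shows "ennreal (cmod (Pop \<alpha> h w)) \<le> ennreal (kconst \<alpha>) * Pplus \<alpha> (\<lambda>z. ennreal (cmod (h z))) w"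
proof (cases "integrable (dV \<alpha>) (\<lambda>z. h z * bkernel \<alpha> z w)")
  case True
  have "ennreal (cmod (Pop \<alpha> h w)) \<le> (\<integral>\<^sup>+ z. ennreal (cmod (h z * bkernel \<alpha> z w)) \<partial>dV \<alpha>)"
    unfolding Pop_def by (rule integral_norm_bound_ennreal[OF True])
  also have "\<dots> \<le> (\<integral>\<^sup>+ z. ennreal (kconst \<alpha>) * (ennreal (cmod (h z)) * ennreal (kmaj \<alpha> w z)) \<partial>dV \<alpha>)"
  proof (rule nn_integral_mono_AE, use AE_dV_half_plane[of \<alpha>] in eventually_elim)
    fix z assume "z \<in> \<complex>\<^sub>+"
    from mult_left_mono[OF cmod_bkernel_le[OF \<alpha> this, of w], of "cmod (h z)"] kconst_pos[OF \<alpha>]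
    show "ennreal (cmod (h z * bkernel \<alpha> z w)) \<le> ennreal (kconst \<alpha>) * (ennreal (cmod (h z)) * ennreal (kmaj \<alpha> w z))"
      by (simp add: norm_mult kmaj_commute[of \<alpha> z] ennreal_leI mult_ac flip: ennreal_mult)
  qed
  also have "\<dots> = ennreal (kconst \<alpha>) * Pplus \<alpha> (\<lambda>z. ennreal (cmod (h z))) w"
    unfolding Pplus_def by (rule nn_integral_cmult) measurable
  finally show ?thesis .
\<comment> \<open>Where the integrand is not integrable, the integral is 0 by convention.\<close>
qed (simp add: Pop_def not_integrable_integral_eq)

lemma Pop_bounded:
  assumes \<Omega>: "slow_weight \<Omega>" and pq: "1 < p" "1 < q" and \<alpha>: "-1 < \<alpha>"
  obtains C where "0 < C"
    "\<And>h. h \<in> borel_measurable borel \<Longrightarrow> mixed_cnorm p q \<Omega> \<alpha> (Pop \<alpha> h) \<le> ennreal C * mixed_cnorm p q \<Omega> \<alpha> h"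
proof -
  interpret sigma_finite_measure "dV \<alpha>"
    unfolding dV_def by (subst sigma_finite_measure.sigma_finite_iff_density_finite[OF lborel.sigma_finite_measure_axioms]) auto
  obtain C where C: "0 < C"
    "\<And>h. h \<in> borel_measurable borel \<Longrightarrow> mixed_norm p q \<Omega> \<alpha> (Pplus \<alpha> h) \<le> ennreal C * mixed_norm p q \<Omega> \<alpha> h"
    using Pplus_bounded[OF \<Omega> pq \<alpha>] by blast
  have "mixed_cnorm p q \<Omega> \<alpha> (Pop \<alpha> h) \<le> ennreal (kconst \<alpha> * C) * mixed_cnorm p q \<Omega> \<alpha> h"
    if [measurable]: "h \<in> borel_measurable borel" for h
  proof -
    have "mixed_cnorm p q \<Omega> \<alpha> (Pop \<alpha> h) \<le> mixed_norm p q \<Omega> \<alpha> (\<lambda>w. ennreal (kconst \<alpha>) * Pplus \<alpha> (\<lambda>z. ennreal (cmod (h z))) w)"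
      using pq by (intro mixed_norm_mono[OF \<Omega>] cmod_Pop_le \<alpha>) auto
    also have "\<dots> = ennreal (kconst \<alpha>) * mixed_norm p q \<Omega> \<alpha> (Pplus \<alpha> (\<lambda>z. ennreal (cmod (h z))))"
    proof (rule mixed_norm_cmult)
      show "Pplus \<alpha> (\<lambda>z. ennreal (cmod (h z))) \<in> borel_measurable borel"
        unfolding Pplus_def[abs_def] by measurable
    qed (use pq in auto)
    also have "\<dots> \<le> ennreal (kconst \<alpha>) * (ennreal C * mixed_cnorm p q \<Omega> \<alpha> h)"
      by (intro mult_left_mono C) auto
    also have "\<dots> = ennreal (kconst \<alpha> * C) * mixed_cnorm p q \<Omega> \<alpha> h"
      using C kconst_pos[OF \<alpha>] by (simp add: ennreal_mult mult.assoc)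
    finally show ?thesis .
  qed
  then show thesis using C kconst_pos[OF \<alpha>] by (intro that[of "kconst \<alpha> * C"]) auto
qed

section \<open>Duality\<close>

lemma hbox_nbhd:
  assumes "1 \<le> r" "z \<in> hbox r" "cmod (z - z') \<le> 1 / (2 * r)" shows "z' \<in> hbox (2 * r)"
proof -
  have "1 / (2 * r) = 1 / r / 2" by simp
  moreover have "1 / (2 * r) \<le> r" using assms(1) frac_le[of 1 1 1 "2 * r"] by linarith
  moreover have "\<bar>Re z - Re z'\<bar> \<le> 1 / (2 * r)" "\<bar>Im z - Im z'\<bar> \<le> 1 / (2 * r)"
    using assms(3) abs_Re_le_cmod[of "z - z'"] abs_Im_le_cmod[of "z - z'"] by auto
  ultimately show ?thesis using assms(2) by (auto simp: hbox_def)
qed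

lemma eventually_in_hbox: "z \<in> \<complex>\<^sub>+ \<Longrightarrow> \<forall>\<^sub>F n in sequentially. z \<in> hbox (real n)"
proof -
  assume z: "z \<in> \<complex>\<^sub>+"
  obtain r where r: "2 \<le> r" "z \<in> hbox r" using hbox_exists[OF z] .
  have "\<forall>\<^sub>F n in sequentially. r \<le> real n" using filterlim_real_sequentially by (simp add: filterlim_at_top)
  then show ?thesis by eventually_elim (use r hbox_mono[of r] in auto)
qed

text \<open>Nodes and coefficients depend on \<open>h\<close>, \<open>r\<close> and
  \<open>\<epsilon>\<close> but not on \<open>G\<close>. This uniformity lets one sum approximate
  the projection at all points and, at the same time, the integral against the values of a
  functional.\<close>

lemma Riemann_sum_Lipschitz:
  fixes h :: "complex \<Rightarrow> complex"
  assumes h: "integrable (dV \<alpha>) h" and supp: "\<forall>z. z \<notin> hbox r \<longrightarrow> h z = 0" and r: "1 \<le> r" and \<epsilon>: "0 < \<epsilon>"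
  shows "\<exists>Z c. finite Z \<and> Z \<subseteq> hbox (2 * r) \<and>
    (\<forall>G E. integrable (dV \<alpha>) (\<lambda>z. h z * G z) \<longrightarrow> 0 \<le> E \<longrightarrow> hbox_Lipschitz (2 * r) E G \<longrightarrow>
      cmod ((\<integral>z. h z * G z \<partial>dV \<alpha>) - (\<Sum>\<zeta>\<in>Z. c \<zeta> * G \<zeta>)) \<le> \<epsilon> * E)"
proof -
  define H where "H = (\<integral>z. cmod (h z) \<partial>dV \<alpha>)"
  have H: "0 \<le> H" by (simp add: H_def)
  \<comment> \<open>\<open>1 / (8 * r)\<close> keeps the rounding error \<open>2 * \<delta>\<close>
    within the range \<open>1 / (4 * r)\<close> of the Lipschitz bound on the doubled box; the
    second term gives \<open>2 * \<delta> * H \<le> \<epsilon>\<close>, with 1 added for the case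
    \<open>H = 0\<close>.\<close>
  define \<delta> where "\<delta> = min (1 / (8 * r)) (\<epsilon> / (2 * (H + 1)))"
  have "\<delta> \<le> 1 / (8 * r)" by (simp add: \<delta>_def)
  moreover have "1 / (8 * r) \<le> 1 / (2 * r)" "2 * (1 / (8 * r)) = 1 / (2 * (2 * r))" using r by (auto intro: frac_le)
  ultimately have \<delta>: "0 < \<delta>" "\<delta> \<le> 1 / (2 * r)" "2 * \<delta> \<le> 1 / (2 * (2 * r))" using r \<epsilon> H by (auto simp: \<delta>_def)
  have \<delta>H: "2 * \<delta> * H \<le> \<epsilon>"
  proof -
    have "2 * \<delta> * H \<le> 2 * (\<epsilon> / (2 * (H + 1))) * (H + 1)"
      using H \<epsilon> \<delta> by (intro mult_mono) (auto simp: \<delta>_def)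
    also have "2 * (\<epsilon> / (2 * H1)) * H1 = \<epsilon>" if "0 < H1" for H1 using that by simp
    from this[of "H + 1"] H have "2 * (\<epsilon> / (2 * (H + 1))) * (H + 1) = \<epsilon>" by linarith
    finally show ?thesis .
  qed
  from Riemann_sum[OF h supp r \<delta>(1,2)] obtain \<pi> :: "complex \<Rightarrow> complex" and Z c where
    RS: "finite Z \<and> Z \<subseteq> hbox (2 * r) \<and> (\<forall>z\<in>hbox r. \<pi> z \<in> Z \<and> cmod (z - \<pi> z) \<le> 2 * \<delta>) \<and>
    (\<forall>\<phi> :: complex \<Rightarrow> complex. integrable (dV \<alpha>) (\<lambda>z. h z * \<phi> (\<pi> z)) \<and> (\<integral>z. h z * \<phi> (\<pi> z) \<partial>dV \<alpha>) = (\<Sum>\<zeta>\<in>Z. c \<zeta> * \<phi> \<zeta>))"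
    by (elim exE)
  then have Z: "finite Z" "Z \<subseteq> hbox (2 * r)" and \<pi>: "\<And>z. z \<in> hbox r \<Longrightarrow> \<pi> z \<in> Z \<and> cmod (z - \<pi> z) \<le> 2 * \<delta>"
    by simp_all
  have sum: "integrable (dV \<alpha>) (\<lambda>z. h z * \<phi> (\<pi> z)) \<and> (\<integral>z. h z * \<phi> (\<pi> z) \<partial>dV \<alpha>) = (\<Sum>\<zeta>\<in>Z. c \<zeta> * \<phi> \<zeta>)"
    for \<phi> :: "complex \<Rightarrow> complex"
    by (rule RS[THEN conjunct2, THEN conjunct2, THEN conjunct2, THEN spec])
  have "cmod ((\<integral>z. h z * G z \<partial>dV \<alpha>) - (\<Sum>\<zeta>\<in>Z. c \<zeta> * G \<zeta>)) \<le> \<epsilon> * E"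
    if int: "integrable (dV \<alpha>) (\<lambda>z. h z * G z)" and E: "0 \<le> E"
      and G: "hbox_Lipschitz (2 * r) E G" for G E
  proof -
    have i: "integrable (dV \<alpha>) (\<lambda>z. h z * G z - h z * G (\<pi> z))" using int sum[of G] by auto
    have "(\<integral>z. h z * G z \<partial>dV \<alpha>) - (\<Sum>\<zeta>\<in>Z. c \<zeta> * G \<zeta>) = (\<integral>z. h z * G z - h z * G (\<pi> z) \<partial>dV \<alpha>)"
      using int sum[of G] by simp
    also have "cmod \<dots> \<le> (\<integral>z. cmod (h z * G z - h z * G (\<pi> z)) \<partial>dV \<alpha>)" by (rule integral_norm_bound)
    also have "\<dots> \<le> (\<integral>z. cmod (h z) * (E * (2 * \<delta>)) \<partial>dV \<alpha>)"
    proof (rule integral_mono)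
      fix z
      show "cmod (h z * G z - h z * G (\<pi> z)) \<le> cmod (h z) * (E * (2 * \<delta>))"
      proof (cases "z \<in> hbox r")
        case True
        have "cmod (G z - G (\<pi> z)) \<le> E * cmod (z - \<pi> z)"
          using True \<pi>[OF True] Z(2) \<delta>(3) hbox_mono[OF r, of "2 * r"] r
          by (intro G[unfolded hbox_Lipschitz_def, rule_format]) auto
        also have "\<dots> \<le> E * (2 * \<delta>)" using \<pi>[OF True] E by (intro mult_left_mono) auto
        finally show ?thesis by (simp add: norm_mult mult_left_mono flip: right_diff_distrib)
      qed (simp add: supp)
    qed (use h i in auto)
    also have "\<dots> = (2 * \<delta> * H) * E" by (simp add: H_def mult_ac)
    also have "\<dots> \<le> \<epsilon> * E" using \<delta>H E by (rule mult_right_mono)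
    finally show ?thesis .
  qed
  then show ?thesis using Z by blast
qed

lemma integrable_mult_bounded_on_hbox:
  fixes h G :: "complex \<Rightarrow> complex"
  assumes h: "integrable (dV \<alpha>) h" and supp: "\<forall>z. z \<notin> hbox r \<longrightarrow> h z = 0"
    and [measurable]: "G \<in> borel_measurable borel" and G: "\<And>z. z \<in> hbox r \<Longrightarrow> cmod (G z) \<le> B"
  shows "integrable (dV \<alpha>) (\<lambda>z. h z * G z)"
proof (rule Bochner_Integration.integrable_bound)
  show "integrable (dV \<alpha>) (\<lambda>z. cmod (h z) * B)" using h by simp
  show "(\<lambda>z. h z * G z) \<in> borel_measurable (dV \<alpha>)"
    using borel_measurable_integrable[OF h] by measurable
  show "AE z in dV \<alpha>. norm (h z * G z) \<le> norm (cmod (h z) * B)"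
  proof (rule AE_I2)
    fix z
    show "norm (h z * G z) \<le> norm (cmod (h z) * B)"
    proof (cases "z \<in> hbox r")
      case True
      from mult_left_mono[OF G[OF this], of "cmod (h z)"] show ?thesis
        by (simp add: norm_mult abs_mult) (meson abs_ge_self mult_left_mono norm_ge_zero order_trans)
    qed (simp add: supp)
  qed
qed

lemma enorm_LIMSEQ:
  assumes "0 < r" "\<And>n. u n \<in> borel_measurable M" "incseq u" "\<And>x. (\<lambda>n. u n x) \<longlonglongrightarrow> v x"
  shows "(\<lambda>n. enorm r M (u n)) \<longlonglongrightarrow> enorm r M v"
  unfolding enorm_def
proof (rule tendsto_ennreal_powr[OF nn_integral_LIMSEQ])
  show "incseq (\<lambda>n x. ennreal_powr (u n x) r)"
    using assms(1,3) by (auto simp: incseq_def le_fun_def intro: ennreal_powr_mono)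
qed (use assms in \<open>auto intro: tendsto_ennreal_powr\<close>)

lemma mixed_norm_LIMSEQ:
  assumes "0 < p" "0 < q" "\<And>n. u n \<in> borel_measurable borel" "incseq u" "\<And>z. (\<lambda>n. u n z) \<longlonglongrightarrow> v z"
  shows "(\<lambda>n. mixed_norm p q \<Omega> \<alpha> (u n)) \<longlonglongrightarrow> mixed_norm p q \<Omega> \<alpha> v"
  unfolding mixed_norm_def
proof (rule enorm_LIMSEQ)
  note [measurable] = assms(3)
  show "(\<lambda>y. enorm p lborel (\<lambda>x. u n (Complex x y))) \<in> borel_measurable (wmeasure \<Omega> \<alpha>)" for n by measurable
  show "incseq (\<lambda>n y. enorm p lborel (\<lambda>x. u n (Complex x y)))"
    using assms(1,4) by (auto simp: incseq_def le_fun_def intro!: enorm_mono)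
  show "(\<lambda>n. enorm p lborel (\<lambda>x. u n (Complex x y))) \<longlonglongrightarrow> enorm p lborel (\<lambda>x. v (Complex x y))" for y
    using assms(1,4,5) by (intro enorm_LIMSEQ) (auto simp: incseq_def le_fun_def)
qed fact

section \<open>The dual pair of spaces and the approximation of projections by kernels\<close>

locale bergman_pair =
  fixes p q p' q' \<alpha> :: real and \<Omega> \<Omega>' :: "real \<Rightarrow> real"
  assumes slow: "slow_weight \<Omega>" "slow_weight \<Omega>'"
    and dual_weight: "\<And>y. 0 < y \<Longrightarrow> \<Omega>' y = \<Omega> y powr (1 - q')"
    and pq: "1 < p" "1 < q" "1 / p + 1 / p' = 1" "1 / q + 1 / q' = 1"
    and \<alpha>: "-1 < \<alpha>"
begin

lemma pq': "1 < p'" "1 < q'"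
  using conjugate_exponent_gt_1 pq by blast+

lemma pq0: "0 < p" "0 < q" "0 < p'" "0 < q'"
  using pq pq' by auto

text \<open>Identities that make the test function of \<open>converse_Hoelder\<close> extremal; the
  third also gives the symmetry of the pair.\<close>

lemma exponents: "(p' - 1) * p = p'" "q / p + (q' / p' - 1) * q = q' / p'" "q * q' = q + q'" "q' - q' / q = 1"
proof -
  show "q * q' = q + q'" using pq(4) pq0 by (simp add: field_simps)
  then have q: "q' * q - q = q'" by (simp add: mult.commute)
  show "(p' - 1) * p = p'" using pq(3) pq0 by (simp add: field_simps)
  have "1 / p = 1 - 1 / p'" "1 / q = 1 - 1 / q'" using pq(3,4) by simp_all
  then have "q * (1 / p) = q * (1 - 1 / p')" "q' * (1 / q) = q' * (1 - 1 / q')" by (simp_all only:)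
  then have e: "q / p = q - q / p'" "q' / q = q' - 1" using pq0 by (simp_all add: right_diff_distrib)
  have "(q' / p' - 1) * q = (q' * q) / p' - q" by (simp add: left_diff_distrib)
  moreover have "(q' * q) / p' - q / p' = q' / p'" using q by (simp flip: diff_divide_distrib)
  ultimately show "q / p + (q' / p' - 1) * q = q' / p'" using e by linarith
  show "q' - q' / q = 1" using e by simp
qed

text \<open>The relation of the weights is symmetric because \<open>(1 - q') * (1 - q) = 1\<close>.
  This makes the reproducing formula available for the dual space.\<close>

lemma swap: "bergman_pair p' q' p q \<alpha> \<Omega>' \<Omega>"
proof
  fix y :: real assume "0 < y"
  then have "0 < \<Omega> y" using slow_weight_pos slow by blast
  have "(1 - q') * (1 - q) = 1" using exponents(3) by (simp add: algebra_simps)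
  then show "\<Omega> y = \<Omega>' y powr (1 - q)"
    using \<open>0 < y\<close> \<open>0 < \<Omega> y\<close> by (simp add: dual_weight powr_powr)
qed (use slow pq pq' \<alpha> in auto)

abbreviation "A \<equiv> bergman p q \<Omega> \<alpha>"
abbreviation "N \<equiv> bergman_norm p q \<Omega> \<alpha>"
abbreviation "A' \<equiv> bergman p' q' \<Omega>' \<alpha>"
abbreviation "cnorm \<equiv> mixed_cnorm p q \<Omega> \<alpha>"
abbreviation "cnorm' \<equiv> mixed_cnorm p' q' \<Omega>' \<alpha>"
abbreviation "K \<equiv> bkernel \<alpha>"

lemma A_iff: "f \<in> A \<longleftrightarrow> f holomorphic_on \<complex>\<^sub>+ \<and> (\<forall>z. z \<notin> \<complex>\<^sub>+ \<longrightarrow> f z = 0) \<and> cnorm f < top"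
  using bergman_iff[OF slow(1) pq0(1,2)] .

lemma N_eq: "f \<in> A \<Longrightarrow> ennreal (N f) = cnorm f"
  by (rule bergman_norm_eq[OF slow(1) pq0(1,2)])

lemma N_nonneg: "0 \<le> N f" by (simp add: bergman_norm_def)

lemma K_in_A: "w \<in> \<complex>\<^sub>+ \<Longrightarrow> K w \<in> A"
  by (rule bkernel_in_bergman[OF slow(1) pq(1,2) \<alpha>])

lemma A_scale: assumes f: "f \<in> A" shows "(\<lambda>z. c * f z) \<in> A" "N (\<lambda>z. c * f z) = cmod c * N f"
proof -
  note [measurable] = bergman_measurable[OF f]
  have e: "cnorm (\<lambda>z. c * f z) = ennreal (cmod c) * cnorm f"
    using pq0 by (simp add: norm_mult ennreal_mult mixed_norm_cmult)
  then show cf: "(\<lambda>z. c * f z) \<in> A"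
    using f unfolding A_iff by (auto intro!: holomorphic_intros simp: ennreal_mult_less_top)
  have "ennreal (N (\<lambda>z. c * f z)) = ennreal (cmod c * N f)"
    using e by (simp add: N_eq[OF cf] N_eq[OF f] ennreal_mult N_nonneg)
  then show "N (\<lambda>z. c * f z) = cmod c * N f" by (subst (asm) ennreal_inj) (auto simp: N_nonneg)
qed

lemma A_add: assumes f: "f \<in> A" and g: "g \<in> A" shows "(\<lambda>z. f z + g z) \<in> A"
proof -
  note [measurable] = bergman_measurable[OF f] bergman_measurable[OF g]
  have "cnorm (\<lambda>z. f z + g z) \<le> mixed_norm p q \<Omega> \<alpha> (\<lambda>z. ennreal (cmod (f z)) + ennreal (cmod (g z)))"
    using pq0 by (intro mixed_norm_mono[OF slow(1)]) (auto simp: norm_triangle_ineq ennreal_leI simp flip: ennreal_plus)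
  also have "\<dots> < top" using f g pq0 unfolding A_iff by (intro mixed_norm_add_lt_top[OF slow(1)]) auto
  finally show ?thesis using f g unfolding A_iff by (auto intro!: holomorphic_intros)
qed

lemma A_zero: "(\<lambda>z. 0) \<in> A" "N (\<lambda>z. 0) = 0"
  using A_scale[OF K_in_A[of \<i>], of 0] by (simp_all add: upper_half_plane_def)

lemma A_diff: "f \<in> A \<Longrightarrow> g \<in> A \<Longrightarrow> (\<lambda>z. f z - g z) \<in> A"
  using A_add[of f "\<lambda>z. - 1 * g z"] A_scale(1)[of g "-1"] by simp

lemma A_sum: "finite Z \<Longrightarrow> (\<And>\<zeta>. \<zeta> \<in> Z \<Longrightarrow> F \<zeta> \<in> A) \<Longrightarrow> (\<lambda>z. \<Sum>\<zeta>\<in>Z. c \<zeta> * F \<zeta> z) \<in> A"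
  by (induction Z rule: finite_induct) (auto simp: A_zero A_add A_scale)

text \<open>Finite by \<open>mixed_norm_kmaj_finite\<close>, so the conversion to a real number
  loses nothing.\<close>

definition "m0 = enn2real (mixed_norm p q \<Omega> \<alpha> (\<lambda>z. ennreal (kmaj \<alpha> \<i> z)))"

lemma cnorm_le_kmaj:
  assumes "0 \<le> e" "\<And>w. w \<in> \<complex>\<^sub>+ \<Longrightarrow> cmod (F w) \<le> e * kmaj \<alpha> \<i> w"
  shows "cnorm F \<le> ennreal (e * m0)"
proof -
  have "cnorm F \<le> mixed_norm p q \<Omega> \<alpha> (\<lambda>z. ennreal e * ennreal (kmaj \<alpha> \<i> z))"
    using assms pq0 by (intro mixed_norm_mono[OF slow(1)]) (auto intro!: ennreal_leI simp flip: ennreal_mult)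
  also have "\<dots> = ennreal e * mixed_norm p q \<Omega> \<alpha> (\<lambda>z. ennreal (kmaj \<alpha> \<i> z))"
    using pq0 by (intro mixed_norm_cmult) auto
  also have "mixed_norm p q \<Omega> \<alpha> (\<lambda>z. ennreal (kmaj \<alpha> \<i> z)) = ennreal m0"
    unfolding m0_def using mixed_norm_kmaj_finite[OF slow(1) pq(1,2) \<alpha>, of \<i>] by (simp add: upper_half_plane_def)
  finally show ?thesis using assms(1) by (simp add: ennreal_mult m0_def)
qed

lemma N_le_kmaj:
  assumes "F \<in> A" "0 \<le> e" "\<And>w. w \<in> \<complex>\<^sub>+ \<Longrightarrow> cmod (F w) \<le> e * kmaj \<alpha> \<i> w"
  shows "N F \<le> e * m0"
  using cnorm_le_kmaj[OF assms(2,3)] assms(2) by (simp add: m0_def flip: N_eq[OF assms(1)])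

lemma Pop_kernel_integrable:
  assumes h: "integrable (dV \<alpha>) h" and supp: "\<forall>z. z \<notin> hbox r \<longrightarrow> h z = 0" and r: "1 \<le> r"
  shows "integrable (dV \<alpha>) (\<lambda>z. h z * K z w)"
proof (cases "w \<in> \<complex>\<^sub>+")
  case True
  show ?thesis
    by (rule integrable_mult_bounded_on_hbox[OF h supp measurable_bkernel_left]) (rule cmod_bkernel_le_ii[OF \<alpha> r _ True])
qed (simp add: bkernel_def)

text \<open>\<open>Riemann_sum_Lipschitz\<close> for \<open>G z = K z w\<close>. The error has the
  profile \<open>kmaj \<alpha> \<i>\<close> in \<open>w\<close>, hence is small in the norm of
  \<open>A\<close> and uniformly on the half-plane; the last clause keeps the same nodes at hand for
  other \<open>G\<close>.\<close>

lemma Pop_approx: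
  assumes h: "integrable (dV \<alpha>) h" and supp: "\<forall>z. z \<notin> hbox r \<longrightarrow> h z = 0" and r: "1 \<le> r" and \<epsilon>: "0 < \<epsilon>"
  shows "\<exists>Z c. finite Z \<and> Z \<subseteq> hbox (2 * r) \<and>
    (\<forall>w\<in>\<complex>\<^sub>+. cmod (Pop \<alpha> h w - (\<Sum>\<zeta>\<in>Z. c \<zeta> * K \<zeta> w)) \<le> \<epsilon> * kmaj \<alpha> \<i> w) \<and>
    (\<forall>G E. integrable (dV \<alpha>) (\<lambda>z. h z * G z) \<longrightarrow> 0 \<le> E \<longrightarrow> hbox_Lipschitz (2 * r) E G \<longrightarrow>
      cmod ((\<integral>z. h z * G z \<partial>dV \<alpha>) - (\<Sum>\<zeta>\<in>Z. c \<zeta> * G \<zeta>)) \<le> \<epsilon> * E)"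
proof -
  have r2: "1 \<le> 2 * r" using r by simp
  obtain D where D: "0 \<le> D" "\<And>w. w \<in> \<complex>\<^sub>+ \<Longrightarrow> hbox_Lipschitz (2 * r) (D * kmaj \<alpha> \<i> w) (\<lambda>z. K z w)"
    using bkernel_Lipschitz[OF \<alpha> r2] by blast
  \<comment> \<open>Both \<open>\<epsilon>' \<le> \<epsilon>\<close>, for general \<open>G\<close>,
    and \<open>\<epsilon>' * D \<le> \<epsilon>\<close>, for the kernels, are needed.\<close>
  define \<epsilon>' where "\<epsilon>' = min \<epsilon> (\<epsilon> / (D + 1))"
  have \<epsilon>': "0 < \<epsilon>'" "\<epsilon>' \<le> \<epsilon>" using \<epsilon> D(1) by (auto simp: \<epsilon>'_def)
  have \<epsilon>'D: "\<epsilon>' * D \<le> \<epsilon>"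
  proof -
    have "\<epsilon>' * D \<le> \<epsilon> / (D + 1) * (D + 1)" using \<epsilon> D(1) by (intro mult_mono) (auto simp: \<epsilon>'_def)
    then show ?thesis using D(1) by simp
  qed
  obtain Z c where Z: "finite Z" "Z \<subseteq> hbox (2 * r)"
    and RS: "\<forall>G E. integrable (dV \<alpha>) (\<lambda>z. h z * G z) \<longrightarrow> 0 \<le> E \<longrightarrow> hbox_Lipschitz (2 * r) E G \<longrightarrow>
      cmod ((\<integral>z. h z * G z \<partial>dV \<alpha>) - (\<Sum>\<zeta>\<in>Z. c \<zeta> * G \<zeta>)) \<le> \<epsilon>' * E"
    using Riemann_sum_Lipschitz[OF h supp r \<epsilon>'(1)] by blast
  have "cmod (Pop \<alpha> h w - (\<Sum>\<zeta>\<in>Z. c \<zeta> * K \<zeta> w)) \<le> \<epsilon> * kmaj \<alpha> \<i> w" if w: "w \<in> \<complex>\<^sub>+" for w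
  proof -
    have "cmod (Pop \<alpha> h w - (\<Sum>\<zeta>\<in>Z. c \<zeta> * K \<zeta> w)) \<le> \<epsilon>' * (D * kmaj \<alpha> \<i> w)"
      unfolding Pop_def
      using RS[rule_format, OF Pop_kernel_integrable[OF h supp r] _ D(2)[OF w]] D(1) by simp
    also have "\<dots> \<le> \<epsilon> * kmaj \<alpha> \<i> w"
      using mult_right_mono[OF \<epsilon>'D, of "kmaj \<alpha> \<i> w"] by (simp add: mult.assoc)
    finally show ?thesis .
  qed
  moreover have "cmod ((\<integral>z. h z * G z \<partial>dV \<alpha>) - (\<Sum>\<zeta>\<in>Z. c \<zeta> * G \<zeta>)) \<le> \<epsilon> * E"
    if "integrable (dV \<alpha>) (\<lambda>z. h z * G z)" "0 \<le> E" "hbox_Lipschitz (2 * r) E G" for G E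
    by (rule order_trans[OF RS[rule_format, OF that]]) (intro mult_right_mono \<epsilon>' that)
  ultimately show ?thesis using Z by blast
qed

lemma hbox_in_half_plane: "1 \<le> r \<Longrightarrow> z \<in> hbox r \<Longrightarrow> z \<in> \<complex>\<^sub>+"
  using hbox_subset by auto

text \<open>Kernel sums with errors \<open>kmaj \<alpha> \<i> / (n + 1)\<close> converge uniformly,
  as the majorant is at most 1, which gives holomorphy; a single such sum plus the majorant bounds
  the norm.\<close>

lemma Pop_in_A:
  assumes h: "integrable (dV \<alpha>) h" and supp: "\<forall>z. z \<notin> hbox r \<longrightarrow> h z = 0" and r: "1 \<le> r"
  shows "Pop \<alpha> h \<in> A"
proof -
  have "\<exists>Z c. finite Z \<and> Z \<subseteq> hbox (2 * r) \<and> (\<forall>w\<in>\<complex>\<^sub>+. cmod (Pop \<alpha> h w - (\<Sum>\<zeta>\<in>Z. c \<zeta> * K \<zeta> w)) \<le> 1 / real (Suc n) * kmaj \<alpha> \<i> w)" for n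
    using Pop_approx[OF h supp r, of "1 / real (Suc n)"] by (simp del: of_nat_Suc) blast
  then obtain Z c where Z: "\<And>n. finite (Z n)" "\<And>n. Z n \<subseteq> hbox (2 * r)"
    and le: "\<And>n w. w \<in> \<complex>\<^sub>+ \<Longrightarrow> cmod (Pop \<alpha> h w - (\<Sum>\<zeta>\<in>Z n. c n \<zeta> * K \<zeta> w)) \<le> 1 / real (Suc n) * kmaj \<alpha> \<i> w"
    by metis
  define S where "S n w = (\<Sum>\<zeta>\<in>Z n. c n \<zeta> * K \<zeta> w)" for n w
  have S: "S n \<in> A" for n
    unfolding S_def using Z hbox_in_half_plane[of "2 * r"] r by (intro A_sum K_in_A) auto
  have "Pop \<alpha> h holomorphic_on \<complex>\<^sub>+"
  proof (rule holomorphic_uniform_sequence[OF open_upper_half_plane])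
    show "S n holomorphic_on \<complex>\<^sub>+" for n using S A_iff by blast
    fix x assume "x \<in> \<complex>\<^sub>+"
    then obtain d where d: "0 < d" "cball x d \<subseteq> \<complex>\<^sub>+" using open_upper_half_plane open_contains_cball by blast
    have "uniform_limit (cball x d) S (Pop \<alpha> h) sequentially"
    proof (rule uniform_limitI)
      fix e :: real assume "0 < e"
      have "(\<lambda>n. 1 / real (Suc n)) \<longlonglongrightarrow> 0" by (rule LIMSEQ_Suc[OF lim_1_over_n])
      then have "\<forall>\<^sub>F n in sequentially. 1 / real (Suc n) < e" using \<open>0 < e\<close> by (rule order_tendstoD)
      then show "\<forall>\<^sub>F n in sequentially. \<forall>w\<in>cball x d. dist (S n w) (Pop \<alpha> h w) < e"
      proof eventually_elim
        case (elim n)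
        show ?case
        proof
          fix w assume "w \<in> cball x d"
          then have w: "w \<in> \<complex>\<^sub>+" using d by auto
          have "cmod (Pop \<alpha> h w - S n w) \<le> 1 / real (Suc n) * 1"
            unfolding S_def by (rule order_trans[OF le[OF w]]) (intro mult_left_mono kmaj_ii_le_1 \<alpha> w, simp)
          then show "dist (S n w) (Pop \<alpha> h w) < e" using elim by (simp add: dist_norm norm_minus_commute)
        qed
      qed
    qed
    with d show "\<exists>d>0. cball x d \<subseteq> \<complex>\<^sub>+ \<and> uniform_limit (cball x d) S (Pop \<alpha> h) sequentially" by blast
  qed
  moreover have "cnorm (Pop \<alpha> h) < top"
  proof -
    note [measurable] = bergman_measurable[OF S]
    have "cnorm (Pop \<alpha> h) \<le> mixed_norm p q \<Omega> \<alpha> (\<lambda>w. ennreal (cmod (S 0 w)) + ennreal (kmaj \<alpha> \<i> w))"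
    proof (rule mixed_norm_mono[OF slow(1) pq0(1,2)])
      fix w assume "w \<in> \<complex>\<^sub>+"
      then have "cmod (Pop \<alpha> h w) \<le> cmod (S 0 w) + kmaj \<alpha> \<i> w"
        using le[of w 0] norm_triangle_ineq2[of "Pop \<alpha> h w" "S 0 w"] by (simp add: S_def)
      then show "ennreal (cmod (Pop \<alpha> h w)) \<le> ennreal (cmod (S 0 w)) + ennreal (kmaj \<alpha> \<i> w)"
        by (simp add: ennreal_leI flip: ennreal_plus)
    qed
    also have "\<dots> < top"
      using S[of 0] mixed_norm_kmaj_finite[OF slow(1) pq(1,2) \<alpha>, of \<i>] unfolding A_iff
      by (intro mixed_norm_add_lt_top[OF slow(1) pq0(1,2)]) (auto simp: upper_half_plane_def)
    finally show ?thesis .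
  qed
  moreover have "Pop \<alpha> h w = 0" if "w \<notin> \<complex>\<^sub>+" for w using that by (simp add: Pop_def bkernel_def)
  ultimately show ?thesis by (simp add: A_iff)
qed

end

section \<open>Bounded functionals evaluated on kernels, and the converse Hoelder inequality\<close>

context bergman_pair
begin

lemma functional_bound:
  assumes "bounded_functional A N L"
  obtains C where "0 \<le> C" "\<And>f. f \<in> A \<Longrightarrow> cmod (L f) \<le> C * N f"
proof -
  obtain C where C: "\<And>f. f \<in> A \<Longrightarrow> cmod (L f) \<le> C * N f"
    using assms unfolding bounded_functional_def by blast
  have "cmod (L f) \<le> max C 0 * N f" if "f \<in> A" for f
    by (rule order_trans[OF C[OF that]]) (intro mult_right_mono N_nonneg, simp)
  then show thesis using that[of "max C 0"] by simp
qed

lemma functional_add: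
  "bounded_functional A N L \<Longrightarrow> f \<in> A \<Longrightarrow> g \<in> A \<Longrightarrow> L (\<lambda>z. f z + g z) = L f + L g"
  unfolding bounded_functional_def by blast

lemma functional_scale:
  "bounded_functional A N L \<Longrightarrow> f \<in> A \<Longrightarrow> L (\<lambda>z. c * f z) = c * L f"
  unfolding bounded_functional_def by blast

lemma functional_diff:
  assumes L: "bounded_functional A N L" and f: "f \<in> A" and g: "g \<in> A"
  shows "L (\<lambda>z. f z - g z) = L f - L g"
proof -
  have "L (\<lambda>z. f z + - 1 * g z) = L f + L (\<lambda>z. - 1 * g z)"
    by (rule functional_add[OF L f A_scale(1)[OF g]])
  also have "L (\<lambda>z. - 1 * g z) = - 1 * L g" by (rule functional_scale[OF L g])
  finally show ?thesis by simp
qed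

lemma functional_sum:
  assumes L: "bounded_functional A N L" and Z: "finite Z" "\<And>\<zeta>. \<zeta> \<in> Z \<Longrightarrow> F \<zeta> \<in> A"
  shows "L (\<lambda>z. \<Sum>\<zeta>\<in>Z. c \<zeta> * F \<zeta> z) = (\<Sum>\<zeta>\<in>Z. c \<zeta> * L (F \<zeta>))"
  using Z
proof (induction Z rule: finite_induct)
  case empty
  have "L (\<lambda>z. 0 * K \<i> z) = 0 * L (K \<i>)"
    by (rule functional_scale[OF L K_in_A]) (simp add: upper_half_plane_def)
  then show ?case by simp
next
  case (insert \<zeta> Z)
  have "L (\<lambda>z. c \<zeta> * F \<zeta> z + (\<Sum>\<zeta>\<in>Z. c \<zeta> * F \<zeta> z)) = L (\<lambda>z. c \<zeta> * F \<zeta> z) + L (\<lambda>z. \<Sum>\<zeta>\<in>Z. c \<zeta> * F \<zeta> z)"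
    using insert by (intro functional_add[OF L] A_scale A_sum) auto
  moreover have "L (\<lambda>z. c \<zeta> * F \<zeta> z) = c \<zeta> * L (F \<zeta>)" using insert by (intro functional_scale[OF L]) auto
  ultimately show ?case using insert by simp
qed

text \<open>Set to 0 off the half-plane, where \<open>K z\<close> need not lie in \<open>A\<close>
  and \<open>L\<close> carries no information.\<close>

definition kernel_value :: "((complex \<Rightarrow> complex) \<Rightarrow> complex) \<Rightarrow> complex \<Rightarrow> complex"
  where "kernel_value L z = (if z \<in> \<complex>\<^sub>+ then L (K z) else 0)"

text \<open>By \<open>bkernel_Lipschitz\<close> the norm of \<open>K z - K z'\<close> is at most
  \<open>D * m0\<close> times the distance, and \<open>L\<close> is bounded.\<close>

lemma kernel_value_Lipschitz:
  assumes L: "bounded_functional A N L" and r: "1 \<le> r"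
  shows "\<exists>E\<ge>0. hbox_Lipschitz r E (kernel_value L)"
proof -
  obtain C where C: "0 \<le> C" "\<And>f. f \<in> A \<Longrightarrow> cmod (L f) \<le> C * N f" using functional_bound[OF L] by blast
  obtain D where D: "0 \<le> D" "\<And>w. w \<in> \<complex>\<^sub>+ \<Longrightarrow> hbox_Lipschitz r (D * kmaj \<alpha> \<i> w) (\<lambda>z. K z w)"
    using bkernel_Lipschitz[OF \<alpha> r] by blast
  have "cmod (kernel_value L z - kernel_value L z') \<le> C * D * m0 * cmod (z - z')"
    if z: "z \<in> hbox r" "z' \<in> hbox r" and d: "cmod (z - z') \<le> 1 / (2 * r)" for z z'
  proof -
    have zz: "z \<in> \<complex>\<^sub>+" "z' \<in> \<complex>\<^sub>+" using z hbox_in_half_plane[OF r] by auto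
    note KA = K_in_A[OF zz(1)] K_in_A[OF zz(2)]
    have "N (\<lambda>w. K z w - K z' w) \<le> D * cmod (z - z') * m0"
    proof (rule N_le_kmaj[OF A_diff[OF KA]])
      fix w assume "w \<in> \<complex>\<^sub>+"
      then show "cmod (K z w - K z' w) \<le> D * cmod (z - z') * kmaj \<alpha> \<i> w"
        using D(2)[of w] z d by (simp add: hbox_Lipschitz_def mult_ac)
    qed (use D(1) in simp)
    then have "C * N (\<lambda>w. K z w - K z' w) \<le> C * (D * cmod (z - z') * m0)" using C(1) by (rule mult_left_mono)
    moreover have "cmod (L (\<lambda>w. K z w - K z' w)) \<le> C * N (\<lambda>w. K z w - K z' w)" by (rule C(2)[OF A_diff[OF KA]])
    ultimately show ?thesis using zz by (simp add: kernel_value_def functional_diff[OF L KA] mult_ac)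
  qed
  moreover have "0 \<le> C * D * m0" using C(1) D(1) by (simp add: m0_def)
  ultimately show ?thesis unfolding hbox_Lipschitz_def by blast
qed

text \<open>The Lipschitz bound is taken on a doubled box, which contains a neighbourhood of the
  point.\<close>

lemma kernel_value_continuous:
  assumes L: "bounded_functional A N L" shows "continuous_on \<complex>\<^sub>+ (kernel_value L)"
  unfolding continuous_on_iff
proof (intro ballI allI impI)
  fix x and e :: real assume x: "x \<in> \<complex>\<^sub>+" and e: "0 < e"
  obtain r where r: "2 \<le> r" "x \<in> hbox r" using hbox_exists[OF x] .
  have r1: "1 \<le> 2 * r" using r by simp
  obtain E where E: "0 \<le> E" "hbox_Lipschitz (2 * r) E (kernel_value L)" using kernel_value_Lipschitz[OF L r1] by blast
  define d where "d = min (1 / (2 * (2 * r))) (e / (E + 1))"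
  have d0: "0 < d" using r e E by (simp add: d_def)
  have "dist (kernel_value L x') (kernel_value L x) < e" if "dist x' x < d" for x'
  proof -
    have x': "cmod (x - x') \<le> 1 / (2 * (2 * r))" "cmod (x - x') < e / (E + 1)"
      using that by (auto simp: d_def dist_norm norm_minus_commute)
    have "1 / (2 * (2 * r)) \<le> 1 / (2 * r)" using r by (intro frac_le) auto
    then have "x' \<in> hbox (2 * r)" using x' r by (intro hbox_nbhd[of r x]) auto
    moreover have "x \<in> hbox (2 * r)" using r hbox_mono[of r "2 * r"] by auto
    ultimately have "cmod (kernel_value L x - kernel_value L x') \<le> E * cmod (x - x')"
      using E(2) x' by (simp add: hbox_Lipschitz_def)
    also have "\<dots> \<le> (E + 1) * cmod (x - x')" by (intro mult_right_mono) auto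
    also have "\<dots> < e" using x'(2) E(1) by (simp add: pos_less_divide_eq mult.commute)
    finally show ?thesis by (simp add: dist_norm norm_minus_commute)
  qed
  with d0 show "\<exists>d>0. \<forall>x'\<in>\<complex>\<^sub>+. dist x' x < d \<longrightarrow> dist (kernel_value L x') (kernel_value L x) < e" by blast
qed

lemma continuous_zero_ext_measurable:
  fixes f :: "complex \<Rightarrow> complex"
  assumes "continuous_on \<complex>\<^sub>+ f" "\<And>z. z \<notin> \<complex>\<^sub>+ \<Longrightarrow> f z = 0"
  shows "f \<in> borel_measurable borel"
proof -
  have "(\<lambda>z. indicator \<complex>\<^sub>+ z *\<^sub>R f z) \<in> borel_measurable borel"
    by (intro borel_measurable_continuous_on_indicator assms) simp
  also have "(\<lambda>z. indicator \<complex>\<^sub>+ z *\<^sub>R f z) = f" using assms by (auto simp: indicator_def)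
  finally show ?thesis .
qed

lemma kernel_value_measurable: "bounded_functional A N L \<Longrightarrow> kernel_value L \<in> borel_measurable borel"
  by (rule continuous_zero_ext_measurable[OF kernel_value_continuous]) (auto simp: kernel_value_def)

lemma continuous_bounded_on_hbox:
  fixes f :: "complex \<Rightarrow> complex"
  assumes "continuous_on \<complex>\<^sub>+ f" "1 \<le> r" obtains B where "\<And>z. z \<in> hbox r \<Longrightarrow> cmod (f z) \<le> B"
proof -
  have "continuous_on (hbox r) f" by (rule continuous_on_subset[OF assms(1) hbox_subset[OF assms(2)]])
  then have "bounded (f ` hbox r)" by (intro compact_imp_bounded compact_continuous_image compact_hbox)
  then show thesis using that by (auto simp: bounded_iff)
qed

text \<open>One finite kernel sum approximates \<open>Pop \<alpha> h\<close> in norm, while the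
  corresponding sum of the values of \<open>L\<close> approximates the integral; so both sides agree
  up to an arbitrarily small error.\<close>

lemma functional_Pop:
  assumes L: "bounded_functional A N L"
    and h: "integrable (dV \<alpha>) h" and supp: "\<forall>z. z \<notin> hbox r \<longrightarrow> h z = 0" and r: "1 \<le> r"
  shows "L (Pop \<alpha> h) = (\<integral>z. h z * kernel_value L z \<partial>dV \<alpha>)"
proof -
  obtain C where C: "0 \<le> C" "\<And>f. f \<in> A \<Longrightarrow> cmod (L f) \<le> C * N f" using functional_bound[OF L] by blast
  obtain B where B: "\<And>z. z \<in> hbox r \<Longrightarrow> cmod (kernel_value L z) \<le> B"
    using continuous_bounded_on_hbox[OF kernel_value_continuous[OF L] r] by blast
  have int: "integrable (dV \<alpha>) (\<lambda>z. h z * kernel_value L z)"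
    by (rule integrable_mult_bounded_on_hbox[OF h supp kernel_value_measurable[OF L] B])
  have r2: "1 \<le> 2 * r" using r by simp
  obtain E where E: "0 \<le> E" "hbox_Lipschitz (2 * r) E (kernel_value L)" using kernel_value_Lipschitz[OF L r2] by blast
  note PA = Pop_in_A[OF h supp r]
  have le: "cmod (L (Pop \<alpha> h) - (\<integral>z. h z * kernel_value L z \<partial>dV \<alpha>)) \<le> e * (C * m0 + E)" if e: "0 < e" for e
  proof -
    obtain Z c where Z: "finite Z" "Z \<subseteq> hbox (2 * r)"
      and 1: "\<And>w. w \<in> \<complex>\<^sub>+ \<Longrightarrow> cmod (Pop \<alpha> h w - (\<Sum>\<zeta>\<in>Z. c \<zeta> * K \<zeta> w)) \<le> e * kmaj \<alpha> \<i> w"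
      and 2: "\<forall>G E. integrable (dV \<alpha>) (\<lambda>z. h z * G z) \<longrightarrow> 0 \<le> E \<longrightarrow> hbox_Lipschitz (2 * r) E G \<longrightarrow>
        cmod ((\<integral>z. h z * G z \<partial>dV \<alpha>) - (\<Sum>\<zeta>\<in>Z. c \<zeta> * G \<zeta>)) \<le> e * E"
      using Pop_approx[OF h supp r e] by blast
    have KA: "K \<zeta> \<in> A" "\<zeta> \<in> \<complex>\<^sub>+" if "\<zeta> \<in> Z" for \<zeta>
      using that Z hbox_in_half_plane[OF r2] K_in_A by blast+
    have SA: "(\<lambda>w. \<Sum>\<zeta>\<in>Z. c \<zeta> * K \<zeta> w) \<in> A" using KA Z by (intro A_sum) auto
    have "L (\<lambda>w. Pop \<alpha> h w - (\<Sum>\<zeta>\<in>Z. c \<zeta> * K \<zeta> w)) = L (Pop \<alpha> h) - (\<Sum>\<zeta>\<in>Z. c \<zeta> * L (K \<zeta>))"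
      unfolding functional_diff[OF L PA SA] using KA Z by (simp add: functional_sum[OF L])
    moreover have "(\<Sum>\<zeta>\<in>Z. c \<zeta> * L (K \<zeta>)) = (\<Sum>\<zeta>\<in>Z. c \<zeta> * kernel_value L \<zeta>)"
      using KA by (intro sum.cong) (auto simp: kernel_value_def)
    ultimately have eq: "L (\<lambda>w. Pop \<alpha> h w - (\<Sum>\<zeta>\<in>Z. c \<zeta> * K \<zeta> w)) = L (Pop \<alpha> h) - (\<Sum>\<zeta>\<in>Z. c \<zeta> * kernel_value L \<zeta>)"
      by (simp only:)
    have "cmod (L (\<lambda>w. Pop \<alpha> h w - (\<Sum>\<zeta>\<in>Z. c \<zeta> * K \<zeta> w))) \<le> C * (e * m0)"
    proof (rule order_trans[OF C(2)[OF A_diff[OF PA SA]]])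
      show "C * N (\<lambda>w. Pop \<alpha> h w - (\<Sum>\<zeta>\<in>Z. c \<zeta> * K \<zeta> w)) \<le> C * (e * m0)"
        using e 1 C(1) by (intro mult_left_mono N_le_kmaj A_diff PA SA) auto
    qed
    moreover have "cmod ((\<integral>z. h z * kernel_value L z \<partial>dV \<alpha>) - (\<Sum>\<zeta>\<in>Z. c \<zeta> * kernel_value L \<zeta>)) \<le> e * E"
      using 2 int E by blast
    ultimately show ?thesis
      unfolding eq using norm_triangle_ineq4[of "L (Pop \<alpha> h) - (\<Sum>\<zeta>\<in>Z. c \<zeta> * kernel_value L \<zeta>)"
          "(\<integral>z. h z * kernel_value L z \<partial>dV \<alpha>) - (\<Sum>\<zeta>\<in>Z. c \<zeta> * kernel_value L \<zeta>)"] by (simp add: algebra_simps)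
  qed
  define c where "c = C * m0 + E"
  have c: "0 \<le> c" using C(1) E(1) by (simp add: c_def m0_def)
  have "cmod (L (Pop \<alpha> h) - (\<integral>z. h z * kernel_value L z \<partial>dV \<alpha>)) \<le> 0 + e" if "0 < e" for e
  proof -
    have "cmod (L (Pop \<alpha> h) - (\<integral>z. h z * kernel_value L z \<partial>dV \<alpha>)) \<le> e / (c + 1) * c"
      unfolding c_def by (rule le) (use that c in \<open>simp add: c_def add_nonneg_pos\<close>)
    also have "\<dots> \<le> e / (c + 1) * (c + 1)" using that c by (intro mult_left_mono) auto
    also have "\<dots> = e" using c by simp
    finally show ?thesis by simp
  qed
  then have "cmod (L (Pop \<alpha> h) - (\<integral>z. h z * kernel_value L z \<partial>dV \<alpha>)) \<le> 0" by (rule field_le_epsilon)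
  then show ?thesis by simp
qed

text \<open>Test against \<open>h = g |g|\<^sup>p\<^sup>'\<^sup>-\<^sup>2 G\<^sup>q\<^sup>'\<^sup>-\<^sup>p\<^sup>' \<Omega>'\<close> cut off to a box, where \<open>G(y)\<close> is the norm of the slice
  of the cut-off \<open>g\<close> at height \<open>y\<close>; below \<open>a(y) = G(y)\<^sup>p\<^sup>'\<close>.\<close>

lemma converse_Hoelder:
  assumes g: "continuous_on \<complex>\<^sub>+ g" and g0: "\<And>z. z \<notin> \<complex>\<^sub>+ \<Longrightarrow> g z = 0"
    and test: "\<And>r h. 1 \<le> r \<Longrightarrow> integrable (dV \<alpha>) h \<Longrightarrow> \<forall>z. z \<notin> hbox r \<longrightarrow> h z = 0 \<Longrightarrow>
      ennreal (cmod (\<integral>z. h z * cnj (g z) \<partial>dV \<alpha>)) \<le> ennreal D * cnorm h"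
  shows "cnorm' g \<le> ennreal D"
proof -
  have [measurable]: "g \<in> borel_measurable borel" by (rule continuous_zero_ext_measurable[OF g g0])
  define gn where "gn n z = cmod (g z) * indicator (hbox (real n)) z" for n z
  have gn_meas [measurable]: "gn n \<in> borel_measurable borel" for n unfolding gn_def by measurable
  have gn0: "0 \<le> gn n z" for n z by (simp add: gn_def)
  have bound: "mixed_norm p' q' \<Omega>' \<alpha> (\<lambda>z. ennreal (gn n z)) \<le> ennreal D" if n: "1 \<le> n" for n
  proof -
    \<comment> \<open>The cut-off makes \<open>Y\<close> finite, which permits the division by a
      power of \<open>Y\<close> at the end.\<close>
    define Y where "Y = mixed_norm p' q' \<Omega>' \<alpha> (\<lambda>z. ennreal (gn n z))"
    have r: "1 \<le> real n" using n by simp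
    obtain B where B: "\<And>z. z \<in> hbox (real n) \<Longrightarrow> cmod (g z) \<le> B" using continuous_bounded_on_hbox[OF g r] by blast
    have B': "cmod (g z) \<le> max B 0" if "z \<in> hbox (real n)" for z using B[OF that] by simp
    have gnB: "ennreal (gn n z) \<le> ennreal (max B 0) * indicator (hbox (real n)) z" for z
      using B' by (auto simp: gn_def indicator_def intro!: ennreal_leI)
    have "Y \<le> mixed_norm p' q' \<Omega>' \<alpha> (\<lambda>z. ennreal (max B 0) * indicator (hbox (real n)) z)"
      unfolding Y_def using gnB by (intro mixed_norm_mono[OF slow(2) pq0(3,4)])
    also have "\<dots> = ennreal (max B 0) * mixed_norm p' q' \<Omega>' \<alpha> (indicator (hbox (real n)))"
      by (rule mixed_norm_cmult[OF pq0(3,4)]) measurable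
    also have "\<dots> < top"
      using mixed_norm_hbox_finite[OF slow(2) pq' r] by (simp add: ennreal_mult_less_top)
    finally have Y: "Y < top" .
    define a where "a y = (\<integral>\<^sup>+ x. ennreal (gn n (Complex x y) powr p') \<partial>lborel)" for y
    have [measurable]: "a \<in> borel_measurable borel" unfolding a_def by measurable
    define ar where "ar y = enn2real (a y)" for y
    have [measurable]: "ar \<in> borel_measurable borel" unfolding ar_def by measurable
    have ar: "a y = ennreal (ar y)" "0 \<le> ar y" for y
    proof -
      have "a y \<le> (\<integral>\<^sup>+ x. ennreal (max B 0 powr p') * indicator {- real n..real n} x \<partial>lborel)"
        unfolding a_def
      proof (rule nn_integral_mono)
        fix x :: real
        show "ennreal (gn n (Complex x y) powr p') \<le> ennreal (max B 0 powr p') * indicator {- real n..real n} x"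
        proof (cases "Complex x y \<in> hbox (real n)")
          case True
          then have "x \<in> {- real n..real n}" by (auto simp: hbox_def)
          then show ?thesis using True B'[OF True] pq0 by (auto simp: gn_def intro!: ennreal_leI powr_mono2)
        qed (simp add: gn_def)
      qed
      also have "\<dots> < top" by (simp add: nn_integral_cmult_indicator ennreal_mult_less_top)
      finally show "a y = ennreal (ar y)" "0 \<le> ar y" by (simp_all add: ar_def)
    qed
    define W where "W y = indicator {0<..} y * (\<Omega>' y * y powr 0)" for y
    have [measurable]: "W \<in> borel_measurable borel" unfolding W_def by (rule slow_weight_measurable[OF slow(2)])
    have W0: "0 \<le> W y" for y using slow_weight_pos[OF slow(2), of y] by (auto simp: W_def indicator_def less_imp_le)
    have WY: "W y = \<Omega>' y" "0 < \<Omega>' y" if "0 < y" for y using that slow_weight_pos[OF slow(2), of y] by (auto simp: W_def)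
    \<comment> \<open>In terms of \<open>G\<close> this is the exponent \<open>q' - p'\<close>,
      since \<open>ar y\<close> is \<open>G y\<close> to the power \<open>p'\<close>.\<close>
    define e where "e = q' / p' - 1"
    have are: "ar y * ar y powr e = ar y powr (q' / p')" for y using ar(2)[of y] by (simp add: powr_mult_base e_def)
    \<comment> \<open>For \<open>p' < 2\<close> the exponent \<open>p' - 2\<close> is negative;
      where \<open>gn\<close> vanishes \<open>h\<close> is 0 all the same, because
      \<open>0 powr x = 0\<close>.\<close>
    define h where "h z = g z * of_real (gn n z powr (p' - 2) * (ar (Im z) powr e * W (Im z)))" for z
    have [measurable]: "h \<in> borel_measurable borel" unfolding h_def by measurable
    have supp: "h z = 0" if "z \<notin> hbox (real n)" for z using that by (simp add: h_def gn_def)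
    have ch: "cmod (h z) = gn n z powr (p' - 1) * (ar (Im z) powr e * W (Im z))" for z
    proof (cases "z \<in> hbox (real n)")
      case True
      then have "cmod (g z) = gn n z" by (simp add: gn_def)
      then have "cmod (h z) = (gn n z * gn n z powr (p' - 2)) * (ar (Im z) powr e * W (Im z))"
        using W0 by (simp add: h_def norm_mult abs_mult)
      then show ?thesis using gn0 by (simp add: powr_mult_base)
    qed (simp add: supp gn_def)
    define \<phi> where "\<phi> z = gn n z powr p' * (ar (Im z) powr e * W (Im z))" for z
    have [measurable]: "\<phi> \<in> borel_measurable borel" unfolding \<phi>_def by measurable
    have \<phi>0: "0 \<le> \<phi> z" for z using W0 by (simp add: \<phi>_def)
    have h\<phi>: "h z * cnj (g z) = of_real (\<phi> z)" for z
    proof (cases "z \<in> hbox (real n)")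
      case True
      then have "cmod (g z) = gn n z" by (simp add: gn_def)
      then have "g z * cnj (g z) = of_real (gn n z * gn n z)"
        by (simp add: complex_norm_square[symmetric] power2_eq_square flip: of_real_mult)
      then have "h z * cnj (g z) = of_real ((gn n z * (gn n z * gn n z powr (p' - 2))) * (ar (Im z) powr e * W (Im z)))"
        by (simp add: h_def mult_ac)
      then show ?thesis using gn0 by (simp add: powr_mult_base \<phi>_def)
    qed (simp add: supp gn_def \<phi>_def)
    have YX: "ennreal_powr Y q' = (\<integral>\<^sup>+ y\<in>{0<..}. ennreal (ar y powr (q' / p')) * ennreal (\<Omega>' y * y powr \<alpha>) \<partial>lborel)"
    proof -
      have "enorm p' lborel (\<lambda>x. ennreal (gn n (Complex x y))) = ennreal (ar y powr (1 / p'))" for y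
        using ar[of y] gn0 by (simp add: enorm_def ennreal_powr_ennreal flip: a_def)
      then have "ennreal_powr Y q' = (\<integral>\<^sup>+ y. ennreal (ar y powr (q' / p')) \<partial>wmeasure \<Omega>' \<alpha>)"
        using pq0 by (simp add: Y_def mixed_norm_def enorm_powr ennreal_powr_ennreal powr_powr)
      then show ?thesis by (simp add: nn_integral_wmeasure[OF slow(2)])
    qed
    \<comment> \<open>The extremal case of Hoelder: the pairing of \<open>h\<close> with
      \<open>g\<close> and the \<open>q\<close>-th power of the norm of \<open>h\<close> (in
      \<open>X2\<close>) both equal the \<open>q'\<close>-th power of \<open>Y\<close>.\<close>
    have X1: "(\<integral>\<^sup>+ z. ennreal (\<phi> z) \<partial>dV \<alpha>) = ennreal_powr Y q'"
    proof -
      have "(\<integral>\<^sup>+ z. ennreal (\<phi> z) \<partial>dV \<alpha>) = (\<integral>\<^sup>+ y\<in>{0<..}. (\<integral>\<^sup>+ x. ennreal (\<phi> (Complex x y)) \<partial>lborel) * ennreal (y powr \<alpha>) \<partial>lborel)"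
        by (rule nn_integral_dV) measurable
      also have "\<dots> = (\<integral>\<^sup>+ y\<in>{0<..}. ennreal (ar y powr (q' / p')) * ennreal (\<Omega>' y * y powr \<alpha>) \<partial>lborel)"
      proof (rule nn_integral_cong)
        fix y :: real
        have "(\<integral>\<^sup>+ x. ennreal (\<phi> (Complex x y)) \<partial>lborel) = (\<integral>\<^sup>+ x. ennreal (gn n (Complex x y) powr p') * ennreal (ar y powr e * W y) \<partial>lborel)"
          using W0 by (intro nn_integral_cong) (simp add: \<phi>_def ennreal_mult)
        also have "\<dots> = a y * ennreal (ar y powr e * W y)"
          unfolding a_def by (rule nn_integral_multc) measurable
        also have "\<dots> = ennreal (ar y powr (q' / p') * W y)"
          using ar W0 by (simp add: are mult.assoc[symmetric] flip: ennreal_mult)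
        finally show "(\<integral>\<^sup>+ x. ennreal (\<phi> (Complex x y)) \<partial>lborel) * ennreal (y powr \<alpha>) * indicator {0<..} y
          = ennreal (ar y powr (q' / p')) * ennreal (\<Omega>' y * y powr \<alpha>) * indicator {0<..} y"
          using WY[of y] by (cases "0 < y") (auto simp: ennreal_mult mult.assoc)
      qed
      finally show ?thesis using YX by simp
    qed
    have X2: "ennreal_powr (cnorm h) q = ennreal_powr Y q'"
    proof -
      have slice: "ennreal_powr (enorm p lborel (\<lambda>x. ennreal (cmod (h (Complex x y))))) q = ennreal (ar y powr (q / p) * (ar y powr e * W y) powr q)" for y
      proof -
        have "(\<integral>\<^sup>+ x. ennreal_powr (ennreal (cmod (h (Complex x y)))) p \<partial>lborel)
          = (\<integral>\<^sup>+ x. ennreal (gn n (Complex x y) powr p') * ennreal ((ar y powr e * W y) powr p) \<partial>lborel)"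
        proof (rule nn_integral_cong)
          fix x :: real
          have "cmod (h (Complex x y)) powr p = gn n (Complex x y) powr p' * (ar y powr e * W y) powr p"
            unfolding ch using W0 by (simp add: powr_mult powr_powr exponents(1))
          then show "ennreal_powr (ennreal (cmod (h (Complex x y)))) p = ennreal (gn n (Complex x y) powr p') * ennreal ((ar y powr e * W y) powr p)"
            by (simp add: ennreal_powr_ennreal flip: ennreal_mult)
        qed
        also have "\<dots> = a y * ennreal ((ar y powr e * W y) powr p)"
          unfolding a_def by (rule nn_integral_multc) measurable
        also have "\<dots> = ennreal (ar y * (ar y powr e * W y) powr p)" using ar by (simp add: ennreal_mult)
        finally show ?thesis
          using ar(2)[of y] W0[of y] pq0 by (simp add: enorm_def ennreal_powr_powr ennreal_powr_ennreal powr_mult powr_powr)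
      qed
      have "ennreal_powr (cnorm h) q = (\<integral>\<^sup>+ y. ennreal (ar y powr (q / p) * (ar y powr e * W y) powr q) \<partial>wmeasure \<Omega> \<alpha>)"
        using pq0 by (simp add: mixed_norm_def enorm_powr slice)
      also have "\<dots> = (\<integral>\<^sup>+ y\<in>{0<..}. ennreal (ar y powr (q / p) * (ar y powr e * W y) powr q) * ennreal (\<Omega> y * y powr \<alpha>) \<partial>lborel)"
        by (rule nn_integral_wmeasure[OF slow(1)]) measurable
      also have "\<dots> = (\<integral>\<^sup>+ y\<in>{0<..}. ennreal (ar y powr (q' / p')) * ennreal (\<Omega>' y * y powr \<alpha>) \<partial>lborel)"
      proof (rule nn_integral_cong)
        fix y :: real
        show "ennreal (ar y powr (q / p) * (ar y powr e * W y) powr q) * ennreal (\<Omega> y * y powr \<alpha>) * indicator {0<..} y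
           = ennreal (ar y powr (q' / p')) * ennreal (\<Omega>' y * y powr \<alpha>) * indicator {0<..} y"
        proof (cases "0 < y")
          case True
          have \<Omega>0: "0 < \<Omega> y" using slow_weight_pos[OF slow(1) True] .
          have "ar y powr (q / p) * ar y powr (e * q) = ar y powr (q' / p')"
            using exponents(2) by (simp add: e_def flip: powr_add)
          moreover have "\<Omega>' y powr q * \<Omega> y = \<Omega>' y"
          proof -
            have "(1 - q') * q + 1 = 1 - q'" using exponents(3) by (simp add: algebra_simps)
            then have "\<Omega> y powr ((1 - q') * q) * \<Omega> y powr 1 = \<Omega> y powr (1 - q')" by (simp only: powr_add[symmetric])
            then show ?thesis using \<Omega>0 by (simp add: dual_weight[OF True] powr_powr)
          qed
          moreover have "ar y powr (q / p) * (ar y powr e * W y) powr q * (\<Omega> y * y powr \<alpha>)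
             = (ar y powr (q / p) * ar y powr (e * q)) * ((\<Omega>' y powr q * \<Omega> y) * y powr \<alpha>)"
            using WY[OF True] by (simp add: powr_mult powr_powr mult_ac)
          ultimately have "ar y powr (q / p) * (ar y powr e * W y) powr q * (\<Omega> y * y powr \<alpha>) = ar y powr (q' / p') * (\<Omega>' y * y powr \<alpha>)"
            by simp
          then show ?thesis using True \<Omega>0 WY[OF True] by (simp flip: ennreal_mult)
        qed simp
      qed
      finally show ?thesis using YX by simp
    qed
    then have cnh: "cnorm h = ennreal_powr Y (q' / q)"
      using pq0 ennreal_powr_powr[of "cnorm h" q "1 / q"] by (simp add: ennreal_powr_powr)
    have "integrable (dV \<alpha>) h"
    proof (rule integrableI_bounded)
      have "(\<integral>\<^sup>+ z. ennreal (norm (h z)) \<partial>dV \<alpha>) = (\<integral>\<^sup>+ z. ennreal (cmod (h z)) * indicator (hbox (real n)) z \<partial>dV \<alpha>)"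
        using supp by (intro nn_integral_cong) (auto simp: indicator_def)
      also have "\<dots> \<le> cnorm h * mixed_norm p' q' \<Omega>' \<alpha> (indicator (hbox (real n)))"
        by (rule mixed_norm_Hoelder[OF slow dual_weight pq]) measurable
      also have "\<dots> < \<infinity>"
        using mixed_norm_hbox_finite[OF slow(2) pq' r] Y by (simp add: cnh ennreal_mult_less_top)
      finally show "(\<integral>\<^sup>+ z. ennreal (norm (h z)) \<partial>dV \<alpha>) < \<infinity>" .
    qed simp
    from test[OF r this] supp have "ennreal (cmod (\<integral>z. h z * cnj (g z) \<partial>dV \<alpha>)) \<le> ennreal D * cnorm h" by blast
    moreover have "ennreal (cmod (\<integral>z. h z * cnj (g z) \<partial>dV \<alpha>)) = ennreal_powr Y q'"
    proof -
      have "integrable (dV \<alpha>) \<phi>"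
        using X1 Y \<phi>0 by (intro integrableI_nonneg) auto
      then have "(\<integral>\<^sup>+ z. ennreal (\<phi> z) \<partial>dV \<alpha>) = ennreal (\<integral>z. \<phi> z \<partial>dV \<alpha>)"
        using \<phi>0 by (intro nn_integral_eq_integral) auto
      moreover have "0 \<le> (\<integral>z. \<phi> z \<partial>dV \<alpha>)" using \<phi>0 by simp
      ultimately show ?thesis using X1 by (simp add: h\<phi>)
    qed
    \<comment> \<open>As \<open>q' - q' / q = 1\<close>, dividing by the power \<open>q' / q\<close>
      of a finite positive \<open>Y\<close> leaves \<open>Y \<le> D\<close>.\<close>
    ultimately have le: "ennreal_powr Y q' \<le> ennreal D * ennreal_powr Y (q' / q)" using cnh by simp
    show "Y \<le> ennreal D"
    proof (cases "Y = 0")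
      case False
      then obtain y where y: "Y = ennreal y" "0 < y" using Y by (cases Y) (auto simp: less_le)
      have D0: "0 \<le> D"
        using le y by (cases "0 \<le> D") (auto simp: ennreal_neg ennreal_powr_ennreal)
      have "y powr q' \<le> D * y powr (q' / q)" using le y D0 by (simp add: ennreal_powr_ennreal flip: ennreal_mult)
      moreover have "y powr q' = y * y powr (q' / q)"
        using exponents(4) y powr_add[of y 1 "q' / q"] by (simp add: algebra_simps)
      ultimately have "y \<le> D" using y by simp
      then show ?thesis using y by (simp add: ennreal_leI)
    qed simp
  qed
  \<comment> \<open>The index starts at 1 because the bound and the monotonicity of boxes need
    \<open>1 \<le> n\<close>.\<close>
  have "(\<lambda>n. mixed_norm p' q' \<Omega>' \<alpha> (\<lambda>z. ennreal (gn (Suc n) z))) \<longlonglongrightarrow> cnorm' g"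
  proof (rule mixed_norm_LIMSEQ[OF pq0(3,4)])
    show "incseq (\<lambda>n z. ennreal (gn (Suc n) z))"
    proof (intro incseq_SucI le_funI ennreal_leI)
      fix n z
      show "gn (Suc n) z \<le> gn (Suc (Suc n)) z"
        using hbox_mono[of "real (Suc n)" "real (Suc (Suc n))"] by (auto simp: gn_def indicator_def)
    qed
    show "(\<lambda>n. ennreal (gn (Suc n) z)) \<longlonglongrightarrow> ennreal (cmod (g z))" for z
    proof (cases "z \<in> \<complex>\<^sub>+")
      case True
      have "\<forall>\<^sub>F n in sequentially. z \<in> hbox (real (Suc n))"
        using eventually_in_hbox[OF True] by (rule eventually_compose_filterlim) (rule filterlim_Suc)
      then have "\<forall>\<^sub>F n in sequentially. ennreal (gn (Suc n) z) = ennreal (cmod (g z))"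
        by eventually_elim (simp add: gn_def)
      then show ?thesis by (rule tendsto_eventually)
    qed (simp add: gn_def g0)
  qed simp
  then show ?thesis by (rule LIMSEQ_le_const2) (use bound in auto)
qed

end

section \<open>The pairing and the representation of bounded functionals\<close>

context bergman_pair
begin

abbreviation "N' \<equiv> bergman_norm p' q' \<Omega>' \<alpha>"

lemma A'_iff: "g \<in> A' \<longleftrightarrow> g holomorphic_on \<complex>\<^sub>+ \<and> (\<forall>z. z \<notin> \<complex>\<^sub>+ \<longrightarrow> g z = 0) \<and> cnorm' g < top"
  using bergman_iff[OF slow(2) pq0(3,4)] .

lemma N'_eq: "g \<in> A' \<Longrightarrow> ennreal (N' g) = cnorm' g"
  by (rule bergman_norm_eq[OF slow(2) pq0(3,4)])

lemma pairing_integrable: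
  assumes f: "f \<in> A" and g: "g \<in> A'" shows "integrable (dV \<alpha>) (\<lambda>z. f z * cnj (g z))"
  using bergman_measurable[OF f] bergman_measurable[OF g] f g unfolding A_iff A'_iff
  by (intro bergman_pairing_integrable[OF slow dual_weight pq]) auto

lemma pairing_le:
  assumes f: "f \<in> A" and g: "g \<in> A'" shows "cmod (pairing \<alpha> f g) \<le> N f * N' g"
proof -
  note [measurable] = bergman_measurable[OF f] bergman_measurable[OF g]
  have "ennreal (cmod (pairing \<alpha> f g)) \<le> (\<integral>\<^sup>+ z. ennreal (cmod (f z * cnj (g z))) \<partial>dV \<alpha>)"
    unfolding pairing_def by (rule integral_norm_bound_ennreal[OF pairing_integrable[OF f g]])
  also have "\<dots> = (\<integral>\<^sup>+ z. ennreal (cmod (f z)) * ennreal (cmod (g z)) \<partial>dV \<alpha>)"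
    by (simp add: norm_mult ennreal_mult)
  also have "\<dots> \<le> cnorm f * cnorm' g" by (rule mixed_norm_Hoelder[OF slow dual_weight pq]) auto
  also have "\<dots> = ennreal (N f * N' g)"
    by (simp add: N_eq[OF f, symmetric] N'_eq[OF g, symmetric] ennreal_mult N_nonneg bergman_norm_def)
  finally show ?thesis by (subst (asm) ennreal_le_iff) (simp_all add: N_nonneg bergman_norm_def)
qed

lemma pairing_functional:
  assumes g: "g \<in> A'" shows "bounded_functional A N (\<lambda>f. pairing \<alpha> f g)"
  unfolding bounded_functional_def
proof (intro conjI ballI allI exI)
  fix f1 f2 assume "f1 \<in> A" "f2 \<in> A"
  then show "pairing \<alpha> (\<lambda>z. f1 z + f2 z) g = pairing \<alpha> f1 g + pairing \<alpha> f2 g"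
    using pairing_integrable g by (simp add: pairing_def distrib_right)
next
  fix c f assume "f \<in> A"
  show "pairing \<alpha> (\<lambda>z. c * f z) g = c * pairing \<alpha> f g"
    by (simp add: pairing_def mult.assoc)
next
  fix f assume "f \<in> A"
  then show "cmod (pairing \<alpha> f g) \<le> N' g * N f" using pairing_le[OF _ g] by (simp add: mult.commute)
qed

text \<open>The conjugated reproducing formula for \<open>g\<close>, obtained from the swapped
  pair.\<close>

lemma pairing_kernel:
  assumes g: "g \<in> A'" and w: "w \<in> \<complex>\<^sub>+" shows "pairing \<alpha> (K w) g = cnj (g w)"
proof -
  interpret swap: bergman_pair p' q' p q \<alpha> \<Omega>' \<Omega> by (rule swap)
  have "(\<integral>z. g z * K z w \<partial>dV \<alpha>) = g w"
    by (rule bergman_reproducing(2)[OF swap.slow swap.dual_weight swap.pq \<alpha> g w])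
  then have e: "cnj (\<integral>z. g z * K z w \<partial>dV \<alpha>) = cnj (g w)" by simp
  have "K w z * cnj (g z) = cnj (g z * K z w)" for z
  proof (cases "z \<in> \<complex>\<^sub>+")
    case True
    then have "cnj (K z w) = K w z" using w by (intro cnj_bkernel)
    then show ?thesis by (simp add: mult.commute)
  qed (use g in \<open>simp add: A'_iff\<close>)
  then have "pairing \<alpha> (K w) g = (\<integral>z. cnj (g z * K z w) \<partial>dV \<alpha>)" unfolding pairing_def by (simp only:)
  also have "\<dots> = cnj (\<integral>z. g z * K z w \<partial>dV \<alpha>)" by (rule Bochner_Integration.integral_cnj)
  finally show ?thesis unfolding e .
qed

lemma cutoff_integrable:
  fixes g :: "complex \<Rightarrow> complex"
  assumes g: "continuous_on \<complex>\<^sub>+ g" "\<And>z. z \<notin> \<complex>\<^sub>+ \<Longrightarrow> g z = 0" and r: "2 \<le> r"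
  shows "integrable (dV \<alpha>) (\<lambda>z. g z * indicator (hbox r) z)"
proof -
  have r1: "1 \<le> r" using r by simp
  obtain B where B: "\<And>z. z \<in> hbox r \<Longrightarrow> cmod (g z) \<le> B" using continuous_bounded_on_hbox[OF g(1) r1] by blast
  have "integrable (dV \<alpha>) (\<lambda>z. complex_of_real (indicator (hbox r) z))"
    using emeasure_hbox(2)[OF r, of \<alpha>] by (intro integrable_of_real integrable_real_indicator) auto
  from integrable_mult_bounded_on_hbox[OF this _ continuous_zero_ext_measurable[OF g] B, of r]
  show ?thesis by (simp add: mult.commute of_real_indicator)
qed

text \<open>The norm bound must come first, while \<open>g\<close> is only known to be continuous:
  it makes the integral against \<open>g\<close> exist, and this in turn yields the formula for
  \<open>L\<close> and then the holomorphy of \<open>g\<close>. The bound \<open>CP\<close> of the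
  projection is a parameter, so that the constant \<open>C * CP\<close> is uniform in
  \<open>L\<close>.\<close>

lemma representation:
  assumes L: "bounded_functional A N L" and C: "0 \<le> C" "\<And>f. f \<in> A \<Longrightarrow> cmod (L f) \<le> C * N f"
    and CP: "0 < CP" "\<And>h. h \<in> borel_measurable borel \<Longrightarrow> cnorm (Pop \<alpha> h) \<le> ennreal CP * cnorm h"
  shows "\<exists>g\<in>A'. (\<forall>f\<in>A. L f = pairing \<alpha> f g) \<and> N' g \<le> C * CP"
proof -
  define k where "k = kernel_value L"
  define g where "g z = cnj (k z)" for z
  have k_cont: "continuous_on \<complex>\<^sub>+ k" unfolding k_def by (rule kernel_value_continuous[OF L])
  have k0: "k z = 0" if "z \<notin> \<complex>\<^sub>+" for z using that by (simp add: k_def kernel_value_def)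
  have g_cont: "continuous_on \<complex>\<^sub>+ g" unfolding g_def by (intro continuous_intros k_cont)
  have g0: "g z = 0" if "z \<notin> \<complex>\<^sub>+" for z using that by (simp add: g_def k0)
  have [measurable]: "k \<in> borel_measurable borel" "g \<in> borel_measurable borel"
    using continuous_zero_ext_measurable[OF k_cont k0] continuous_zero_ext_measurable[OF g_cont g0] by auto
  have norm_g: "cnorm' g \<le> ennreal (C * CP)"
  proof (rule converse_Hoelder[OF g_cont g0])
    fix r :: real and h :: "complex \<Rightarrow> complex" assume r: "1 \<le> r" and h: "integrable (dV \<alpha>) h" and supp: "\<forall>z. z \<notin> hbox r \<longrightarrow> h z = 0"
    have [measurable]: "h \<in> borel_measurable borel" using borel_measurable_integrable[OF h] by simp
    note PA = Pop_in_A[OF h supp r]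
    have "(\<integral>z. h z * cnj (g z) \<partial>dV \<alpha>) = L (Pop \<alpha> h)"
      using functional_Pop[OF L h supp r] by (simp add: g_def k_def)
    then have "ennreal (cmod (\<integral>z. h z * cnj (g z) \<partial>dV \<alpha>)) \<le> ennreal (C * N (Pop \<alpha> h))"
      using C(2)[OF PA] by (simp add: ennreal_leI)
    also have "\<dots> = ennreal C * cnorm (Pop \<alpha> h)" using C(1) by (simp add: ennreal_mult N_nonneg N_eq[OF PA])
    also have "\<dots> \<le> ennreal C * (ennreal CP * cnorm h)" by (intro mult_left_mono CP(2)) auto
    also have "\<dots> = ennreal (C * CP) * cnorm h" using C(1) CP(1) by (simp add: ennreal_mult mult.assoc)
    finally show "ennreal (cmod (\<integral>z. h z * cnj (g z) \<partial>dV \<alpha>)) \<le> ennreal (C * CP) * cnorm h" .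
  qed
  then have norm_k: "cnorm' k < top" "cnorm' g < top" by (auto simp: g_def le_less_trans)
  have ind_lim: "(\<lambda>n. indicator (hbox (real (n + 2))) z) \<longlonglongrightarrow> (1 :: complex)" if "z \<in> \<complex>\<^sub>+" for z
  proof (rule tendsto_eventually)
    have "\<forall>\<^sub>F n in sequentially. z \<in> hbox (real (n + 2))"
      using eventually_in_hbox[OF that] by (rule eventually_compose_filterlim) (rule filterlim_add_const_nat_at_top)
    then show "\<forall>\<^sub>F n in sequentially. indicator (hbox (real (n + 2))) z = (1 :: complex)" by eventually_elim simp
  qed
  \<comment> \<open>By the reproducing formula \<open>f\<close> is its own projection, and the
    projections of its cut-offs converge to it in norm, so \<open>L\<close> passes to the limit. For
    the cut-offs \<open>functional_Pop\<close> applies, and dominated convergence identifies the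
    limit as the integral.\<close>
  have repr: "L f = (\<integral>z. f z * k z \<partial>dV \<alpha>)" if f: "f \<in> A" for f
  proof -
    note [measurable] = bergman_measurable[OF f]
    have f_hol: "f holomorphic_on \<complex>\<^sub>+" and f0: "\<And>z. z \<notin> \<complex>\<^sub>+ \<Longrightarrow> f z = 0" and f_fin: "cnorm f < top"
      using f unfolding A_iff by auto
    \<comment> \<open>The shift by 2 meets the condition \<open>2 \<le> r\<close> of
      \<open>cutoff_integrable\<close>.\<close>
    define fn where "fn n z = f z * indicator (hbox (real (n + 2))) z" for n z
    have fn: "integrable (dV \<alpha>) (fn n)" for n
      unfolding fn_def by (rule cutoff_integrable[OF holomorphic_on_imp_continuous_on[OF f_hol] f0]) auto
    have [measurable]: "fn n \<in> borel_measurable borel" for n unfolding fn_def by measurable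
    have supp: "\<forall>z. z \<notin> hbox (real (n + 2)) \<longrightarrow> fn n z = 0" for n by (simp add: fn_def)
    have n1: "1 \<le> real (n + 2)" for n by simp
    have fn_lim: "(\<lambda>n. fn n z) \<longlonglongrightarrow> f z" for z
      using tendsto_mult[OF tendsto_const ind_lim, of z "f z"] f0[of z] by (cases "z \<in> \<complex>\<^sub>+") (simp_all add: fn_def)
    note PA = Pop_in_A[OF fn supp n1]
    have int: "integrable (dV \<alpha>) (\<lambda>z. f z * k z)"
      using f_fin norm_k by (intro bergman_pairing_integrable[OF slow dual_weight pq]) auto
    have "(\<lambda>n. L (Pop \<alpha> (fn n))) \<longlonglongrightarrow> (\<integral>z. f z * k z \<partial>dV \<alpha>)"
      unfolding functional_Pop[OF L fn supp n1] k_def[symmetric]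
    proof (rule integral_dominated_convergence[where w = "\<lambda>z. cmod (f z * k z)"])
      show "AE z in dV \<alpha>. (\<lambda>n. fn n z * k z) \<longlonglongrightarrow> f z * k z"
        by (intro AE_I2 tendsto_intros fn_lim)
      show "AE z in dV \<alpha>. norm (fn n z * k z) \<le> cmod (f z * k z)" for n
        by (rule AE_I2) (simp add: fn_def indicator_def norm_mult)
    qed (use int in auto)
    moreover have "(\<lambda>n. L (Pop \<alpha> (fn n))) \<longlonglongrightarrow> L f"
    proof -
      define dn where "dn n = (\<lambda>z. f z - fn n z)" for n
      have [measurable]: "dn n \<in> borel_measurable borel" for n unfolding dn_def by measurable
      have le: "ennreal (cmod (L f - L (Pop \<alpha> (fn n)))) \<le> ennreal (C * CP) * cnorm (dn n)" for n
      proof -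
        have "f w - Pop \<alpha> (fn n) w = Pop \<alpha> (dn n) w" if w: "w \<in> \<complex>\<^sub>+" for w
          using bergman_reproducing[OF slow dual_weight pq \<alpha> f w] Pop_kernel_integrable[OF fn[of n] supp[of n] n1[of n], of w]
          by (simp add: Pop_def dn_def left_diff_distrib)
        then have e: "cnorm (\<lambda>w. f w - Pop \<alpha> (fn n) w) = cnorm (Pop \<alpha> (dn n))"
          by (intro mixed_norm_cong[OF slow(1)]) simp
        have "cmod (L f - L (Pop \<alpha> (fn n))) \<le> C * N (\<lambda>w. f w - Pop \<alpha> (fn n) w)"
          using C(2)[OF A_diff[OF f PA]] by (simp add: functional_diff[OF L f PA])
        then have "ennreal (cmod (L f - L (Pop \<alpha> (fn n)))) \<le> ennreal (C * N (\<lambda>w. f w - Pop \<alpha> (fn n) w))" by (rule ennreal_leI)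
        also have "\<dots> = ennreal C * cnorm (Pop \<alpha> (dn n))"
          using C(1) by (simp add: ennreal_mult N_nonneg N_eq[OF A_diff[OF f PA]] e)
        also have "\<dots> \<le> ennreal C * (ennreal CP * cnorm (dn n))" by (intro mult_left_mono CP(2)) auto
        also have "\<dots> = ennreal (C * CP) * cnorm (dn n)" using C(1) CP(1) by (simp add: ennreal_mult mult.assoc)
        finally show ?thesis .
      qed
      have "(\<lambda>n. cnorm (dn n)) \<longlonglongrightarrow> 0"
      proof (rule mixed_norm_dominated[OF slow(1) pq0(1,2) _ _ _ f_fin])
        show "ennreal (cmod (dn n z)) \<le> ennreal (cmod (f z))" for n z
          by (auto simp: dn_def fn_def indicator_def intro!: ennreal_leI)
        have "(\<lambda>n. cmod (f z - fn n z)) \<longlonglongrightarrow> cmod (f z - f z)" for z by (intro tendsto_intros fn_lim)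
        then show "(\<lambda>n. ennreal (cmod (dn n z))) \<longlonglongrightarrow> 0" for z
          unfolding dn_def using tendsto_ennrealI[of "\<lambda>n. cmod (f z - fn n z)" 0] by simp
      qed auto
      then have "(\<lambda>n. ennreal (C * CP) * cnorm (dn n)) \<longlonglongrightarrow> ennreal (C * CP) * 0"
        by (intro ennreal_tendsto_cmult) simp
      then have "(\<lambda>n. ennreal (cmod (L f - L (Pop \<alpha> (fn n))))) \<longlonglongrightarrow> ennreal 0"
        by (intro tendsto_sandwich[OF _ _ tendsto_const, where g = "\<lambda>n. ennreal (cmod (L f - L (Pop \<alpha> (fn n))))"]) (use le in auto)
      then have "(\<lambda>n. cmod (L f - L (Pop \<alpha> (fn n)))) \<longlonglongrightarrow> 0" by (rule tendsto_ennrealD) auto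
      then have "(\<lambda>n. L f - L (Pop \<alpha> (fn n))) \<longlonglongrightarrow> 0" by (rule tendsto_norm_zero_cancel)
      then have "(\<lambda>n. L f - (L f - L (Pop \<alpha> (fn n)))) \<longlonglongrightarrow> L f - 0" by (intro tendsto_intros)
      then show ?thesis by simp
    qed
    ultimately show ?thesis by (rule LIMSEQ_unique[symmetric])
  qed
  \<comment> \<open>The formula for \<open>L\<close>, applied to \<open>K w\<close>, shows that
    \<open>g\<close> is reproduced by the projection before \<open>g\<close> is known to be
    holomorphic.\<close>
  have g_Pop: "integrable (dV \<alpha>) (\<lambda>z. g z * K z w)" "g w = Pop \<alpha> g w" if w: "w \<in> \<complex>\<^sub>+" for w
  proof -
    have [measurable]: "K w \<in> borel_measurable borel" by (rule bkernel_measurable[OF w])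
    have e: "g z * K z w = cnj (K w z * k z)" for z
      using cnj_bkernel[OF w, of z] by (cases "z \<in> \<complex>\<^sub>+") (simp_all add: g_def k0)
    have "integrable (dV \<alpha>) (\<lambda>z. K w z * k z)"
      using K_in_A[OF w] norm_k unfolding A_iff by (intro bergman_pairing_integrable[OF slow dual_weight pq]) auto
    then show "integrable (dV \<alpha>) (\<lambda>z. g z * K z w)" unfolding e by (rule integrable_cnj)
    have "g w = cnj (L (K w))" using w by (simp add: g_def k_def kernel_value_def)
    also have "\<dots> = Pop \<alpha> g w" unfolding Pop_def e repr[OF K_in_A[OF w]] by (rule Bochner_Integration.integral_cnj[symmetric])
    finally show "g w = Pop \<alpha> g w" .
  qed
  define gn where "gn n z = g z * indicator (hbox (real (n + 2))) z" for n z
  have gn: "integrable (dV \<alpha>) (gn n)" for n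
    unfolding gn_def by (rule cutoff_integrable[OF g_cont g0]) auto
  have [measurable]: "gn n \<in> borel_measurable borel" for n unfolding gn_def by measurable
  have supp: "\<forall>z. z \<notin> hbox (real (n + 2)) \<longrightarrow> gn n z = 0" for n by (simp add: gn_def)
  have n1: "1 \<le> real (n + 2)" for n by simp
  \<comment> \<open>For \<open>w\<close> in a fixed box the kernel is at most a constant times
    \<open>kmaj \<alpha> \<i> z\<close>, so that constant times \<open>\<epsilon> n\<close> bounds
    the distance from \<open>g\<close> to the holomorphic function
    \<open>Pop \<alpha> (gn n)\<close> uniformly there.\<close>
  define \<epsilon> where "\<epsilon> n = (\<integral>z. cmod (g z - gn n z) * kmaj \<alpha> \<i> z \<partial>dV \<alpha>)" for n
  have gk: "integrable (dV \<alpha>) (\<lambda>z. cmod (g z) * kmaj \<alpha> \<i> z)"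
  proof (rule integrableI_nonneg)
    have "(\<integral>\<^sup>+ z. ennreal (cmod (g z) * kmaj \<alpha> \<i> z) \<partial>dV \<alpha>) = (\<integral>\<^sup>+ z. ennreal (kmaj \<alpha> \<i> z) * ennreal (cmod (g z)) \<partial>dV \<alpha>)"
      by (simp add: ennreal_mult mult.commute)
    also have "\<dots> \<le> mixed_norm p q \<Omega> \<alpha> (\<lambda>z. ennreal (kmaj \<alpha> \<i> z)) * cnorm' g"
      by (rule mixed_norm_Hoelder[OF slow dual_weight pq]) auto
    also have "\<dots> < \<infinity>"
      using norm_k mixed_norm_kmaj_finite[OF slow(1) pq(1,2) \<alpha>, of \<i>] by (simp add: ennreal_mult_less_top upper_half_plane_def)
    finally show "(\<integral>\<^sup>+ z. ennreal (cmod (g z) * kmaj \<alpha> \<i> z) \<partial>dV \<alpha>) < \<infinity>" .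
  qed auto
  have dn_le: "cmod (g z - gn n z) \<le> cmod (g z)" for n z by (auto simp: gn_def indicator_def)
  have gnk: "integrable (dV \<alpha>) (\<lambda>z. cmod (g z - gn n z) * kmaj \<alpha> \<i> z)" for n
    by (rule Bochner_Integration.integrable_bound[OF gk]) (auto intro!: mult_right_mono dn_le simp: abs_mult)
  have \<epsilon>0: "0 \<le> \<epsilon> n" for n by (simp add: \<epsilon>_def)
  have \<epsilon>_lim: "\<epsilon> \<longlonglongrightarrow> 0"
  proof -
    have "\<epsilon> \<longlonglongrightarrow> (\<integral>z. 0 \<partial>dV \<alpha>)"
      unfolding \<epsilon>_def
    proof (rule integral_dominated_convergence[where w = "\<lambda>z. cmod (g z) * kmaj \<alpha> \<i> z"])
      show "AE z in dV \<alpha>. (\<lambda>n. cmod (g z - gn n z) * kmaj \<alpha> \<i> z) \<longlonglongrightarrow> 0"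
      proof (rule AE_I2)
        fix z
        have "(\<lambda>n. gn n z) \<longlonglongrightarrow> g z"
          using tendsto_mult[OF tendsto_const ind_lim, of z "g z"] g0[of z] by (cases "z \<in> \<complex>\<^sub>+") (simp_all add: gn_def)
        then have "(\<lambda>n. cmod (g z - gn n z) * kmaj \<alpha> \<i> z) \<longlonglongrightarrow> cmod (g z - g z) * kmaj \<alpha> \<i> z" by (intro tendsto_intros)
        then show "(\<lambda>n. cmod (g z - gn n z) * kmaj \<alpha> \<i> z) \<longlonglongrightarrow> 0" by simp
      qed
      show "AE z in dV \<alpha>. norm (cmod (g z - gn n z) * kmaj \<alpha> \<i> z) \<le> cmod (g z) * kmaj \<alpha> \<i> z" for n
        by (rule AE_I2) (auto intro!: mult_right_mono dn_le simp: abs_mult)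
    qed (use gk in auto)
    then show ?thesis by simp
  qed
  have "g holomorphic_on \<complex>\<^sub>+"
  proof (rule holomorphic_uniform_sequence[OF open_upper_half_plane])
    show "Pop \<alpha> (gn n) holomorphic_on \<complex>\<^sub>+" for n using Pop_in_A[OF gn supp n1] A_iff by blast
    fix x assume x: "x \<in> \<complex>\<^sub>+"
    obtain r where r: "2 \<le> r" "x \<in> hbox r" using hbox_exists[OF x] .
    have r2: "1 \<le> 2 * r" using r by simp
    define c where "c = kconst \<alpha> * (1 + 3 * (2 * r)\<^sup>2) powr (\<alpha> + 2)"
    have c: "0 \<le> c" using kconst_pos[OF \<alpha>] by (simp add: c_def)
    have ball: "cball x (1 / (2 * r)) \<subseteq> hbox (2 * r)"
    proof
      fix y assume "y \<in> cball x (1 / (2 * r))"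
      then show "y \<in> hbox (2 * r)" using r by (intro hbox_nbhd[of r x]) (auto simp: dist_norm)
    qed
    have le: "cmod (g w - Pop \<alpha> (gn n) w) \<le> c * \<epsilon> n" if w: "w \<in> hbox (2 * r)" for w n
    proof -
      have wH: "w \<in> \<complex>\<^sub>+" using hbox_in_half_plane[OF r2 w] .
      note i = g_Pop(1)[OF wH] Pop_kernel_integrable[OF gn[of n] supp[of n] n1[of n], of w]
      have "g w - Pop \<alpha> (gn n) w = (\<integral>z. g z * K z w - gn n z * K z w \<partial>dV \<alpha>)"
        using i g_Pop(2)[OF wH] by (simp add: Pop_def)
      also have "cmod \<dots> \<le> (\<integral>z. cmod (g z * K z w - gn n z * K z w) \<partial>dV \<alpha>)" by (rule integral_norm_bound)
      also have "\<dots> \<le> (\<integral>z. c * (cmod (g z - gn n z) * kmaj \<alpha> \<i> z) \<partial>dV \<alpha>)"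
      proof (rule integral_mono)
        fix z
        show "cmod (g z * K z w - gn n z * K z w) \<le> c * (cmod (g z - gn n z) * kmaj \<alpha> \<i> z)"
        proof (cases "z \<in> \<complex>\<^sub>+")
          case True
          have "cmod (K z w) = cmod (K w z)" using cnj_bkernel[OF wH True] by (metis complex_mod_cnj)
          also have "\<dots> \<le> c * kmaj \<alpha> \<i> z" unfolding c_def by (rule cmod_bkernel_le_ii[OF \<alpha> r2 w True])
          finally have "cmod (g z - gn n z) * cmod (K z w) \<le> cmod (g z - gn n z) * (c * kmaj \<alpha> \<i> z)" by (rule mult_left_mono) simp
          then show ?thesis by (simp add: norm_mult mult_ac flip: left_diff_distrib)
        qed (simp add: g0 gn_def)
      qed (use i gnk in auto)
      also have "\<dots> = c * \<epsilon> n" by (simp add: \<epsilon>_def)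
      finally show ?thesis .
    qed
    have "uniform_limit (cball x (1 / (2 * r))) (\<lambda>n. Pop \<alpha> (gn n)) g sequentially"
    proof (rule uniform_limitI)
      fix e :: real assume "0 < e"
      have "(\<lambda>n. c * \<epsilon> n) \<longlonglongrightarrow> c * 0" by (intro tendsto_intros \<epsilon>_lim)
      then have "\<forall>\<^sub>F n in sequentially. c * \<epsilon> n < e" using \<open>0 < e\<close> by (intro order_tendstoD(2)) auto
      then show "\<forall>\<^sub>F n in sequentially. \<forall>w\<in>cball x (1 / (2 * r)). dist (Pop \<alpha> (gn n) w) (g w) < e"
      proof eventually_elim
        case (elim n)
        then show ?case using le[of _ n] ball by (fastforce simp: dist_norm norm_minus_commute)
      qed
    qed
    then show "\<exists>d>0. cball x d \<subseteq> \<complex>\<^sub>+ \<and> uniform_limit (cball x d) (\<lambda>n. Pop \<alpha> (gn n)) g sequentially"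
      using r ball hbox_subset[OF r2] by (intro exI[of _ "1 / (2 * r)"]) auto
  qed
  then have gA: "g \<in> A'" using norm_k g0 by (simp add: A'_iff)
  moreover have "N' g \<le> C * CP"
    using norm_g C(1) CP(1) unfolding N'_eq[OF gA, symmetric] by simp
  moreover have "\<forall>f\<in>A. L f = pairing \<alpha> f g" using repr by (simp add: pairing_def g_def)
  ultimately show ?thesis by blast
qed

lemma representation_unique:
  assumes g: "g1 \<in> A'" "g2 \<in> A'" and eq: "\<And>f. f \<in> A \<Longrightarrow> pairing \<alpha> f g1 = pairing \<alpha> f g2"
  shows "g1 = g2"
proof
  fix w
  show "g1 w = g2 w"
  proof (cases "w \<in> \<complex>\<^sub>+")
    case True
    then have "cnj (g1 w) = cnj (g2 w)"
      using eq[OF K_in_A[OF True]] pairing_kernel g by simp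
    then show ?thesis by simp
  qed (use g in \<open>simp add: A'_iff\<close>)
qed

text \<open>The upper constant 1 is Hoelder's inequality. For the lower one,
  \<open>representation\<close> is applied to the functional of \<open>g\<close> itself with its
  functional norm as bound; uniqueness returns \<open>g\<close>, now with \<open>N' g\<close> at
  most \<open>CP\<close> times that norm.\<close>

theorem duality:
  "(\<forall>g\<in>A'. (\<forall>f\<in>A. integrable (dV \<alpha>) (\<lambda>z. f z * cnj (g z))) \<and> bounded_functional A N (\<lambda>f. pairing \<alpha> f g)) \<and>
   (\<forall>L. bounded_functional A N L \<longrightarrow> (\<exists>!g. g \<in> A' \<and> (\<forall>f\<in>A. L f = pairing \<alpha> f g))) \<and>
   (\<exists>c>0. \<exists>C>0. \<forall>g\<in>A'. c * N' g \<le> functional_norm A N (\<lambda>f. pairing \<alpha> f g) \<and>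
      functional_norm A N (\<lambda>f. pairing \<alpha> f g) \<le> C * N' g)"
proof (intro conjI)
  obtain CP where CP: "0 < CP" "\<And>h. h \<in> borel_measurable borel \<Longrightarrow> cnorm (Pop \<alpha> h) \<le> ennreal CP * cnorm h"
    using Pop_bounded[OF slow(1) pq(1,2) \<alpha>] by blast
  show "\<forall>g\<in>A'. (\<forall>f\<in>A. integrable (dV \<alpha>) (\<lambda>z. f z * cnj (g z))) \<and> bounded_functional A N (\<lambda>f. pairing \<alpha> f g)"
    using pairing_integrable pairing_functional by blast
  show "\<forall>L. bounded_functional A N L \<longrightarrow> (\<exists>!g. g \<in> A' \<and> (\<forall>f\<in>A. L f = pairing \<alpha> f g))"
  proof (intro allI impI)
    fix L assume L: "bounded_functional A N L"
    obtain C where C: "0 \<le> C" "\<And>f. f \<in> A \<Longrightarrow> cmod (L f) \<le> C * N f" using functional_bound[OF L] by blast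
    obtain g where g: "g \<in> A'" "\<forall>f\<in>A. L f = pairing \<alpha> f g" using representation[OF L C CP] by blast
    then show "\<exists>!g. g \<in> A' \<and> (\<forall>f\<in>A. L f = pairing \<alpha> f g)"
      by (intro ex1I[of _ g]) (auto intro!: representation_unique)
  qed
  have "(1 / CP) * N' g \<le> functional_norm A N (\<lambda>f. pairing \<alpha> f g) \<and> functional_norm A N (\<lambda>f. pairing \<alpha> f g) \<le> 1 * N' g"
    if g: "g \<in> A'" for g
  proof -
    define F where "F = functional_norm A N (\<lambda>f. pairing \<alpha> f g)"
    have N'0: "0 \<le> N' g" by (simp add: bergman_norm_def)
    have le: "cmod (pairing \<alpha> f g) \<le> N' g" if "f \<in> A" "N f \<le> 1" for f
      using pairing_le[OF that(1) g] mult_right_mono[OF that(2) N'0] by simp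
    \<comment> \<open>The supremum of reals behaves well only for a nonempty set bounded above; the
      zero function and Hoelder's inequality provide this.\<close>
    have zero: "(\<lambda>z. 0) \<in> {f \<in> A. N f \<le> 1}" using A_zero by simp
    have F_upper: "F \<le> N' g"
      unfolding F_def functional_norm_def using zero le by (intro cSUP_least) auto
    have bdd: "bdd_above ((\<lambda>f. cmod (pairing \<alpha> f g)) ` {f \<in> A. N f \<le> 1})" using le by (intro bdd_aboveI2) auto
    have F0: "0 \<le> F"
      unfolding F_def functional_norm_def by (rule cSUP_upper2[OF bdd zero]) simp
    have "cmod (pairing \<alpha> f g) \<le> F * N f" if f: "f \<in> A" for f
    proof (cases "N f = 0")
      case True
      then show ?thesis using pairing_le[OF f g] by simp
    next
      case False
      then have N0: "0 < N f" using N_nonneg[of f] by simp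
      define c where "c = complex_of_real (1 / N f)"
      have cf: "(\<lambda>z. c * f z) \<in> A" "N (\<lambda>z. c * f z) = 1" using A_scale[OF f, of c] N0 by (auto simp: c_def norm_divide)
      have "cmod (pairing \<alpha> (\<lambda>z. c * f z) g) \<le> F"
        unfolding F_def functional_norm_def by (rule cSUP_upper[OF _ bdd]) (use cf in auto)
      also have "pairing \<alpha> (\<lambda>z. c * f z) g = c * pairing \<alpha> f g" by (rule functional_scale[OF pairing_functional[OF g] f])
      finally show ?thesis using N0 by (simp add: c_def norm_mult norm_divide field_simps)
    qed
    from representation[OF pairing_functional[OF g] F0 this CP]
    obtain g2 where g2: "g2 \<in> A'" "\<forall>f\<in>A. pairing \<alpha> f g = pairing \<alpha> f g2" "N' g2 \<le> F * CP" by blast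
    then have "g2 = g" using representation_unique[OF g2(1) g] by simp
    then show ?thesis using g2(3) F_upper CP(1) by (simp add: F_def[symmetric] field_simps)
  qed
  then show "\<exists>c>0. \<exists>C>0. \<forall>g\<in>A'. c * N' g \<le> functional_norm A N (\<lambda>f. pairing \<alpha> f g) \<and>
      functional_norm A N (\<lambda>f. pairing \<alpha> f g) \<le> C * N' g"
    using CP(1) by (intro exI[of _ "1 / CP"] exI[of _ 1] conjI) auto
qed

end

text \<open>Integrability of the product is asserted separately, because the integral of a
  non-integrable function is 0 by convention and the pairing alone would not exclude that
  case.\<close>

theorem proposition7:
  fixes p q p' q' \<alpha> k :: real and \<Phi> \<omega> :: "real \<Rightarrow> real" and \<epsilon> :: "nat \<times> nat"
  assumes "1 < p" and "1 < q"
    and "1 / p + 1 / p' = 1" and "1 / q + 1 / q' = 1"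
    and "\<alpha> > -1"
    and "\<Phi> \<in> \<L> \<union> \<U>"
    and "\<epsilon> \<in> {0, 1} \<times> {0, 1}"
  defines "\<omega> \<equiv> T_weight \<Phi> \<epsilon>"
  defines "A \<equiv> bergman p q (\<lambda>y. \<omega> y powr k) \<alpha>"
    and "N \<equiv> bergman_norm p q (\<lambda>y. \<omega> y powr k) \<alpha>"
    and "A' \<equiv> bergman p' q' (\<lambda>y. \<omega> y powr (k * (1 - q'))) \<alpha>"
    and "N' \<equiv> bergman_norm p' q' (\<lambda>y. \<omega> y powr (k * (1 - q'))) \<alpha>"
  shows "(\<forall>g\<in>A'. (\<forall>f\<in>A. integrable (dV \<alpha>) (\<lambda>z. f z * cnj (g z))) \<and>
                  bounded_functional A N (\<lambda>f. pairing \<alpha> f g)) \<and>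
         (\<forall>L. bounded_functional A N L \<longrightarrow> (\<exists>!g. g \<in> A' \<and> (\<forall>f\<in>A. L f = pairing \<alpha> f g))) \<and>
         (\<exists>c>0. \<exists>C>0. \<forall>g\<in>A'. c * N' g \<le> functional_norm A N (\<lambda>f. pairing \<alpha> f g) \<and>
                               functional_norm A N (\<lambda>f. pairing \<alpha> f g) \<le> C * N' g)"
proof -
  \<comment> \<open>The weights form a dual pair because raising \<open>\<omega> y powr k\<close> to
    the power \<open>1 - q'\<close> multiplies the exponents.\<close>
  interpret B: bergman_pair p q p' q' \<alpha> "\<lambda>y. \<omega> y powr k" "\<lambda>y. \<omega> y powr (k * (1 - q'))"
  proof
    show "slow_weight (\<lambda>y. \<omega> y powr k)" "slow_weight (\<lambda>y. \<omega> y powr (k * (1 - q')))"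
      using slow_weight_T_weight[OF assms(6)] unfolding \<omega>_def by auto
  qed (use assms(1-5) in \<open>auto simp: powr_powr\<close>)
  show ?thesis
    using B.duality unfolding A_def N_def A'_def N'_def .
qed

end
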